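(* There exists a sequence of properly embedded minimal disks $\Sigma_i$ ($i\in\mathbb N$) with $0\in\Sigma_i\subset\{x_1^2+x_2^2\le 1,\ x_3\in\mathbb R\}\subset\mathbb R^3$, each containing the $x_3$-axis, i.e. $\{(0,0,t)\mid t\in\mathbb R\}\subset\Sigma_i$, such that the following conditions are satisfied: (1) $\lim_{i\to\infty}|A_{\Sigma_i}|^2(0)=\infty$; (2) $\sup_i\sup_{\Sigma_i\setminus B_\delta}|A_{\Sigma_i}|^2<\infty$ for all $\delta>0$; (3) for each $i$, $\Sigma_i\setminus\{x_3\text{-axis}\}=\Sigma_{1,i}\cup\Sigma_{2,i}$ for multi-valued graphs $\Sigma_{1,i}$ and $\Sigma_{2,i}$; (4) $\Sigma_i\setminus\{x_3=0\}$ converges to two embedded minimal disks $\Sigma^{\pm}\subset\{\pm x_3>0\}$ with $\overline{\Sigma^{\pm}}\setminus\Sigma^{\pm}=\{x_1^2+x_2^2\le 1,\ x_3=0\}$. Moreover, $\Sigma^{\pm}\setminus\{x_3\text{-axis}\}=\Sigma^{\pm}_1\cup\Sigma^{\pm}_2$ for multi-valued graphs $\Sigma^{\pm}_1$ and $\Sigma^{\pm}_2$, each of which spirals into $\{x_3=0\}$.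
   Context: $(x_1,x_2,x_3)$ are the standard coordinates on Euclidean $\mathbb R^3$; $B_\delta$ is the Euclidean ball of radius $\delta$ centred at the origin; $A_\Sigma$ is the second fundamental form of a surface $\Sigma$ (for a minimal surface $|A_\Sigma|^2=-2\mathbf K_\Sigma$, with $\mathbf K_\Sigma$ the Gauss curvature). Closures are taken in $\mathbb R^3$. A "disk" is a simply connected, non-compact or compact surface (possibly with boundary) whose interior is homeomorphic to an open disk. A disk contained in the closed solid cylinder $\{x_1^2+x_2^2\le 1\}$ is properly embedded if it is embedded, its inclusion into the closed solid cylinder is a proper map, and its boundary lies in $\{x_1^2+x_2^2=1\}$ while its interior lies in $\{x_1^2+x_2^2<1\}$. Multi-valued graph: let $\mathcal P=\{(\rho,\theta)\mid \rho>0,\ \theta\in\mathbb R\}$ be the universal cover of $\mathbb C\setminus\{0\}$ with its global polar coordinates. A surface is a multi-valued graph if it is of the form $\{(\rho\cos\theta,\rho\sin\theta,u(\rho,\theta))\mid(\rho,\theta)\in U\}$ for some connected region $U\subset\mathcal P$ and some function $u$ on $U$. A multi-valued graph in $\{0<x_1^2+x_2^2\le 1\}$ spirals into $\{x_3=0\}$ if it is $\infty$-valued, i.e. $U$ contains $\{0<\rho<1,\ \theta>\theta_0\}$ or $\{0<\rho<1,\ \theta<-\theta_0\}$ for some $\theta_0$, and $u(\rho,\theta)\to 0$ as $\theta\to+\infty$ (respectively $\theta\to-\infty$). In (4), convergence is understood as convergence of (parametrized) surfaces, uniformly in $C^2$ on compact subsets, away from $\{x_3=0\}$; $\Sigma^+$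 is the limit in $\{x_3>0\}$ and $\Sigma^-$ is the limit in $\{x_3<0\}$. *)

theory Defs
  imports "HOL-Analysis.Analysis"
begin

definition pd :: "2 \<Rightarrow> (real^2 \<Rightarrow> real^3) \<Rightarrow> real^2 \<Rightarrow> real^3" where
  "pd i f u = frechet_derivative f (at u) (axis i 1)"

text \<open>Meaningful for open \<open>V\<close>, where being \<open>k + 1\<close> times continuously differentiable amounts to
  being differentiable with \<open>k\<close> times continuously differentiable partial derivatives.\<close>

primrec Ck_on :: "nat \<Rightarrow> (real^2 \<Rightarrow> real^3) \<Rightarrow> (real^2) set \<Rightarrow> bool" where
  "Ck_on 0 f V \<longleftrightarrow> continuous_on V f"
| "Ck_on (Suc k) f V \<longleftrightarrow> f differentiable_on V \<and> (\<forall>i. Ck_on k (pd i f) V)"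

definition smooth_on :: "(real^2 \<Rightarrow> real^3) \<Rightarrow> (real^2) set \<Rightarrow> bool" where
  "smooth_on f V \<longleftrightarrow> (\<forall>k. Ck_on k f V)"

text \<open>The parameter set \<open>D\<close> may contain boundary points. Smoothness there means that \<open>f\<close> is smooth
  on a neighbourhood of \<open>D\<close>. If \<open>D\<close> lies in the closure of its interior, as it does in all uses
  below, the derivatives of \<open>f\<close> at points of \<open>D\<close> are determined by \<open>f\<close> on \<open>D\<close>.\<close>

definition regular_param :: "(real^2 \<Rightarrow> real^3) \<Rightarrow> (real^2) set \<Rightarrow> (real^3) set \<Rightarrow> bool" where
  "regular_param f D S \<longleftrightarrow>
     (\<exists>V. open V \<and> D \<subseteq> V \<and> smooth_on f V) \<and>
     (\<forall>u\<in>D. inj (frechet_derivative f (at u))) \<and>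
     (\<exists>g. homeomorphism D S f g)"

definition half_plane :: "(real^2) set" where
  "half_plane = {u. 0 \<le> u $ 2}"

text \<open>Charts around interior points are those whose domain avoids the line \<open>u $ 2 = 0\<close>.\<close>

definition surface_chart :: "(real^3) set \<Rightarrow> (real^2 \<Rightarrow> real^3) \<Rightarrow> (real^2) set \<Rightarrow> bool" where
  "surface_chart S f D \<longleftrightarrow>
     openin (top_of_set half_plane) D \<and> openin (top_of_set S) (f ` D) \<and> regular_param f D (f ` D)"

definition embedded_surface :: "(real^3) set \<Rightarrow> bool" where
  "embedded_surface S \<longleftrightarrow> (\<forall>p\<in>S. \<exists>f D. surface_chart S f D \<and> p \<in> f ` D)"

definition surface_boundary :: "(real^3) set \<Rightarrow> (real^3) set" where
  "surface_boundary S = {p. \<exists>f D u. surface_chart S f D \<and> u \<in> D \<and> u $ 2 = 0 \<and> f u = p}"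

definition surface_interior :: "(real^3) set \<Rightarrow> (real^3) set" where
  "surface_interior S = S - surface_boundary S"

definition embedded_disk :: "(real^3) set \<Rightarrow> bool" where
  "embedded_disk S \<longleftrightarrow>
     embedded_surface S \<and> simply_connected S \<and>
     surface_interior S homeomorphic (ball 0 1 :: (real^2) set)"

definition unit_normal :: "(real^2 \<Rightarrow> real^3) \<Rightarrow> real^2 \<Rightarrow> real^3" where
  "unit_normal f u = (cross3 (pd 1 f u) (pd 2 f u)) /\<^sub>R norm (cross3 (pd 1 f u) (pd 2 f u))"

definition first_form :: "(real^2 \<Rightarrow> real^3) \<Rightarrow> real^2 \<Rightarrow> real^2^2" where
  "first_form f u = (\<chi> i j. pd i f u \<bullet> pd j f u)"

definition second_form :: "(real^2 \<Rightarrow> real^3) \<Rightarrow> real^2 \<Rightarrow> real^2^2" where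
  "second_form f u = (\<chi> i j. pd i (pd j f) u \<bullet> unit_normal f u)"

definition shape_operator :: "(real^2 \<Rightarrow> real^3) \<Rightarrow> real^2 \<Rightarrow> real^2^2" where
  "shape_operator f u = matrix_inv (first_form f u) ** second_form f u"

definition mean_curvature :: "(real^2 \<Rightarrow> real^3) \<Rightarrow> real^2 \<Rightarrow> real" where
  "mean_curvature f u = trace (shape_operator f u) / 2"

definition minimal_surface :: "(real^3) set \<Rightarrow> bool" where
  "minimal_surface S \<longleftrightarrow>
     embedded_surface S \<and> (\<forall>f D u. surface_chart S f D \<and> u \<in> D \<longrightarrow> mean_curvature f u = 0)"

text \<open>\<open>|A|\<^sup>2 = g\<^sup>i\<^sup>k g\<^sup>j\<^sup>l A\<^sub>i\<^sub>j A\<^sub>k\<^sub>l\<close> at the point \<open>p\<close> of \<open>S\<close> is the trace of the square of the shape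
  operator, which is the same for every chart around \<open>p\<close>.\<close>

definition norm_A_sq :: "(real^3) set \<Rightarrow> real^3 \<Rightarrow> real" where
  "norm_A_sq S p =
     (THE a. \<exists>f D u. surface_chart S f D \<and> u \<in> D \<and> f u = p \<and>
        a = trace (shape_operator f u ** shape_operator f u))"

definition solid_cylinder :: "(real^3) set" where
  "solid_cylinder = {x. (x$1)\<^sup>2 + (x$2)\<^sup>2 \<le> 1}"

definition x3_axis :: "(real^3) set" where
  "x3_axis = {vector [0, 0, t] | t. True}"

definition properly_embedded_disk :: "(real^3) set \<Rightarrow> bool" where
  "properly_embedded_disk S \<longleftrightarrow>
     embedded_disk S \<and> S \<subseteq> solid_cylinder \<and>
     proper_map (top_of_set S) (top_of_set solid_cylinder) (\<lambda>x. x) \<and>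
     surface_boundary S \<subseteq> {x. (x$1)\<^sup>2 + (x$2)\<^sup>2 = 1} \<and>
     surface_interior S \<subseteq> {x. (x$1)\<^sup>2 + (x$2)\<^sup>2 < 1}"

definition polar_cover :: "(real \<times> real) set" where
  "polar_cover = {(\<rho>, \<theta>). \<rho> > 0}"

text \<open>A region may contain part of its boundary.\<close>

definition region :: "(real \<times> real) set \<Rightarrow> bool" where
  "region U \<longleftrightarrow> U \<noteq> {} \<and> connected (interior U) \<and> U \<subseteq> closure (interior U)"

definition multi_graph_of :: "(real \<times> real) set \<Rightarrow> (real \<times> real \<Rightarrow> real) \<Rightarrow> (real^3) set \<Rightarrow> bool" where
  "multi_graph_of U u S \<longleftrightarrow>
     region U \<and> U \<subseteq> polar_cover \<and> continuous_on U u \<and> embedded_surface S \<and>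
     S = {vector [\<rho> * cos \<theta>, \<rho> * sin \<theta>, u (\<rho>, \<theta>)] | \<rho> \<theta>. (\<rho>, \<theta>) \<in> U}"

definition multi_valued_graph :: "(real^3) set \<Rightarrow> bool" where
  "multi_valued_graph S \<longleftrightarrow> (\<exists>U u. multi_graph_of U u S)"

text \<open>The limits are taken over all \<open>(\<rho>, \<theta>) \<in> U\<close> with only \<open>\<theta>\<close> prescribed to tend to infinity.\<close>

definition spiraling_multi_graph :: "(real^3) set \<Rightarrow> bool" where
  "spiraling_multi_graph S \<longleftrightarrow>
     S \<subseteq> {x. 0 < (x$1)\<^sup>2 + (x$2)\<^sup>2 \<and> (x$1)\<^sup>2 + (x$2)\<^sup>2 \<le> 1} \<and>
     (\<exists>U u. multi_graph_of U u S \<and>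
        ((\<exists>\<theta>\<^sub>0. {(\<rho>, \<theta>). 0 < \<rho> \<and> \<rho> < 1 \<and> \<theta> > \<theta>\<^sub>0} \<subseteq> U) \<and>
           (u \<longlongrightarrow> 0) (inf (filtercomap snd at_top) (principal U))
       \<or> (\<exists>\<theta>\<^sub>0. {(\<rho>, \<theta>). 0 < \<rho> \<and> \<rho> < 1 \<and> \<theta> < - \<theta>\<^sub>0} \<subseteq> U) \<and>
           (u \<longlongrightarrow> 0) (inf (filtercomap snd at_bot) (principal U))))"

text \<open>Convergence of the parts of \<open>S i\<close> in the open set \<open>\<Omega>\<close> to \<open>T\<close>, uniformly in \<open>C\<^sup>2\<close> on compact
  subsets of the parameter domain of \<open>T\<close>. By the last clause the part of \<open>S i\<close> in a given compact
  subset of \<open>\<Omega>\<close> is covered by a fixed compact set of parameters, so that no piece of \<open>S i\<close>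
  is left out in the limit. One parameter domain in the plane suffices for each surface since
  the definition is used for disks.\<close>

definition C2_converges_in ::
  "(real^3) set \<Rightarrow> (nat \<Rightarrow> (real^3) set) \<Rightarrow> (real^3) set \<Rightarrow> bool" where
  "C2_converges_in \<Omega> S T \<longleftrightarrow>
     (\<exists>F D F\<^sub>i D\<^sub>i.
        regular_param F D T \<and>
        (\<forall>i. regular_param (F\<^sub>i i) (D\<^sub>i i) (S i \<inter> \<Omega>)) \<and>
        (\<forall>K. compact K \<and> K \<subseteq> D \<longrightarrow>
           (\<forall>\<^sub>F i in sequentially. K \<subseteq> D\<^sub>i i) \<and>
           uniform_limit K F\<^sub>i F sequentially \<and>
           (\<forall>j. uniform_limit K (\<lambda>i. pd j (F\<^sub>i i)) (pd j F) sequentially) \<and>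
           (\<forall>j k. uniform_limit K (\<lambda>i. pd j (pd k (F\<^sub>i i))) (pd j (pd k F)) sequentially)) \<and>
        (\<forall>L. compact L \<and> L \<subseteq> \<Omega> \<longrightarrow>
           (\<exists>K. compact K \<and> K \<subseteq> D \<and>
              (\<forall>\<^sub>F i in sequentially. \<forall>u\<in>D\<^sub>i i. F\<^sub>i i u \<in> L \<longrightarrow> u \<in> K))))"

end

theory Submission
  imports Defs "HOL-Complex_Analysis.Cauchy_Integral_Theorem" "HOL-Real_Asymp.Real_Asymp"
begin

text \<open>
  The surfaces come from the Weierstrass representation. For holomorphic \<open>h = u + i v\<close> on a
  neighbourhood of an interval of the real axis, real on the axis, let \<open>S' = sin h\<close> and
  \<open>C' = cos h\<close>, with \<open>S\<close> and \<open>C\<close> real on the axis. Then \<open>F(x + i y) = (Im S, - Im C, x)\<close> is a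
  conformal minimal immersion with Gauss map \<open>exp (i h)\<close> and height differential \<open>dz\<close>, and it
  maps the real axis to the \<open>x\<^sub>3\<close>-axis. The slice at height \<open>x\<close> is the image of a vertical line, a
  plane curve with velocity \<open>cosh v (sin u, - cos u)\<close>. Hence everything is decided by two
  properties of \<open>h\<close>. If \<open>u\<close> varies little on each vertical segment, then each slice is nearly
  straight, so that the surface is embedded and the distance to the axis increases along each half
  of a slice. If \<open>v\<close> grows fast, then the slices leave the unit cylinder.

  For \<open>a > 0\<close> take \<open>h(z) = (c/a) arctan (z/a)\<close>, so that \<open>h' = c/(z\<^sup>2 + a\<^sup>2)\<close>, with a large constant
  \<open>c\<close>. With \<open>s = sqrt (x\<^sup>2 + a\<^sup>2)\<close> and \<open>\<bar>y\<bar> \<le> s/2\<close>, the derivative of \<open>u\<close> along the slice is at most a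
  multiple of \<open>\<bar>y\<bar>/s\<^sup>3\<close>, and that of \<open>v\<close> is at least a multiple of \<open>1/s\<^sup>2\<close>. For \<open>\<bar>y\<bar>\<close> up to a small multiple of
  \<open>s\<^sup>3\<^sup>/\<^sup>2\<close> the angle \<open>u\<close> therefore varies by at most \<open>1/2\<close>, while \<open>v\<close> reaches a large multiple of
  \<open>s\<^sup>-\<^sup>1\<^sup>/\<^sup>2\<close>, and for small \<open>s\<close> the growth of \<open>cosh v\<close> outweighs the shortness of the segment. So all
  slices reach the cylinder, uniformly in \<open>x\<close> and \<open>a\<close> (\<open>slice_p_exceeds_1\<close>). The squared norm of the second fundamental
  form is \<open>2 \<bar>h'\<bar>\<^sup>2 / cosh\<^sup>4 v\<close>. At the origin it is \<open>2 c\<^sup>2 / a\<^sup>4\<close>. Away from the origin either \<open>s\<close> is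
  bounded below, or \<open>cosh v\<close> is large because the point is far from the axis (\<open>curvature_bound\<close>).

  The normal is horizontal only on the axis, so in polar coordinates of the horizontal plane the
  height is locally a function of \<open>(\<rho>, \<theta>)\<close> on each half of the surface. At fixed \<open>\<rho>\<close> the angle is
  strictly increasing in the height (\<open>theta_derivative\<close>), which makes the halves multi-valued graphs.

  As \<open>a\<close> tends to \<open>0\<close>, the function \<open>h\<close> on a half plane \<open>\<plusminus> Re z > 0\<close> differs from a function that
  tends to \<open>- c/z\<close> by the constant \<open>\<plusminus> c pi / (2 a)\<close>. Only \<open>sin h\<close> and \<open>cos h\<close> enter, so for the values
  of \<open>a\<close> that make this constant a multiple of \<open>2 pi\<close> the surfaces converge on each side, and since
  \<open>- c/x\<close> is unbounded near \<open>0\<close> the limits spiral into the plane \<open>x\<^sub>3 = 0\<close>. All surfaces, the limits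
  included, are parametrized over \<open>J \<times> [-1, 1]\<close> for an interval \<open>J\<close> of heights, by
  \<open>(x, t) \<mapsto> F(x + i t Y(x))\<close> where \<open>Y(x)\<close> solves \<open>\<bar>F\<bar> = 1\<close> in the horizontal plane. The parameter \<open>a\<close>
  is carried along through the whole argument: all partial derivatives are jointly continuous in
  \<open>a\<close> and the point, up to \<open>a = 0\<close>, and convergence in \<open>C\<^sup>2\<close> follows by compactness.

  The curvature conditions speak about every chart of a surface. They reduce to the one explicit
  parametrization (\<open>surface_curvature\<close>): a chart differs from it by a change of coordinates, whose
  differentiability is derived from continuity, and this conjugates the shape operator up to sign.
\<close>

section \<open>Smooth families of functions on the plane\<close>

definition partial :: "2 \<Rightarrow> (real^2 \<Rightarrow> real) \<Rightarrow> real^2 \<Rightarrow> real" where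
  "partial i f p = frechet_derivative f (at p) (axis i 1)"

text \<open>The function \<open>f a\<close> is \<open>k\<close> times differentiable in the planar variable, and all partial
  derivatives up to order \<open>k\<close> are jointly continuous in the parameter and the point. For a single
  parameter this is smoothness of one function. For a compact set of parameters it also gives
  uniform convergence of the derivatives when the parameter converges. One calculus thus serves for
  the regularity of each surface and for the convergence of the sequence.\<close>

primrec Ck_family :: "nat \<Rightarrow> (real \<Rightarrow> real^2 \<Rightarrow> real) \<Rightarrow> (real \<times> (real^2)) set \<Rightarrow> bool" where
  "Ck_family 0 f V \<longleftrightarrow> continuous_on V (\<lambda>(a, p). f a p)"
| "Ck_family (Suc k) f V \<longleftrightarrow> continuous_on V (\<lambda>(a, p). f a p) \<and>
     (\<forall>(a, p)\<in>V. f a differentiable at p) \<and> (\<forall>i. Ck_family k (\<lambda>a. partial i (f a)) V)"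

definition open_slices :: "(real \<times> (real^2)) set \<Rightarrow> bool" where
  "open_slices V \<longleftrightarrow> (\<forall>a. open {p. (a, p) \<in> V})"

lemma partial_eq:
  assumes "(f has_derivative (\<lambda>d. d$1 * g1 + d$2 * g2)) (at p)"
  shows "partial 1 f p = g1" "partial 2 f p = g2"
  using frechet_derivative_at[OF assms] by (simp_all add: partial_def axis_def flip: frechet_derivative_at[OF assms])

lemma has_derivative_partial:
  assumes "f differentiable (at p)"
  shows "(f has_derivative (\<lambda>d. d$1 * partial 1 f p + d$2 * partial 2 f p)) (at p)"
proof -
  have D: "(f has_derivative frechet_derivative f (at p)) (at p)"
    using assms by (simp add: frechet_derivative_works)
  then have lin: "linear (frechet_derivative f (at p))"
    by (simp add: has_derivative_linear)
  have "frechet_derivative f (at p) = (\<lambda>d. d$1 * partial 1 f p + d$2 * partial 2 f p)"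
  proof
    fix d :: "real^2"
    have "d = (d$1) *\<^sub>R axis 1 1 + (d$2) *\<^sub>R axis 2 1"
      by (simp add: vec_eq_iff forall_2 axis_def)
    then have "frechet_derivative f (at p) d
        = frechet_derivative f (at p) ((d$1) *\<^sub>R axis 1 1 + (d$2) *\<^sub>R axis 2 1)" by simp
    also have "\<dots> = d$1 * partial 1 f p + d$2 * partial 2 f p"
      by (simp add: linear_add[OF lin] linear_cmul[OF lin] partial_def)
    finally show "frechet_derivative f (at p) d = d$1 * partial 1 f p + d$2 * partial 2 f p" .
  qed
  with D show ?thesis by simp
qed

lemma Ck_family_continuous: "Ck_family k f V \<Longrightarrow> continuous_on V (\<lambda>(a, p). f a p)"
  by (cases k) auto

lemma Ck_family_SucD:
  assumes "Ck_family (Suc k) f V"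
  shows "(a, p) \<in> V \<Longrightarrow>
      (f a has_derivative (\<lambda>d. d$1 * partial 1 (f a) p + d$2 * partial 2 (f a) p)) (at p)"
    and "Ck_family k (\<lambda>a. partial i (f a)) V"
  using assms has_derivative_partial by auto

lemma Ck_family_mono_Suc: "Ck_family (Suc k) f V \<Longrightarrow> Ck_family k f V"
proof (induction k arbitrary: f)
  case (Suc k)
  then show ?case by (auto simp del: Ck_family.simps(2) simp: Ck_family.simps(2)[of _ f])
qed simp

lemma Ck_family_cong:
  assumes "Ck_family k f V" "open_slices V" "\<And>a p. (a, p) \<in> V \<Longrightarrow> f a p = g a p"
  shows "Ck_family k g V"
  using assms
proof (induction k arbitrary: f g)
  case 0
  then show ?case by (auto elim!: continuous_on_eq)
next
  case (Suc k)
  have cont: "continuous_on V (\<lambda>(a, p). g a p)"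
    using Ck_family_continuous[OF Suc.prems(1)] Suc.prems(3) by (auto elim!: continuous_on_eq)
  have D: "(g a has_derivative (\<lambda>d. d$1 * partial 1 (f a) p + d$2 * partial 2 (f a) p)) (at p)"
    if "(a, p) \<in> V" for a p
  proof (rule has_derivative_transform_within_open[OF Ck_family_SucD(1)[OF Suc.prems(1) that]])
    show "open {p. (a, p) \<in> V}" using Suc.prems(2) by (simp add: open_slices_def)
  qed (use that Suc.prems(3) in auto)
  have "partial i (g a) p = partial i (f a) p" if "(a, p) \<in> V" for a p i
    using partial_eq[OF D[OF that]] exhaust_2[of i] by auto
  then have "Ck_family k (\<lambda>a. partial i (g a)) V" for i
    using Suc.IH[OF Ck_family_SucD(2)[OF Suc.prems(1)] Suc.prems(2)] by metis
  with cont D show ?case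
    by (auto simp: differentiable_def)
qed

text \<open>Smoothness is always obtained in this way: the derivative is known explicitly, and its
  coefficients belong to the calculus already.\<close>

lemma Ck_family_SucI:
  assumes V: "open_slices V" and cont: "continuous_on V (\<lambda>(a, p). f a p)"
    and D: "\<And>a p. (a, p) \<in> V \<Longrightarrow> (f a has_derivative (\<lambda>d. d$1 * f1 a p + d$2 * f2 a p)) (at p)"
    and "Ck_family k f1 V" "Ck_family k f2 V"
  shows "Ck_family (Suc k) f V"
proof -
  have "Ck_family k (\<lambda>a. partial i (f a)) V" for i
    using exhaust_2[of i]
  proof
    assume "i = 1"
    then show ?thesis
      by (intro Ck_family_cong[OF assms(4) V]) (simp add: partial_eq(1)[OF D])
  next
    assume "i = 2"
    then show ?thesis
      by (intro Ck_family_cong[OF assms(5) V]) (simp add: partial_eq(2)[OF D])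
  qed
  with cont D show ?thesis by (auto simp: differentiable_def)
qed

lemma Ck_family_subset: "Ck_family k f V \<Longrightarrow> W \<subseteq> V \<Longrightarrow> Ck_family k f W"
  by (induction k arbitrary: f) (auto intro: continuous_on_subset)

lemma Ck_family_param:
  assumes "open_slices V" "continuous_on (fst ` V) g"
  shows "Ck_family k (\<lambda>a p. g a) V"
proof (induction k)
  case 0
  have "continuous_on V (\<lambda>q. g (fst q))"
    by (rule continuous_on_compose2[OF assms(2)]) (auto intro: continuous_intros)
  then show ?case by (simp add: case_prod_unfold)
next
  case (Suc k)
  have z: "Ck_family k (\<lambda>a p. 0) V" for k
  proof (induction k)
    case (Suc k) show ?case
      by (rule Ck_family_SucI[OF assms(1) _ _ Suc Suc]) (auto simp: case_prod_unfold)
  qed (simp add: case_prod_unfold)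
  show ?case
    by (rule Ck_family_SucI[OF assms(1) Ck_family_continuous[OF Suc] _ z z]) auto
qed

lemma Ck_family_const: "open_slices V \<Longrightarrow> Ck_family k (\<lambda>a p. c) V"
  by (rule Ck_family_param) auto

lemma Ck_family_coord:
  assumes "open_slices V" shows "Ck_family k (\<lambda>a p. p$i) V"
proof (cases k)
  case 0
  then show ?thesis by (auto simp: case_prod_unfold intro!: continuous_intros)
next
  case (Suc j)
  have "Ck_family (Suc j) (\<lambda>a p. p$i) V"
  proof (rule Ck_family_SucI[OF assms, where ?f1.0="\<lambda>a p. if i = 1 then 1 else 0"
          and ?f2.0="\<lambda>a p. if i = 2 then 1 else 0"])
    fix a and p :: "real^2"
    have "((\<lambda>p::real^2. p$i) has_derivative (\<lambda>d. d$i)) (at p)"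
      by (rule bounded_linear.has_derivative[OF bounded_linear_vec_nth has_derivative_ident])
    then show "((\<lambda>p::real^2. p$i) has_derivative
        (\<lambda>d::real^2. d$1 * (if i = 1 then 1 else 0) + d$2 * (if i = 2 then 1 else 0))) (at p)"
      using exhaust_2[of i] by auto
  qed (auto simp: case_prod_unfold intro!: continuous_intros Ck_family_const assms)
  with Suc show ?thesis by simp
qed

lemma Ck_family_add:
  assumes "open_slices V" "Ck_family k f V" "Ck_family k g V"
  shows "Ck_family k (\<lambda>a p. f a p + g a p) V"
  using assms(2,3)
proof (induction k arbitrary: f g)
  case 0
  then show ?case by (auto simp: case_prod_unfold intro!: continuous_intros)
next
  case (Suc k)
  note f = Suc.prems(1) and g = Suc.prems(2)
  show ?case
  proof (rule Ck_family_SucI[OF assms(1)])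
    show "continuous_on V (\<lambda>(a, p). f a p + g a p)"
      using Ck_family_continuous[OF f] Ck_family_continuous[OF g]
      by (auto simp: case_prod_unfold intro!: continuous_intros)
    show "((\<lambda>p. f a p + g a p) has_derivative (\<lambda>d. d$1 * (partial 1 (f a) p + partial 1 (g a) p)
        + d$2 * (partial 2 (f a) p + partial 2 (g a) p))) (at p)" if "(a, p) \<in> V" for a p
      using has_derivative_add[OF Ck_family_SucD(1)[OF f that] Ck_family_SucD(1)[OF g that]]
      by (rule has_derivative_eq_rhs) (auto simp: algebra_simps)
  qed (intro Suc.IH Ck_family_SucD(2)[OF f] Ck_family_SucD(2)[OF g])+
qed

lemma Ck_family_mult:
  assumes "open_slices V" "Ck_family k f V" "Ck_family k g V"
  shows "Ck_family k (\<lambda>a p. f a p * g a p) V"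
  using assms(2,3)
proof (induction k arbitrary: f g)
  case 0
  then show ?case by (auto simp: case_prod_unfold intro!: continuous_intros)
next
  case (Suc k)
  note f = Suc.prems(1) and g = Suc.prems(2)
  show ?case
  proof (rule Ck_family_SucI[OF assms(1)])
    show "continuous_on V (\<lambda>(a, p). f a p * g a p)"
      using Ck_family_continuous[OF f] Ck_family_continuous[OF g]
      by (auto simp: case_prod_unfold intro!: continuous_intros)
    show "((\<lambda>p. f a p * g a p) has_derivative
        (\<lambda>d. d$1 * (f a p * partial 1 (g a) p + partial 1 (f a) p * g a p)
        + d$2 * (f a p * partial 2 (g a) p + partial 2 (f a) p * g a p))) (at p)"
      if "(a, p) \<in> V" for a p
      using has_derivative_mult[OF Ck_family_SucD(1)[OF f that] Ck_family_SucD(1)[OF g that]]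
      by (rule has_derivative_eq_rhs) (auto simp: algebra_simps)
  qed (intro Ck_family_add assms(1) Suc.IH Ck_family_SucD(2)[OF f] Ck_family_SucD(2)[OF g]
        Ck_family_mono_Suc[OF f] Ck_family_mono_Suc[OF g])+
qed

lemma Ck_family_minus:
  assumes "open_slices V" "Ck_family k f V"
  shows "Ck_family k (\<lambda>a p. - f a p) V"
  using Ck_family_mult[OF assms(1) Ck_family_const[OF assms(1), of k "-1"] assms(2)] by simp

lemma Ck_family_diff:
  assumes "open_slices V" "Ck_family k f V" "Ck_family k g V"
  shows "Ck_family k (\<lambda>a p. f a p - g a p) V"
  using Ck_family_add[OF assms(1,2) Ck_family_minus[OF assms(1,3)]] by simp

lemma Ck_family_power:
  assumes "open_slices V" "Ck_family k f V"
  shows "Ck_family k (\<lambda>a p. f a p ^ n) V"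
  by (induction n) (auto intro: Ck_family_const Ck_family_mult assms)

lemma Ck_family_inverse:
  assumes "open_slices V" "Ck_family k f V" and nz: "\<And>a p. (a, p) \<in> V \<Longrightarrow> f a p \<noteq> 0"
  shows "Ck_family k (\<lambda>a p. inverse (f a p)) V"
  using assms(2)
proof (induction k)
  case 0
  with nz show ?case by (auto simp: case_prod_unfold intro!: continuous_intros)
next
  case (Suc k)
  note f = Suc.prems and inv = Suc.IH[OF Ck_family_mono_Suc[OF Suc.prems]]
  show ?case
  proof (rule Ck_family_SucI[OF assms(1)])
    show "continuous_on V (\<lambda>(a, p). inverse (f a p))"
      using Ck_family_continuous[OF f] nz by (auto simp: case_prod_unfold intro!: continuous_intros)
    show "((\<lambda>p. inverse (f a p)) has_derivative
        (\<lambda>d. d$1 * (- partial 1 (f a) p * (inverse (f a p) * inverse (f a p)))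
        + d$2 * (- partial 2 (f a) p * (inverse (f a p) * inverse (f a p))))) (at p)"
      if "(a, p) \<in> V" for a p
      using Deriv.has_derivative_inverse[OF nz[OF that] Ck_family_SucD(1)[OF f that]]
      by (rule has_derivative_eq_rhs) (auto simp: algebra_simps)
  qed (intro Ck_family_mult Ck_family_minus assms(1) Ck_family_SucD(2)[OF f] inv)+
qed

lemma Ck_family_divide:
  assumes "open_slices V" "Ck_family k f V" "Ck_family k g V" "\<And>a p. (a, p) \<in> V \<Longrightarrow> g a p \<noteq> 0"
  shows "Ck_family k (\<lambda>a p. f a p / g a p) V"
  using Ck_family_mult[OF assms(1,2) Ck_family_inverse[OF assms(1,3,4)]]
  by (simp add: divide_inverse)

text \<open>The derivatives alternate between the two functions, which makes a simultaneous induction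
  possible: this covers sine and cosine as well as their hyperbolic versions.\<close>

lemma Ck_family_compose_pair:
  fixes \<phi> \<psi> :: "real \<Rightarrow> real"
  assumes V: "open_slices V" and f: "Ck_family k f V"
    and \<phi>: "\<And>x. (\<phi> has_field_derivative \<psi> x) (at x)"
    and \<psi>: "\<And>x. (\<psi> has_field_derivative \<epsilon> * \<phi> x) (at x)"
  shows "Ck_family k (\<lambda>a p. \<phi> (f a p)) V \<and> Ck_family k (\<lambda>a p. \<psi> (f a p)) V"
  using f
proof (induction k)
  case 0
  have "continuous_on UNIV \<phi>" "continuous_on UNIV \<psi>"
    using \<phi> \<psi> by (meson DERIV_isCont continuous_at_imp_continuous_on)+
  with 0 show ?case
    by (auto simp: case_prod_unfold intro: continuous_on_compose2)
next
  case (Suc k)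
  note f = Suc.prems and IH = Suc.IH[OF Ck_family_mono_Suc[OF Suc.prems]]
  have *: "((\<lambda>p. \<theta> (f a p)) has_derivative
        (\<lambda>d. d$1 * (partial 1 (f a) p * \<theta>' (f a p)) + d$2 * (partial 2 (f a) p * \<theta>' (f a p)))) (at p)"
    if "(a, p) \<in> V" "\<And>x. (\<theta> has_field_derivative \<theta>' x) (at x)" for a p \<theta> and \<theta>' :: "real \<Rightarrow> real"
    using has_derivative_compose[OF Ck_family_SucD(1)[OF f that(1)]
        that(2)[unfolded has_field_derivative_def]]
    by (rule has_derivative_eq_rhs) (auto simp: algebra_simps)
  have cont: "continuous_on V (\<lambda>(a, p). \<theta> (f a p))"
    if "\<And>x. (\<theta> has_field_derivative \<theta>' x) (at x)" for \<theta> and \<theta>' :: "real \<Rightarrow> real"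
  proof -
    have "continuous_on UNIV \<theta>"
      using that by (meson DERIV_isCont continuous_at_imp_continuous_on)
    then show ?thesis using Ck_family_continuous[OF f]
      by (auto simp: case_prod_unfold intro: continuous_on_compose2)
  qed
  have "Ck_family (Suc k) (\<lambda>a p. \<phi> (f a p)) V"
    by (rule Ck_family_SucI[OF V cont[OF \<phi>] *[OF _ \<phi>]])
      (use IH in \<open>auto intro!: Ck_family_mult V Ck_family_SucD(2)[OF f]\<close>)
  moreover have "Ck_family (Suc k) (\<lambda>a p. \<psi> (f a p)) V"
    by (rule Ck_family_SucI[OF V cont[OF \<psi>] *[OF _ \<psi>]])
      (use IH in \<open>auto intro!: Ck_family_mult Ck_family_const V Ck_family_SucD(2)[OF f]\<close>)
  ultimately show ?case by blast
qed

lemma Ck_family_sin_cos: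
  assumes "open_slices V" "Ck_family k f V"
  shows "Ck_family k (\<lambda>a p. sin (f a p)) V" "Ck_family k (\<lambda>a p. cos (f a p)) V"
  using Ck_family_compose_pair[OF assms, of sin cos "-1"] by (auto intro!: derivative_eq_intros)

lemma Ck_family_sinh_cosh:
  assumes "open_slices V" "Ck_family k f V"
  shows "Ck_family k (\<lambda>a p. sinh (f a p)) V" "Ck_family k (\<lambda>a p. cosh (f a p)) V"
proof -
  have "(sinh has_field_derivative cosh x) (at x)" "(cosh has_field_derivative 1 * sinh x) (at x)"
    for x :: real by (auto intro!: derivative_eq_intros)
  then show "Ck_family k (\<lambda>a p. sinh (f a p)) V" "Ck_family k (\<lambda>a p. cosh (f a p)) V"
    using Ck_family_compose_pair[OF assms, of sinh cosh 1] by auto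
qed

section \<open>Composition and maps into space\<close>

definition vec2 :: "real \<Rightarrow> real \<Rightarrow> real^2" where
  "vec2 x y = (\<chi> i. if i = 1 then x else y)"

lemma vec2_nth [simp]: "vec2 x y $ 1 = x" "vec2 x y $ 2 = y"
  by (simp_all add: vec2_def)

lemma vec2_eta [simp]: "vec2 (p$1) (p$2) = p"
  by (simp add: vec_eq_iff forall_2)

lemma vec2_conv: "vec2 x y = x *\<^sub>R axis 1 1 + y *\<^sub>R axis 2 1"
  by (simp add: vec_eq_iff forall_2 axis_def)

lemma continuous_on_vec2 [continuous_intros]:
  "continuous_on S f \<Longrightarrow> continuous_on S g \<Longrightarrow> continuous_on S (\<lambda>x. vec2 (f x) (g x))"
  unfolding vec2_conv by (intro continuous_intros)

lemma has_derivative_vec2 [derivative_intros]: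
  "(f has_derivative f') F \<Longrightarrow> (g has_derivative g') F \<Longrightarrow>
    ((\<lambda>x. vec2 (f x) (g x)) has_derivative (\<lambda>d. vec2 (f' d) (g' d))) F"
  unfolding vec2_conv by (intro derivative_intros)

lemma Ck_family_compose:
  assumes V: "open_slices V" and "Ck_family k f W" "Ck_family k g1 V" "Ck_family k g2 V"
    and maps: "\<And>a p. (a, p) \<in> V \<Longrightarrow> (a, vec2 (g1 a p) (g2 a p)) \<in> W"
  shows "Ck_family k (\<lambda>a p. f a (vec2 (g1 a p) (g2 a p))) V"
proof -
  have cont: "continuous_on V (\<lambda>(a, p). f a (vec2 (g1 a p) (g2 a p)))"
    if "continuous_on W (\<lambda>(a, p). f a p)" "continuous_on V (\<lambda>(a, p). g1 a p)"
      "continuous_on V (\<lambda>(a, p). g2 a p)" for f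
  proof -
    have "continuous_on V (\<lambda>q. (fst q, vec2 (g1 (fst q) (snd q)) (g2 (fst q) (snd q))))"
      using that by (auto simp: case_prod_unfold intro!: continuous_intros)
    from continuous_on_compose2[OF that(1) this] have
      "(\<lambda>q. (fst q, vec2 (g1 (fst q) (snd q)) (g2 (fst q) (snd q)))) ` V \<subseteq> W \<Longrightarrow> ?thesis"
      by (simp add: case_prod_unfold)
    moreover have "(\<lambda>q. (fst q, vec2 (g1 (fst q) (snd q)) (g2 (fst q) (snd q)))) ` V \<subseteq> W"
      using maps by auto
    ultimately show ?thesis by blast
  qed
  show ?thesis using assms(2-4)
  proof (induction k arbitrary: f)
    case 0
    then show ?case using cont by auto
  next
    case (Suc k)
    note f = Suc.prems(1) and g1 = Suc.prems(2) and g2 = Suc.prems(3)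
    have IH: "Ck_family k (\<lambda>a p. h a (vec2 (g1 a p) (g2 a p))) V" if "Ck_family k h W" for h
      using Suc.IH[OF that Ck_family_mono_Suc[OF g1] Ck_family_mono_Suc[OF g2]] .
    show ?case
    proof (rule Ck_family_SucI[OF V])
      show "continuous_on V (\<lambda>(a, p). f a (vec2 (g1 a p) (g2 a p)))"
        by (intro cont Ck_family_continuous[OF f] Ck_family_continuous[OF g1]
            Ck_family_continuous[OF g2])
      fix a p assume ap: "(a, p) \<in> V"
      let ?g = "vec2 (g1 a p) (g2 a p)"
      show "((\<lambda>p. f a (vec2 (g1 a p) (g2 a p))) has_derivative
         (\<lambda>d. d$1 * (partial 1 (g1 a) p * partial 1 (f a) ?g + partial 1 (g2 a) p * partial 2 (f a) ?g)
            + d$2 * (partial 2 (g1 a) p * partial 1 (f a) ?g + partial 2 (g2 a) p * partial 2 (f a) ?g)))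
         (at p)"
        using has_derivative_compose[OF has_derivative_vec2[OF Ck_family_SucD(1)[OF g1 ap]
              Ck_family_SucD(1)[OF g2 ap]] Ck_family_SucD(1)[OF f maps[OF ap]]]
        by (rule has_derivative_eq_rhs) (auto simp: algebra_simps)
    qed (intro Ck_family_add Ck_family_mult V IH[OF Ck_family_SucD(2)[OF f]]
        Ck_family_SucD(2)[OF g1] Ck_family_SucD(2)[OF g2])+
  qed
qed

lemma differentiable_componentwise_vec:
  fixes f :: "real^2 \<Rightarrow> real^3"
  shows "(\<forall>j. (\<lambda>p. f p $ j) differentiable at p) \<longleftrightarrow> f differentiable at p"
  unfolding differentiable_componentwise_within[of f]
  by (auto simp: Basis_vec_def inner_axis)

lemma pd_nth:
  assumes "f differentiable at p"
  shows "pd i f p $ j = partial i (\<lambda>p. f p $ j) p"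
proof -
  have "((\<lambda>p. f p $ j) has_derivative (\<lambda>d. frechet_derivative f (at p) d $ j)) (at p)"
    using assms frechet_derivative_works bounded_linear.has_derivative[OF bounded_linear_vec_nth]
    by blast
  then show ?thesis
    unfolding partial_def pd_def using frechet_derivative_at by metis
qed

lemma continuous_on_componentwise_vec:
  fixes f :: "'a::topological_space \<Rightarrow> real^3"
  shows "continuous_on S f \<longleftrightarrow> (\<forall>j. continuous_on S (\<lambda>x. f x $ j))"
proof
  assume "\<forall>j. continuous_on S (\<lambda>x. f x $ j)"
  then have "continuous_on S (\<lambda>x. \<chi> j. f x $ j)" by (intro continuous_on_vec_lambda) auto
  then show "continuous_on S f" by simp
qed (auto intro!: continuous_intros)

lemma Ck_family_pd:
  assumes V: "open_slices V" and "\<And>j. Ck_family (Suc k) (\<lambda>a p. F a p $ j) V"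
  shows "Ck_family k (\<lambda>a p. pd i (F a) p $ j) V"
    and "(a, p) \<in> V \<Longrightarrow> F a differentiable at p"
proof -
  have "F a differentiable at p" if "(a, p) \<in> V" for a p
    unfolding differentiable_componentwise_vec[symmetric]
    using assms(2) that by fastforce
  then show "(a, p) \<in> V \<Longrightarrow> F a differentiable at p"
    "Ck_family k (\<lambda>a p. pd i (F a) p $ j) V"
    using Ck_family_cong[OF Ck_family_SucD(2)[OF assms(2)] V] by (auto simp: pd_nth)
qed

lemma Ck_family_imp_Ck_on:
  assumes V: "open_slices V" and "\<And>j. Ck_family k (\<lambda>a p. F a p $ j) V"
  shows "Ck_on k (F a) {p. (a, p) \<in> V}"
  using assms(2)
proof (induction k arbitrary: F)
  case 0
  have "continuous_on V (\<lambda>(a, p). F a p)"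
    using 0 by (simp add: continuous_on_componentwise_vec case_prod_unfold)
  then have "continuous_on {p. (a, p) \<in> V} (\<lambda>p. case (a, p) of (a, p) \<Rightarrow> F a p)"
    by (rule continuous_on_compose2) (auto intro!: continuous_intros)
  then show ?case by simp
next
  case (Suc k)
  have "F a differentiable_on {p. (a, p) \<in> V}"
    using Ck_family_pd(2)[OF V Suc.prems]
    by (auto simp: differentiable_on_def intro: differentiable_at_withinI)
  moreover have "Ck_on k (pd i (F a)) {p. (a, p) \<in> V}" for i
    by (rule Suc.IH[of "\<lambda>a. pd i (F a)"]) (rule Ck_family_pd(1)[OF V Suc.prems])
  ultimately show ?case by simp
qed

text \<open>A jointly continuous function is uniformly continuous on a compact product, so the values at a
  convergent sequence of parameters converge uniformly.\<close>

lemma uniform_limit_of_joint_continuity: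
  fixes f :: "real \<Rightarrow> real^2 \<Rightarrow> real^3"
  assumes cont: "continuous_on (A \<times> K) (\<lambda>(a, p). f a p)" and "compact A" "compact K"
    and a: "a \<longlonglongrightarrow> b" "\<And>n. a n \<in> A" "b \<in> A"
  shows "uniform_limit K (\<lambda>n. f (a n)) (f b) sequentially"
proof (rule uniform_limitI)
  fix e :: real assume "0 < e"
  have "uniformly_continuous_on (A \<times> K) (\<lambda>(a, p). f a p)"
    using assms by (intro compact_uniformly_continuous compact_Times)
  then obtain d where "d > 0" and d: "\<And>x y. x \<in> A \<times> K \<Longrightarrow> y \<in> A \<times> K \<Longrightarrow> dist y x < d \<Longrightarrow>
      dist (case_prod f y) (case_prod f x) < e"
    using \<open>0 < e\<close> unfolding uniformly_continuous_on_def by blast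
  have "\<forall>\<^sub>F n in sequentially. dist (a n) b < d"
    using a(1) \<open>d > 0\<close> by (rule tendstoD)
  then show "\<forall>\<^sub>F n in sequentially. \<forall>p\<in>K. dist (f (a n) p) (f b p) < e"
  proof (rule eventually_mono)
    fix n assume n: "dist (a n) b < d"
    show "\<forall>p\<in>K. dist (f (a n) p) (f b p) < e"
    proof
      fix p assume "p \<in> K"
      then show "dist (f (a n) p) (f b p) < e"
        using d[of "(b, p)" "(a n, p)"] a n by (simp add: dist_Pair_Pair)
    qed
  qed
qed

text \<open>Strict monotonicity traps the solution: at \<open>y e - d\<close> and \<open>y e + d\<close> the values of \<open>f\<close> have opposite
  signs, which persist nearby.\<close>

lemma continuous_on_implicit:
  fixes f :: "'e::topological_space \<Rightarrow> real \<Rightarrow> real"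
  assumes I: "\<And>e. e \<in> E \<Longrightarrow> open (I e)" "\<And>e. e \<in> E \<Longrightarrow> y e \<in> I e"
    and mono: "\<And>e s t. e \<in> E \<Longrightarrow> s \<in> I e \<Longrightarrow> t \<in> I e \<Longrightarrow> s < t \<Longrightarrow> f e s < f e t"
    and sol: "\<And>e. e \<in> E \<Longrightarrow> f e (y e) = 0"
    and dom: "\<And>e t. e \<in> E \<Longrightarrow> t \<in> I e \<Longrightarrow> \<forall>\<^sub>F e' in at e within E. t \<in> I e'"
    and cont: "\<And>e t. e \<in> E \<Longrightarrow> t \<in> I e \<Longrightarrow> ((\<lambda>e'. f e' t) \<longlongrightarrow> f e t) (at e within E)"
  shows "continuous_on E y"
  unfolding continuous_on_def
proof
  fix e assume e: "e \<in> E"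
  show "(y \<longlongrightarrow> y e) (at e within E)"
  proof (rule order_tendstoI)
    fix l assume "l < y e"
    obtain d where d: "d > 0" "\<And>t. dist t (y e) < d \<Longrightarrow> t \<in> I e"
      using I[OF e] unfolding open_dist by blast
    define t where "t = max l (y e - d/2)"
    have t: "t \<in> I e" "l \<le> t" "t < y e"
      using d \<open>l < y e\<close> by (auto simp: t_def dist_real_def)
    have "f e t < 0" using mono[OF e t(1) I(2)[OF e] t(3)] sol[OF e] by simp
    then have "\<forall>\<^sub>F e' in at e within E. f e' t < 0"
      using cont[OF e t(1)] order_tendstoD(2) by blast
    moreover have "\<forall>\<^sub>F e' in at e within E. e' \<in> E"
      by (simp add: eventually_at_filter)
    ultimately show "\<forall>\<^sub>F e' in at e within E. l < y e'"
      using dom[OF e t(1)]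
    proof eventually_elim
      case (elim e')
      then show ?case using mono[of e' "y e'" t] sol[of e'] I(2)[of e'] t
        by (metis leD less_le_trans linorder_less_linear order.asym)
    qed
  next
    fix l assume "y e < l"
    obtain d where d: "d > 0" "\<And>t. dist t (y e) < d \<Longrightarrow> t \<in> I e"
      using I[OF e] unfolding open_dist by blast
    define t where "t = min l (y e + d/2)"
    have t: "t \<in> I e" "t \<le> l" "y e < t"
      using d \<open>y e < l\<close> by (auto simp: t_def dist_real_def)
    have "f e t > 0" using mono[OF e I(2)[OF e] t(1) t(3)] sol[OF e] by simp
    then have "\<forall>\<^sub>F e' in at e within E. f e' t > 0"
      using cont[OF e t(1)] order_tendstoD(1) by blast
    moreover have "\<forall>\<^sub>F e' in at e within E. e' \<in> E"
      by (simp add: eventually_at_filter)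
    ultimately show "\<forall>\<^sub>F e' in at e within E. y e' < l"
      using dom[OF e t(1)]
    proof eventually_elim
      case (elim e')
      then show ?case using mono[of e' t "y e'"] sol[of e'] I(2)[of e'] t
        by (metis less_le_trans linorder_less_linear order.asym)
    qed
  qed
qed

section \<open>Curvature in an isothermal parametrization\<close>

text \<open>A continuous solution \<open>t\<close> of \<open>G (t v) = g v\<close> inherits the derivative of \<open>g\<close>, provided that \<open>G\<close> has
  the identity as its derivative: near \<open>u\<close> the increment of \<open>t\<close> is at most twice that of \<open>g\<close>, hence of
  first order, and then differs from that of \<open>g\<close> by terms of higher order. This is where
  transition maps between charts, and implicitly defined functions, become differentiable.\<close>

lemma has_derivative_lift:
  fixes G :: "'a::real_normed_vector \<Rightarrow> 'a" and g :: "'b::real_normed_vector \<Rightarrow> 'a"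
  assumes G: "(G has_derivative (\<lambda>d. d)) (at (t u))" and g: "(g has_derivative L) (at u)"
    and t: "continuous (at u) t" and eq: "open W" "u \<in> W" "\<And>v. v \<in> W \<Longrightarrow> G (t v) = g v"
  shows "(t has_derivative L) (at u)"
  unfolding has_derivative_at_alt
proof (intro conjI allI impI)
  show bl: "bounded_linear L" using g by (rule has_derivative_bounded_linear)
  fix e :: real assume "0 < e"
  obtain M where M: "M > 0" "\<And>d. norm (L d) \<le> norm d * M"
    using bounded_linear.pos_bounded[OF bl] by blast
  \<comment> \<open>\<open>2 M + 2\<close> collects the errors of \<open>g\<close> and of \<open>G\<close>, the latter at distance at most \<open>(2 M + 1) \<bar>v - u\<bar>\<close>\<close>
  define e1 where "e1 = min (1/2) (e / (2 * M + 3))"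
  have "2 * M + 3 > 0" using M(1) by simp
  have e1: "0 < e1" "e1 \<le> 1/2" "e1 \<le> e / (2 * M + 3)"
  proof -
    show "0 < e1" using \<open>0 < e\<close> \<open>2 * M + 3 > 0\<close> by (simp add: e1_def)
    show "e1 \<le> 1/2" unfolding e1_def by (rule min.cobounded1)
    show "e1 \<le> e / (2 * M + 3)" unfolding e1_def by (rule min.cobounded2)
  qed
  then have e1': "e1 * (2 * M + 3) \<le> e"
    using \<open>2 * M + 3 > 0\<close> by (simp add: pos_le_divide_eq)
  obtain d1 where d1: "d1 > 0" "\<And>q. norm (q - t u) < d1 \<Longrightarrow>
      norm (G q - G (t u) - (q - t u)) \<le> e1 * norm (q - t u)"
    using G e1(1) unfolding has_derivative_at_alt by metis
  obtain d2 where d2: "d2 > 0" "\<And>v. norm (v - u) < d2 \<Longrightarrow>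
      norm (g v - g u - L (v - u)) \<le> e1 * norm (v - u)"
    using g e1(1) unfolding has_derivative_at_alt by metis
  obtain d3 where d3: "d3 > 0" "\<And>v. dist v u < d3 \<Longrightarrow> dist (t v) (t u) < d1"
    using t d1(1) unfolding continuous_at_eps_delta by metis
  obtain d4 where d4: "d4 > 0" "\<And>v. dist v u < d4 \<Longrightarrow> v \<in> W"
    using eq(1,2) unfolding open_dist by metis
  show "\<exists>d>0. \<forall>v. norm (v - u) < d \<longrightarrow> norm (t v - t u - L (v - u)) \<le> e * norm (v - u)"
  proof (intro exI[of _ "min d2 (min d3 d4)"] conjI allI impI)
    fix v assume v: "norm (v - u) < min d2 (min d3 d4)"
    define q where "q = t v - t u"
    have *: "norm (G (t v) - G (t u) - q) \<le> e1 * norm q"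
      using d1(2)[of "t v"] d3(2)[of v] v by (simp add: dist_norm q_def)
    have Gg: "G (t v) - G (t u) = g v - g u"
      using eq(3)[of v] eq(3)[of u] eq(2) d4(2)[of v] v by (simp add: dist_norm)
    have **: "norm (g v - g u - L (v - u)) \<le> e1 * norm (v - u)"
      using d2(2)[of v] v by simp
    have "norm q \<le> norm (G (t v) - G (t u)) + norm (G (t v) - G (t u) - q)"
      using norm_triangle_sub[of q "G (t v) - G (t u)"] norm_minus_commute[of q "G (t v) - G (t u)"]
      by simp
    also have "\<dots> \<le> norm (G (t v) - G (t u)) + 1/2 * norm q"
      using * mult_right_mono[OF e1(2) norm_ge_zero[of q]] by linarith
    finally have "norm q \<le> 2 * norm (g v - g u)"
      using Gg by simp
    moreover have "norm (g v - g u) \<le> norm (L (v - u)) + norm (g v - g u - L (v - u))"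
      by (metis norm_triangle_sub)
    moreover have "norm (g v - g u - L (v - u)) \<le> 1/2 * norm (v - u)"
      using ** mult_right_mono[OF e1(2) norm_ge_zero[of "v - u"]] by linarith
    ultimately have q: "norm q \<le> (2 * M + 1) * norm (v - u)"
      using M(2)[of "v - u"] by (simp add: algebra_simps)
    have "norm (q - L (v - u)) \<le> norm (g v - g u - L (v - u)) + norm (G (t v) - G (t u) - q)"
      using norm_triangle_ineq4[of "g v - g u - L (v - u)" "g v - g u - q"] unfolding Gg by simp
    also have "\<dots> \<le> e1 * norm (v - u) + e1 * ((2 * M + 1) * norm (v - u))"
      using * ** mult_left_mono[OF q, of e1] e1(1) by linarith
    also have "\<dots> = (e1 * (2 * M + 2)) * norm (v - u)" by (simp add: algebra_simps)
    also have "\<dots> \<le> e * norm (v - u)"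
    proof (rule mult_right_mono)
      have "e1 * (2 * M + 2) \<le> e1 * (2 * M + 3)" using e1(1) by simp
      then show "e1 * (2 * M + 2) \<le> e" using e1' by linarith
    qed simp
    finally show "norm (t v - t u - L (v - u)) \<le> e * norm (v - u)" by (simp add: q_def)
  qed (use d2 d3 d4 in simp)
qed

lemma half_plane_upper_open:
  assumes "openin (top_of_set half_plane) D"
  shows "open (D \<inter> {u. 0 < u$2})"
proof -
  obtain T where T: "open T" "D = half_plane \<inter> T"
    using assms by (auto simp: openin_open)
  have "D \<inter> {u. 0 < u$2} = T \<inter> {u. 0 < u$2}"
    by (auto simp: T half_plane_def)
  moreover have "open {u::real^2. 0 < u$2}"
    by (intro open_Collect_less continuous_intros)
  ultimately show ?thesis using T(1) by auto
qed

text \<open>Points of a chart domain on the boundary line are limits of points above it, so that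
  identities proved by differentiation at interior points extend to them.\<close>

lemma half_plane_density:
  fixes \<phi> :: "real^2 \<Rightarrow> 'a::real_normed_vector"
  assumes D: "openin (top_of_set half_plane) D" and cont: "continuous_on D \<phi>"
    and z: "\<And>u. u \<in> D \<Longrightarrow> 0 < u$2 \<Longrightarrow> \<phi> u = 0" and u: "u \<in> D"
  shows "\<phi> u = 0"
proof -
  obtain T where T: "open T" "D = half_plane \<inter> T"
    using D by (auto simp: openin_open)
  have u2: "0 \<le> u$2" using u T by (auto simp: half_plane_def)
  define w where "w n = u + inverse (real (Suc n)) *\<^sub>R axis 2 1" for n
  have w2: "w n $ 2 = u$2 + inverse (real (Suc n))" for n by (simp add: w_def axis_def)
  have "w \<longlonglongrightarrow> u + 0 *\<^sub>R axis 2 1"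
    unfolding w_def by (intro tendsto_intros LIMSEQ_inverse_real_of_nat)
  then have lim: "w \<longlonglongrightarrow> u" by simp
  have "\<forall>\<^sub>F n in sequentially. w n \<in> T"
    using lim T u by (simp add: topological_tendstoD)
  moreover have "w n \<in> half_plane \<and> 0 < w n $ 2" for n
  proof -
    have "0 < u$2 + inverse (real (Suc n))" using u2 by (intro add_nonneg_pos) auto
    then show ?thesis by (simp add: half_plane_def w2)
  qed
  ultimately have ev: "\<forall>\<^sub>F n in sequentially. w n \<in> D \<and> \<phi> (w n) = 0"
    by (auto elim!: eventually_mono simp: T(2) intro: z[unfolded T(2)])
  have "\<forall>\<^sub>F n in sequentially. w n \<in> D"
    using ev by eventually_elim simp
  then have "(\<lambda>n. \<phi> (w n)) \<longlonglongrightarrow> \<phi> u"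
    by (rule continuous_on_tendsto_compose[OF cont lim u])
  moreover have "\<forall>\<^sub>F n in sequentially. \<phi> (w n) = 0"
    using ev by eventually_elim simp
  then have "(\<lambda>n. \<phi> (w n)) \<longlonglongrightarrow> 0"
    by (rule tendsto_eventually)
  ultimately show ?thesis using LIMSEQ_unique by blast
qed

lemma linear_pd:
  fixes f :: "real^2 \<Rightarrow> real^3"
  assumes "f differentiable at u"
  shows "frechet_derivative f (at u) d = d$1 *\<^sub>R pd 1 f u + d$2 *\<^sub>R pd 2 f u"
proof -
  have lin: "linear (frechet_derivative f (at u))"
    using assms frechet_derivative_works has_derivative_linear by blast
  have "d = (d$1) *\<^sub>R axis 1 1 + (d$2) *\<^sub>R axis 2 1"
    by (simp add: vec_eq_iff forall_2 axis_def)
  then have "frechet_derivative f (at u) d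
      = frechet_derivative f (at u) ((d$1) *\<^sub>R axis 1 1 + (d$2) *\<^sub>R axis 2 1)" by simp
  then show ?thesis by (simp add: linear_add[OF lin] linear_cmul[OF lin] pd_def)
qed

lemma has_derivative_pd:
  fixes f :: "real^2 \<Rightarrow> real^3"
  assumes "f differentiable at u"
  shows "(f has_derivative (\<lambda>d. d$1 *\<^sub>R pd 1 f u + d$2 *\<^sub>R pd 2 f u)) (at u)"
proof -
  have "frechet_derivative f (at u) = (\<lambda>d. d$1 *\<^sub>R pd 1 f u + d$2 *\<^sub>R pd 2 f u)"
    by (rule ext) (rule linear_pd[OF assms])
  with assms show ?thesis using frechet_derivative_works[of f "at u"] by simp
qed

lemma pd_eqI:
  fixes f :: "real^2 \<Rightarrow> real^3"
  assumes "(f has_derivative (\<lambda>d. d$1 *\<^sub>R a + d$2 *\<^sub>R b)) (at u)"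
  shows "pd 1 f u = a" "pd 2 f u = b"
  unfolding pd_def frechet_derivative_at[OF assms, symmetric] by (simp_all add: axis_def)

lemma matrix_inv_mult:
  assumes "invertible A"
  shows "A ** matrix_inv A = mat 1" "matrix_inv A ** A = mat 1"
  using someI_ex[OF assms[unfolded invertible_def]] by (simp_all add: matrix_inv_def)

text \<open>Under a change of coordinates with matrix \<open>L\<close> both fundamental forms are transformed by the
  same congruence. The shape operator is therefore conjugated, and the traces of it and of its
  square are those of the conformal parametrization. The sign \<open>\<sigma>\<close> is the choice of the normal.\<close>

lemma shape_algebra:
  fixes G H L M :: "real^2^2"
  assumes "\<mu> \<noteq> 0" "invertible L" "\<sigma> * \<sigma> = 1"
    and G: "G = \<mu> *\<^sub>R (L ** transpose L)" and H: "H = \<sigma> *\<^sub>R (L ** M ** transpose L)"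
  shows "trace (matrix_inv G ** H) = \<sigma> / \<mu> * trace M"
    and "trace ((matrix_inv G ** H) ** (matrix_inv G ** H)) = trace (M ** M) / \<mu>\<^sup>2"
proof -
  define R where "R = transpose L"
  have R: "invertible R" using assms(2) by (simp add: R_def invertible_det_nz)
  define R' where "R' = matrix_inv R"
  have inv: "R ** R' = mat 1" "R' ** R = mat 1"
    using matrix_inv_mult[OF R] by (auto simp: R'_def)
  have invL: "invertible (L ** transpose L)" using assms(2) by (simp add: invertible_det_nz det_mul)
  have invG: "invertible G"
    unfolding G using scalar_invertible[OF assms(1) invL] .
  define X where "X = (\<sigma> / \<mu>) *\<^sub>R (R' ** M ** R)"
  have "G ** X = \<sigma> *\<^sub>R (L ** (R ** R') ** M ** R)"
    using assms(1) by (simp add: G X_def R_def matrix_scalar_ac scalar_matrix_assoc[symmetric] matrix_mul_assoc)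
  also have "\<dots> = H" unfolding inv(1) H by (simp add: R_def)
  finally have "matrix_inv G ** (G ** X) = matrix_inv G ** H" by simp
  then have S: "matrix_inv G ** H = X"
    using matrix_inv_mult(2)[OF invG] by (simp add: matrix_mul_assoc)
  have tr: "trace (R' ** N ** R) = trace N" for N :: "real^2^2"
    by (metis inv(1) matrix_mul_assoc matrix_mul_lid trace_mul_sym)
  have trs: "trace (k *\<^sub>R N) = k * trace N" for k and N :: "real^2^2"
    by (simp add: trace_def sum_distrib_left)
  show "trace (matrix_inv G ** H) = \<sigma> / \<mu> * trace M"
    by (simp add: S X_def tr trs)
  have "X ** X = (\<sigma> / \<mu> * (\<sigma> / \<mu>)) *\<^sub>R (R' ** M ** (R ** R') ** M ** R)"
    by (simp add: X_def matrix_scalar_ac scalar_matrix_assoc[symmetric] matrix_mul_assoc)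
  also have "\<dots> = (1 / \<mu>\<^sup>2) *\<^sub>R (R' ** (M ** M) ** R)"
    using assms(3) by (simp add: inv power2_eq_square matrix_mul_assoc)
  finally show "trace ((matrix_inv G ** H) ** (matrix_inv G ** H)) = trace (M ** M) / \<mu>\<^sup>2"
    by (simp add: S tr trs)
qed

lemma cross3_combination:
  "cross3 (a *\<^sub>R X + b *\<^sub>R Y) (c *\<^sub>R X + d *\<^sub>R Y) = (a * d - b * c) *\<^sub>R cross3 X Y"
  by (simp add: cross3_def vec_eq_iff forall_3 algebra_simps)

text \<open>A conformal immersion \<open>F\<close> with unit normal \<open>n\<close>, conformal factor \<open>\<mu>\<close> and second fundamental form
  with rows \<open>(\<alpha>, \<beta>)\<close> and \<open>(\<beta>, - \<alpha>)\<close>, whose trace vanishes. The second fundamental form is given by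
  Weingarten's equations, through the derivatives of the normal.\<close>

locale isothermal_patch =
  fixes \<Omega> :: "(real^2) set" and F Fx Fy n nx ny :: "real^2 \<Rightarrow> real^3"
    and \<mu> \<alpha> \<beta> :: "real^2 \<Rightarrow> real"
  assumes F': "q \<in> \<Omega> \<Longrightarrow> (F has_derivative (\<lambda>d. d$1 *\<^sub>R Fx q + d$2 *\<^sub>R Fy q)) (at q)"
    and n': "q \<in> \<Omega> \<Longrightarrow> (n has_derivative (\<lambda>d. d$1 *\<^sub>R nx q + d$2 *\<^sub>R ny q)) (at q)"
    and cont: "continuous_on \<Omega> Fx" "continuous_on \<Omega> Fy"
      "continuous_on \<Omega> \<mu>" "continuous_on \<Omega> \<alpha>" "continuous_on \<Omega> \<beta>"
    and conformal: "q \<in> \<Omega> \<Longrightarrow> Fx q \<bullet> Fx q = \<mu> q" "q \<in> \<Omega> \<Longrightarrow> Fy q \<bullet> Fy q = \<mu> q"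
      "q \<in> \<Omega> \<Longrightarrow> Fx q \<bullet> Fy q = 0" "q \<in> \<Omega> \<Longrightarrow> 0 < \<mu> q"
    and normal: "q \<in> \<Omega> \<Longrightarrow> cross3 (Fx q) (Fy q) = \<mu> q *\<^sub>R n q" "q \<in> \<Omega> \<Longrightarrow> norm (n q) = 1"
    and second: "q \<in> \<Omega> \<Longrightarrow> Fx q \<bullet> nx q = - \<alpha> q" "q \<in> \<Omega> \<Longrightarrow> Fx q \<bullet> ny q = - \<beta> q"
      "q \<in> \<Omega> \<Longrightarrow> Fy q \<bullet> nx q = - \<beta> q" "q \<in> \<Omega> \<Longrightarrow> Fy q \<bullet> ny q = \<alpha> q"
begin

lemma normal_orthogonal: "q \<in> \<Omega> \<Longrightarrow> Fx q \<bullet> n q = 0" "q \<in> \<Omega> \<Longrightarrow> Fy q \<bullet> n q = 0"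
  using normal(1)[of q] conformal(4)[of q] dot_cross_self(1)[of "Fx q" "Fy q"]
    dot_cross_self(2)[of "Fy q" "Fx q"] by (auto simp: dot_cross_self)

text \<open>The map \<open>t\<close> expresses another chart \<open>f\<close> in the coordinates of the patch. Projecting to the tangent
  plane turns \<open>F\<close> into a map with derivative the identity at the point in question.\<close>

lemma lift_derivative:
  assumes "open W" "u \<in> W" and t: "continuous_on W t" "t u \<in> \<Omega>"
    and eq: "\<And>v. v \<in> W \<Longrightarrow> F (t v) = f v" and f: "f differentiable at u"
  defines "l i \<equiv> vec2 (pd i f u \<bullet> Fx (t u) / \<mu> (t u)) (pd i f u \<bullet> Fy (t u) / \<mu> (t u))"
  shows "(t has_derivative (\<lambda>d. d$1 *\<^sub>R l 1 + d$2 *\<^sub>R l 2)) (at u)"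
    and "pd i f u = l i $ 1 *\<^sub>R Fx (t u) + l i $ 2 *\<^sub>R Fy (t u)"
proof -
  define P where "P X = vec2 (X \<bullet> Fx (t u) / \<mu> (t u)) (X \<bullet> Fy (t u) / \<mu> (t u))" for X :: "real^3"
  have P: "(P has_derivative P) (at X)" for X
  proof -
    have "((\<lambda>X. vec2 (X \<bullet> Fx (t u) / \<mu> (t u)) (X \<bullet> Fy (t u) / \<mu> (t u))) has_derivative
       (\<lambda>X. vec2 (X \<bullet> Fx (t u) / \<mu> (t u)) (X \<bullet> Fy (t u) / \<mu> (t u)))) (at X)"
      unfolding divide_inverse by (auto intro!: derivative_eq_intros)
    then show ?thesis by (simp add: P_def[abs_def])
  qed
  have "((\<lambda>q. P (F q)) has_derivative (\<lambda>d. P (d$1 *\<^sub>R Fx (t u) + d$2 *\<^sub>R Fy (t u)))) (at (t u))"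
    by (rule has_derivative_compose[OF F'[OF t(2)] P])
  moreover have "P (d$1 *\<^sub>R Fx (t u) + d$2 *\<^sub>R Fy (t u)) = d" for d
    using conformal[OF t(2)] by (simp add: P_def inner_left_distrib inner_commute[of "Fy (t u)" "Fx (t u)"])
  ultimately have G: "((\<lambda>q. P (F q)) has_derivative (\<lambda>d. d)) (at (t u))" by simp
  have g: "((\<lambda>v. P (f v)) has_derivative (\<lambda>d. P (d$1 *\<^sub>R pd 1 f u + d$2 *\<^sub>R pd 2 f u))) (at u)"
    by (rule has_derivative_compose[OF has_derivative_pd[OF f] P])
  have "P (d$1 *\<^sub>R pd 1 f u + d$2 *\<^sub>R pd 2 f u) = d$1 *\<^sub>R l 1 + d$2 *\<^sub>R l 2" for d :: "real^2"
    by (simp add: P_def l_def vec_eq_iff forall_2 inner_left_distrib add_divide_distrib)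
  with g have g: "((\<lambda>v. P (f v)) has_derivative (\<lambda>d. d$1 *\<^sub>R l 1 + d$2 *\<^sub>R l 2)) (at u)" by simp
  show *: "(t has_derivative (\<lambda>d. d$1 *\<^sub>R l 1 + d$2 *\<^sub>R l 2)) (at u)"
  proof (rule has_derivative_lift[where t=t and u=u and G="\<lambda>q. P (F q)", OF G g _ assms(1,2)])
    show "continuous (at u) t" using t(1) assms(1,2) by (simp add: continuous_on_eq_continuous_at)
  qed (simp add: eq)
  have "((\<lambda>v. F (t v)) has_derivative (\<lambda>d. (d$1 *\<^sub>R l 1 + d$2 *\<^sub>R l 2)$1 *\<^sub>R Fx (t u)
      + (d$1 *\<^sub>R l 1 + d$2 *\<^sub>R l 2)$2 *\<^sub>R Fy (t u))) (at u)"
    by (rule has_derivative_compose[OF * F'[OF t(2)]])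
  then have "(f has_derivative (\<lambda>d. (d$1 *\<^sub>R l 1 + d$2 *\<^sub>R l 2)$1 *\<^sub>R Fx (t u)
      + (d$1 *\<^sub>R l 1 + d$2 *\<^sub>R l 2)$2 *\<^sub>R Fy (t u))) (at u)"
    by (rule has_derivative_transform_within_open[OF _ assms(1,2)]) (simp add: eq)
  then have "(f has_derivative (\<lambda>d. d$1 *\<^sub>R (l 1 $ 1 *\<^sub>R Fx (t u) + l 1 $ 2 *\<^sub>R Fy (t u))
      + d$2 *\<^sub>R (l 2 $ 1 *\<^sub>R Fx (t u) + l 2 $ 2 *\<^sub>R Fy (t u)))) (at u)"
    by (rule has_derivative_eq_rhs) (auto simp: algebra_simps)
  from pd_eqI[OF this] show "pd i f u = l i $ 1 *\<^sub>R Fx (t u) + l i $ 2 *\<^sub>R Fy (t u)"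
    using exhaust_2[of i] by auto
qed

text \<open>Differentiate the equation that the partial derivatives of \<open>f\<close> are orthogonal to \<open>n \<circ> t\<close>. This
  needs the first derivative of \<open>t\<close> only.\<close>

lemma lift_second_derivative:
  assumes "open W" "u \<in> W" and t: "continuous_on W t" "\<And>v. v \<in> W \<Longrightarrow> t v \<in> \<Omega>"
    and eq: "\<And>v. v \<in> W \<Longrightarrow> F (t v) = f v"
    and f: "f differentiable_on W" "\<And>i. pd i f differentiable_on W"
  defines "l i \<equiv> vec2 (pd i f u \<bullet> Fx (t u) / \<mu> (t u)) (pd i f u \<bullet> Fy (t u) / \<mu> (t u))"
  shows "pd j (pd i f) u \<bullet> n (t u) = (l i$1 * l j$1 - l i$2 * l j$2) * \<alpha> (t u)
    + (l i$1 * l j$2 + l i$2 * l j$1) * \<beta> (t u)"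
proof -
  have diff: "f differentiable at v" "pd i f differentiable at v" if "v \<in> W" for v i
    using f that assms(1) by (auto simp: differentiable_on_eq_differentiable_at)
  have orth: "pd i f v \<bullet> n (t v) = 0" if v: "v \<in> W" for v
  proof -
    from lift_derivative(2)[OF assms(1) v t(1) t(2)[OF v] eq diff(1)[OF v], of i]
    have "pd i f v \<bullet> n (t v) = ((pd i f v \<bullet> Fx (t v) / \<mu> (t v)) *\<^sub>R Fx (t v)
        + (pd i f v \<bullet> Fy (t v) / \<mu> (t v)) *\<^sub>R Fy (t v)) \<bullet> n (t v)"
      by simp
    then show ?thesis
      by (simp only: inner_left_distrib inner_scaleR_left normal_orthogonal[OF t(2)[OF v]]
          mult_zero_right add_0_right)
  qed
  have u: "u \<in> W" by fact
  note q = t(2)[OF u]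
  have t': "(t has_derivative (\<lambda>d. d$1 *\<^sub>R l 1 + d$2 *\<^sub>R l 2)) (at u)"
    and pd: "\<And>i. pd i f u = l i $ 1 *\<^sub>R Fx (t u) + l i $ 2 *\<^sub>R Fy (t u)"
    unfolding l_def by (rule lift_derivative[OF assms(1) u t(1) q eq diff(1)[OF u]]; assumption)+
  have nt: "((\<lambda>v. n (t v)) has_derivative (\<lambda>d. (d$1 *\<^sub>R l 1 + d$2 *\<^sub>R l 2)$1 *\<^sub>R nx (t u)
      + (d$1 *\<^sub>R l 1 + d$2 *\<^sub>R l 2)$2 *\<^sub>R ny (t u))) (at u)"
    by (rule has_derivative_compose[OF t' n'[OF q]])
  note D = has_derivative_inner[OF has_derivative_pd[OF diff(2)[OF u, of i]] nt]
  have D0: "((\<lambda>v. pd i f v \<bullet> n (t v)) has_derivative (\<lambda>d. 0)) (at u)"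
    by (rule has_derivative_transform_within_open[OF _ assms(1,2)]) (auto simp: orth)
  have "pd i f u \<bullet> ((d$1 *\<^sub>R l 1 + d$2 *\<^sub>R l 2)$1 *\<^sub>R nx (t u) + (d$1 *\<^sub>R l 1 + d$2 *\<^sub>R l 2)$2 *\<^sub>R ny (t u))
      + (d$1 *\<^sub>R pd 1 (pd i f) u + d$2 *\<^sub>R pd 2 (pd i f) u) \<bullet> n (t u) = 0" for d :: "real^2"
    using fun_cong[OF has_derivative_unique[OF D D0], of d] .
  from this[of "axis j 1"] have "pd j (pd i f) u \<bullet> n (t u)
      = - (pd i f u \<bullet> (l j$1 *\<^sub>R nx (t u) + l j$2 *\<^sub>R ny (t u)))"
    using exhaust_2[of j] by (auto simp: axis_def algebra_simps)
  then show ?thesis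
    by (simp add: pd[of i] inner_left_distrib inner_right_distrib second[OF q] algebra_simps)
qed

text \<open>The relations between the forms hold at interior points by differentiation and on the boundary
  line by continuity. The rest is linear algebra.\<close>

theorem chart_curvature:
  assumes D: "openin (top_of_set half_plane) D" and V: "open V" "D \<subseteq> V" and f: "smooth_on f V"
    and inj: "\<And>u. u \<in> D \<Longrightarrow> inj (frechet_derivative f (at u))"
    and t: "continuous_on D t" "\<And>v. v \<in> D \<Longrightarrow> t v \<in> \<Omega>" "\<And>v. v \<in> D \<Longrightarrow> F (t v) = f v"
    and u: "u \<in> D"
  shows "mean_curvature f u = 0"
    and "trace (shape_operator f u ** shape_operator f u)
      = 2 * ((\<alpha> (t u))\<^sup>2 + (\<beta> (t u))\<^sup>2) / (\<mu> (t u))\<^sup>2"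
proof -
  have C2: "Ck_on (Suc (Suc 0)) f V" using f by (simp add: smooth_on_def)
  have df: "f differentiable_on V" "\<And>i. pd i f differentiable_on V"
    and cont2: "\<And>i j. continuous_on V (pd j (pd i f))"
    using C2 by simp_all
  have diff: "f differentiable at v" if "v \<in> D" for v
    using df(1) V that by (auto simp: differentiable_on_eq_differentiable_at)
  have cont1: "\<And>i. continuous_on V (pd i f)"
    using df(2) by (rule differentiable_imp_continuous_on)
  define l where "l i v = vec2 (pd i f v \<bullet> Fx (t v) / \<mu> (t v)) (pd i f v \<bullet> Fy (t v) / \<mu> (t v))" for i v
  let ?W = "D \<inter> {u. 0 < u$2}"
  have W: "open ?W" by (rule half_plane_upper_open[OF D])
  have contt: "continuous_on D (\<lambda>v. \<phi> (t v))" if "continuous_on \<Omega> \<phi>" for \<phi> :: "real^2 \<Rightarrow> 'z::real_normed_vector"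
    by (rule continuous_on_compose2[OF that t(1)]) (use t(2) in auto)
  have contl: "continuous_on D (l i)" for i
  proof -
    have "\<forall>v\<in>D. \<mu> (t v) \<noteq> 0" using conformal(4) t(2) by (metis less_irrefl)
    then show ?thesis
      unfolding l_def by (intro continuous_intros contt cont continuous_on_subset[OF cont1 V(2)]) auto
  qed
  have R1: "pd i f u = l i u $ 1 *\<^sub>R Fx (t u) + l i u $ 2 *\<^sub>R Fy (t u)" for i
  proof -
    have "pd i f u - (l i u $ 1 *\<^sub>R Fx (t u) + l i u $ 2 *\<^sub>R Fy (t u)) = 0"
    proof (rule half_plane_density[OF D _ _ u])
      show "continuous_on D (\<lambda>u. pd i f u - (l i u $ 1 *\<^sub>R Fx (t u) + l i u $ 2 *\<^sub>R Fy (t u)))"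
        by (intro continuous_intros contt cont contl continuous_on_subset[OF cont1 V(2)])
      fix v assume v: "v \<in> D" "0 < v$2"
      have "continuous_on ?W t" using t(1) by (rule continuous_on_subset) auto
      then have "pd i f v = l i v $ 1 *\<^sub>R Fx (t v) + l i v $ 2 *\<^sub>R Fy (t v)"
        unfolding l_def using v t diff by (intro lift_derivative(2)[OF W]) auto
      then show "pd i f v - (l i v $ 1 *\<^sub>R Fx (t v) + l i v $ 2 *\<^sub>R Fy (t v)) = 0"
        by simp
    qed
    then show ?thesis by simp
  qed
  have R2: "pd j (pd i f) u \<bullet> n (t u) = (l i u$1 * l j u$1 - l i u$2 * l j u$2) * \<alpha> (t u)
    + (l i u$1 * l j u$2 + l i u$2 * l j u$1) * \<beta> (t u)" for i j
  proof -
    have "continuous_on \<Omega> n"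
      by (rule continuous_at_imp_continuous_on) (use n' has_derivative_continuous in blast)
    then have "pd j (pd i f) u \<bullet> n (t u) - ((l i u$1 * l j u$1 - l i u$2 * l j u$2) * \<alpha> (t u)
      + (l i u$1 * l j u$2 + l i u$2 * l j u$1) * \<beta> (t u)) = 0"
    proof (intro half_plane_density[OF D _ _ u, where \<phi>="\<lambda>u. pd j (pd i f) u \<bullet> n (t u) -
          ((l i u$1 * l j u$1 - l i u$2 * l j u$2) * \<alpha> (t u)
          + (l i u$1 * l j u$2 + l i u$2 * l j u$1) * \<beta> (t u))"] continuous_intros contt cont contl
          continuous_on_subset[OF cont2 V(2)])
      fix v assume v: "v \<in> D" "0 < v$2"
      have "continuous_on ?W t" using t(1) by (rule continuous_on_subset) auto
      moreover have "?W \<subseteq> V" using V by auto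
      ultimately have "pd j (pd i f) v \<bullet> n (t v) = (l i v$1 * l j v$1 - l i v$2 * l j v$2) * \<alpha> (t v)
          + (l i v$1 * l j v$2 + l i v$2 * l j v$1) * \<beta> (t v)"
        unfolding l_def using v t
          differentiable_on_subset[OF df(1)] differentiable_on_subset[OF df(2)]
        by (intro lift_second_derivative[OF W]) auto
      then show "pd j (pd i f) v \<bullet> n (t v) - ((l i v$1 * l j v$1 - l i v$2 * l j v$2) * \<alpha> (t v)
          + (l i v$1 * l j v$2 + l i v$2 * l j v$1) * \<beta> (t v)) = 0"
        by simp
    qed auto
    then show ?thesis by simp
  qed
  note q = t(2)[OF u]
  define L where "L = (\<chi> i k. l i u $ k)"
  define M :: "real^2^2" where
    "M = (\<chi> i j. if i = j then if i = 1 then \<alpha> (t u) else - \<alpha> (t u) else \<beta> (t u))"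
  define \<delta> where "\<delta> = l 1 u $ 1 * l 2 u $ 2 - l 1 u $ 2 * l 2 u $ 1"
  define \<sigma> where "\<sigma> = sgn \<delta>"
  have \<delta>: "\<delta> \<noteq> 0"
  proof
    assume \<delta>0: "\<delta> = 0"
    have ker: "d = 0" if "\<And>k. d$1 * l 1 u $ k + d$2 * l 2 u $ k = 0" for d :: "real^2"
    proof -
      have "frechet_derivative f (at u) d = (d$1 * l 1 u $ 1 + d$2 * l 2 u $ 1) *\<^sub>R Fx (t u)
          + (d$1 * l 1 u $ 2 + d$2 * l 2 u $ 2) *\<^sub>R Fy (t u)"
        by (simp add: linear_pd[OF diff[OF u]] R1 algebra_simps)
      also have "\<dots> = frechet_derivative f (at u) 0"
        by (simp only: that linear_pd[OF diff[OF u]]) simp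
      finally show ?thesis using inj[OF u] by (auto dest: injD)
    qed
    \<comment> \<open>if the determinant vanished, then the columns of the adjugate would be in the kernel\<close>
    have *: "vec2 (l 2 u $ j) (- l 1 u $ j) = 0" for j
    proof (rule ker)
      show "vec2 (l 2 u $ j) (- l 1 u $ j) $ 1 * l 1 u $ k + vec2 (l 2 u $ j) (- l 1 u $ j) $ 2 * l 2 u $ k = 0" for k
        using \<delta>0 exhaust_2[of j] exhaust_2[of k] by (auto simp: \<delta>_def algebra_simps)
    qed
    have z: "l 1 u $ j = 0" "l 2 u $ j = 0" for j
      using arg_cong[OF *[of j], of "\<lambda>v. v$1"] arg_cong[OF *[of j], of "\<lambda>v. v$2"] by simp_all
    have "vec2 1 0 = 0" by (rule ker) (simp add: z)
    then have "vec2 1 0 $ 1 = (0 :: real^2) $ 1" by simp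
    then show False by simp
  qed
  have \<sigma>: "\<sigma> * \<sigma> = 1" using \<delta> by (simp add: \<sigma>_def sgn_if)
  have L: "invertible L"
    using \<delta> by (simp add: invertible_det_nz det_2 L_def \<delta>_def)
  have "cross3 (pd 1 f u) (pd 2 f u) = (\<delta> * \<mu> (t u)) *\<^sub>R n (t u)"
    unfolding R1 cross3_combination normal(1)[OF q] by (simp add: \<delta>_def)
  moreover have "norm ((\<delta> * \<mu> (t u)) *\<^sub>R n (t u)) = \<bar>\<delta>\<bar> * \<mu> (t u)"
    using conformal(4)[OF q] normal(2)[OF q] by (simp add: abs_mult)
  ultimately have un: "unit_normal f u = \<sigma> *\<^sub>R n (t u)"
    using conformal(4)[OF q] \<delta> by (simp add: unit_normal_def \<sigma>_def sgn_if field_simps)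
  have G: "first_form f u = \<mu> (t u) *\<^sub>R (L ** transpose L)"
    by (simp add: first_form_def R1 vec_eq_iff L_def matrix_matrix_mult_def transpose_def sum_2
        inner_left_distrib inner_right_distrib conformal[OF q] inner_commute[of "Fy (t u)" "Fx (t u)"]
        algebra_simps)
  have H: "second_form f u = \<sigma> *\<^sub>R (L ** M ** transpose L)"
    by (simp add: second_form_def un R2 vec_eq_iff forall_2 L_def M_def matrix_matrix_mult_def
        transpose_def sum_2 algebra_simps)
  have "\<mu> (t u) \<noteq> 0" using conformal(4)[OF q] by simp
  note S = shape_algebra[OF this L \<sigma> G H]
  have "trace M = 0" by (simp add: trace_def sum_2 M_def)
  then show "mean_curvature f u = 0"
    using S(1) by (simp add: mean_curvature_def shape_operator_def)
  have "trace (M ** M) = 2 * ((\<alpha> (t u))\<^sup>2 + (\<beta> (t u))\<^sup>2)"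
    by (simp add: trace_def sum_2 M_def matrix_matrix_mult_def power2_eq_square)
  then show "trace (shape_operator f u ** shape_operator f u)
      = 2 * ((\<alpha> (t u))\<^sup>2 + (\<beta> (t u))\<^sup>2) / (\<mu> (t u))\<^sup>2"
    using S(2) by (simp add: shape_operator_def)
qed

text \<open>It suffices that the patch covers the surface and that its inverse is continuous on it. In
  particular the trace that defines \<open>norm_A_sq\<close> is the same in all charts.\<close>

theorem surface_curvature:
  assumes S: "embedded_surface S"
    and g: "continuous_on S g" "\<And>X. X \<in> S \<Longrightarrow> g X \<in> \<Omega>" "\<And>X. X \<in> S \<Longrightarrow> F (g X) = X"
  shows "minimal_surface S"
    and "X \<in> S \<Longrightarrow> norm_A_sq S X = 2 * ((\<alpha> (g X))\<^sup>2 + (\<beta> (g X))\<^sup>2) / (\<mu> (g X))\<^sup>2"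
proof -
  have *: "mean_curvature f u = 0 \<and> trace (shape_operator f u ** shape_operator f u)
      = 2 * ((\<alpha> (g (f u)))\<^sup>2 + (\<beta> (g (f u)))\<^sup>2) / (\<mu> (g (f u)))\<^sup>2"
    if "surface_chart S f D" "u \<in> D" for f D u
  proof -
    from that obtain V where D: "openin (top_of_set half_plane) D" "openin (top_of_set S) (f ` D)"
      and V: "open V" "D \<subseteq> V" "smooth_on f V"
      and inj: "\<forall>u\<in>D. inj (frechet_derivative f (at u))" and hom: "\<exists>h. homeomorphism D (f ` D) f h"
      by (auto simp: surface_chart_def regular_param_def)
    have sub: "f ` D \<subseteq> S" using D(2) openin_imp_subset by blast
    have "continuous_on D f" using hom by (auto simp: homeomorphism_def)
    then have "continuous_on D (\<lambda>u. g (f u))"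
      by (rule continuous_on_compose2[OF g(1)]) (use sub in auto)
    with chart_curvature[OF D(1) V, of "\<lambda>u. g (f u)" u] inj sub g that(2)
    show ?thesis by (simp add: image_subset_iff)
  qed
  then show "minimal_surface S" using S by (auto simp: minimal_surface_def)
  show "norm_A_sq S X = 2 * ((\<alpha> (g X))\<^sup>2 + (\<beta> (g X))\<^sup>2) / (\<mu> (g X))\<^sup>2" if "X \<in> S"
    unfolding norm_A_sq_def
  proof (rule the_equality)
    show "\<exists>f D u. surface_chart S f D \<and> u \<in> D \<and> f u = X \<and>
      2 * ((\<alpha> (g X))\<^sup>2 + (\<beta> (g X))\<^sup>2) / (\<mu> (g X))\<^sup>2 = trace (shape_operator f u ** shape_operator f u)"
      using S that * unfolding embedded_surface_def by (smt (verit, best) imageE)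
  qed (use * in auto)
qed

end

lemma embedded_surface_open_subset:
  assumes S: "embedded_surface S" and T: "openin (top_of_set S) T"
  shows "embedded_surface T"
  unfolding embedded_surface_def
proof
  fix p assume p: "p \<in> T"
  have "T \<subseteq> S" using T openin_imp_subset by blast
  with p obtain f D where ch: "surface_chart S f D" and pD: "p \<in> f ` D"
    using S unfolding embedded_surface_def by blast
  from ch obtain V h where D: "openin (top_of_set half_plane) D" "openin (top_of_set S) (f ` D)"
    and V: "open V" "D \<subseteq> V" "smooth_on f V"
    and inj: "\<forall>u\<in>D. inj (frechet_derivative f (at u))" and hom: "homeomorphism D (f ` D) f h"
    by (auto simp: surface_chart_def regular_param_def)
  define E where "E = D \<inter> f -` T"
  obtain T' where T': "open T'" "T = S \<inter> T'" using T by (auto simp: openin_open)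
  have fDS: "f ` D \<subseteq> S" using D(2) openin_imp_subset by blast
  have "continuous_on D f" using hom by (auto simp: homeomorphism_def)
  then have "openin (top_of_set D) (D \<inter> f -` T')"
    by (intro continuous_openin_preimage_gen T'(1))
  moreover have "D \<inter> f -` T' = E" using fDS by (auto simp: E_def T')
  ultimately have "openin (top_of_set half_plane) E" using D(1) openin_trans by metis
  moreover have "f ` E = f ` D \<inter> T" by (auto simp: E_def)
  then have "openin (top_of_set T) (f ` E)"
    using D(2) T by (metis \<open>T \<subseteq> S\<close> inf_commute openin_subset_trans openin_Int inf_le1)
  moreover have "regular_param f E (f ` E)"
    unfolding regular_param_def
  proof (intro conjI)
    show "\<exists>h. homeomorphism E (f ` E) f h"
      using homeomorphism_of_subsets[OF hom, of E "f ` E" "f ` E"] by (auto simp: E_def)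
  qed (use V inj in \<open>auto simp: E_def\<close>)
  ultimately have "surface_chart T f E" by (simp add: surface_chart_def)
  moreover have "p \<in> f ` E" using p pD by (auto simp: E_def)
  ultimately show "\<exists>f D. surface_chart T f D \<and> p \<in> f ` D" by blast
qed

section \<open>The holomorphic data\<close>

definition cvec :: "real^2 \<Rightarrow> complex" where
  "cvec p = Complex (p$1) (p$2)"

lemma cvec_simps [simp]: "Re (cvec p) = p$1" "Im (cvec p) = p$2"
  by (simp_all add: cvec_def)

lemma bounded_linear_cvec: "bounded_linear cvec"
proof -
  have "cvec = (\<lambda>p. of_real (p$1) + \<i> * of_real (p$2))"
    by (auto simp: complex_eq_iff)
  moreover have "bounded_linear (\<lambda>p::real^2. of_real (p$1) + \<i> * of_real (p$2) :: complex)"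
    by (intro bounded_linear_add bounded_linear_const_mult bounded_linear_vec_nth
        bounded_linear_compose[OF bounded_linear_of_real])
  ultimately show ?thesis by simp
qed

lemma continuous_on_cvec [continuous_intros]:
  "continuous_on T f \<Longrightarrow> continuous_on T (\<lambda>x. cvec (f x))"
  by (rule bounded_linear.continuous_on[OF bounded_linear_cvec])

lemma has_derivative_Re_Im_cvec:
  assumes "(f has_field_derivative D) (at (cvec p))"
  shows "((\<lambda>p. Re (f (cvec p))) has_derivative (\<lambda>d. d$1 * Re D + d$2 * (- Im D))) (at p)"
    and "((\<lambda>p. Im (f (cvec p))) has_derivative (\<lambda>d. d$1 * Im D + d$2 * Re D)) (at p)"
proof -
  have *: "((\<lambda>p. f (cvec p)) has_derivative (\<lambda>d. D * cvec d)) (at p)"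
    by (rule has_derivative_compose[OF bounded_linear_imp_has_derivative[OF bounded_linear_cvec]
          assms[unfolded has_field_derivative_def]])
  show "((\<lambda>p. Re (f (cvec p))) has_derivative (\<lambda>d. d$1 * Re D + d$2 * (- Im D))) (at p)"
    using has_derivative_Re[OF *] by (rule has_derivative_eq_rhs) (auto simp: algebra_simps)
  show "((\<lambda>p. Im (f (cvec p))) has_derivative (\<lambda>d. d$1 * Im D + d$2 * Re D)) (at p)"
    using has_derivative_Im[OF *] by (rule has_derivative_eq_rhs) (auto simp: algebra_simps)
qed

lemma has_real_derivative_partials:
  fixes f :: "real^2 \<Rightarrow> real"
  assumes "(f has_derivative (\<lambda>d. d$1 * a + d$2 * b)) (at (vec2 x y))"
  shows "((\<lambda>y. f (vec2 x y)) has_real_derivative b) (at y)"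
    and "((\<lambda>x. f (vec2 x y)) has_real_derivative a) (at x)"
proof -
  have 1: "((\<lambda>y. vec2 x y) has_derivative (\<lambda>d. vec2 0 d)) (at y)"
    and 2: "((\<lambda>x. vec2 x y) has_derivative (\<lambda>d. vec2 d 0)) (at x)"
    by (auto intro!: derivative_intros)
  show "((\<lambda>y. f (vec2 x y)) has_real_derivative b) (at y)"
    using has_derivative_compose[OF 1 assms] by (simp add: has_field_derivative_def mult_commute_abs)
  show "((\<lambda>x. f (vec2 x y)) has_real_derivative a) (at x)"
    using has_derivative_compose[OF 2 assms] by (simp add: has_field_derivative_def mult_commute_abs)
qed

lemma Re_Im_sin_cos:
  "Re (sin z) = sin (Re z) * cosh (Im z)" "Im (sin z) = cos (Re z) * sinh (Im z)"
  "Re (cos z) = cos (Re z) * cosh (Im z)" "Im (cos z) = - (sin (Re z) * sinh (Im z))"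
  by (simp_all add: Re_sin Im_sin Re_cos Im_cos cosh_field_def sinh_field_def)
     (simp_all add: field_simps)

definition radius :: "real \<Rightarrow> real \<Rightarrow> real" where
  "radius a x = sqrt (x\<^sup>2 + a\<^sup>2)"

text \<open>The bound for \<open>\<bar>y\<bar>\<close> on the slice at height \<open>x\<close>. With \<open>s = radius a x\<close>, the bound \<open>s / 2\<close> keeps both
  the real part and the modulus of \<open>h'\<close> comparable to \<open>twist / s\<^sup>2\<close>. The bound \<open>s\<^sup>3\<^sup>/\<^sup>2 / 2\<^sup>1\<^sup>4\<close> keeps the variation of \<open>u\<close>
  at most \<open>1/2\<close>, while \<open>y / s\<^sup>2\<close> can still become large for small \<open>s\<close>.\<close>

definition height :: "real \<Rightarrow> real \<Rightarrow> real" where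
  "height a x = min (radius a x / 2) (radius a x * sqrt (radius a x) / 2^14)"

text \<open>The numerator of \<open>h'\<close>. It fixes the scale of the surfaces and is so large that all slices leave
  the unit cylinder.\<close>

definition twist :: real where "twist = 2^26"

lemma twist_pos [simp]: "twist > 0" by (simp add: twist_def)

definition denom :: "real \<Rightarrow> real^2 \<Rightarrow> real" where
  "denom a p = ((p$1)\<^sup>2 + a\<^sup>2 - (p$2)\<^sup>2)\<^sup>2 + (2 * p$1 * p$2)\<^sup>2"

text \<open>The real part \<open>hx\<close> and the imaginary part \<open>hy\<close> of \<open>h' = twist / (z\<^sup>2 + a\<^sup>2)\<close>.\<close>

definition hx :: "real \<Rightarrow> real^2 \<Rightarrow> real" where
  "hx a p = twist * ((p$1)\<^sup>2 + a\<^sup>2 - (p$2)\<^sup>2) / denom a p"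

definition hy :: "real \<Rightarrow> real^2 \<Rightarrow> real" where
  "hy a p = - (twist * (2 * p$1 * p$2) / denom a p)"

lemma Re_Im_derivative_h:
  "Re (of_real twist / ((cvec p)\<^sup>2 + (of_real a)\<^sup>2)) = hx a p"
  "Im (of_real twist / ((cvec p)\<^sup>2 + (of_real a)\<^sup>2)) = hy a p"
  by (simp_all add: Re_divide Im_divide Re_power2 Im_power2 hx_def hy_def denom_def algebra_simps)

lemma
  assumes "0 < x\<^sup>2 + a\<^sup>2" "\<bar>y\<bar> < height a x"
  defines "s \<equiv> radius a x"
  shows radius_pos: "0 < s" and denom_pos: "0 < denom a (vec2 x y)"
    and hx_lower: "twist / (4 * s\<^sup>2) \<le> hx a (vec2 x y)"
    and hy_bound: "\<bar>hy a (vec2 x y)\<bar> \<le> 4 * twist * \<bar>y\<bar> / s^3"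
    and h'_bound: "(hx a (vec2 x y))\<^sup>2 + (hy a (vec2 x y))\<^sup>2 \<le> 4 * twist\<^sup>2 / s^4"
proof -
  show s: "0 < s" using assms(1) by (simp add: s_def radius_def)
  have s2: "s\<^sup>2 = x\<^sup>2 + a\<^sup>2" by (simp add: s_def radius_def)
  have ys: "\<bar>y\<bar> \<le> s / 2" using assms(2) by (simp add: height_def s_def)
  then have "\<bar>y\<bar>\<^sup>2 \<le> (s/2)\<^sup>2" by (intro power_mono) auto
  then have y2: "4 * y\<^sup>2 \<le> s\<^sup>2" by (simp add: power_divide)
  have xs: "x\<^sup>2 \<le> s\<^sup>2" using s2 by simp
  then have xs': "\<bar>x\<bar> \<le> s" using s by (simp add: abs_le_square_iff[symmetric])
  define N where "N = denom a (vec2 x y)"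
  have N: "N = (s\<^sup>2 - y\<^sup>2)\<^sup>2 + 4 * x\<^sup>2 * y\<^sup>2"
    by (simp add: N_def denom_def s2 power_mult_distrib)
  have "(3/4 * s\<^sup>2)\<^sup>2 \<le> (s\<^sup>2 - y\<^sup>2)\<^sup>2" using y2 by (intro power_mono) auto
  moreover have "(3/4 * s\<^sup>2)\<^sup>2 = 9/16 * s^4" by (simp add: power_mult_distrib power_divide)
  moreover have "0 \<le> 4 * x\<^sup>2 * y\<^sup>2" by simp
  ultimately have N1: "9/16 * s^4 \<le> N" unfolding N by linarith
  moreover have "0 < 9/16 * s^4" using s by simp
  ultimately have Np: "0 < N" by linarith
  then show "0 < denom a (vec2 x y)" by (simp add: N_def)
  have "x\<^sup>2 * y\<^sup>2 \<le> s\<^sup>2 * y\<^sup>2" using xs by (intro mult_right_mono) auto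
  then have "N \<le> (s\<^sup>2 + y\<^sup>2)\<^sup>2" by (simp add: N power2_eq_square algebra_simps)
  also have "\<dots> \<le> (5/4 * s\<^sup>2)\<^sup>2" using y2 by (intro power_mono) auto
  also have "\<dots> \<le> (4 * s\<^sup>2) * (3/4 * s\<^sup>2)" using s by (simp add: power2_eq_square)
  also have "\<dots> \<le> (4 * s\<^sup>2) * (s\<^sup>2 - y\<^sup>2)" using y2 by (intro mult_left_mono) auto
  finally have N2: "N \<le> (4 * s\<^sup>2) * (s\<^sup>2 - y\<^sup>2)" .
  have hxN: "hx a (vec2 x y) = twist * (s\<^sup>2 - y\<^sup>2) / N" by (simp add: hx_def s2 N_def)
  have hyN: "hy a (vec2 x y) = - (twist * (2 * x * y) / N)" by (simp add: hy_def N_def)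
  have "twist * N \<le> twist * ((4 * s\<^sup>2) * (s\<^sup>2 - y\<^sup>2))"
    using N2 by (intro mult_left_mono) (auto simp: less_imp_le)
  then show "twist / (4 * s\<^sup>2) \<le> hx a (vec2 x y)"
    unfolding hxN using s Np by (simp add: divide_le_eq le_divide_eq field_simps)
  have "\<bar>hy a (vec2 x y)\<bar> = twist * (2 * \<bar>x\<bar> * \<bar>y\<bar>) / N"
    using Np by (simp add: hyN abs_mult abs_of_pos)
  also have "\<dots> \<le> twist * (2 * s * \<bar>y\<bar>) / (9/16 * s^4)"
    using N1 s xs' by (intro frac_le mult_left_mono mult_right_mono) (auto simp: less_imp_le)
  also have "\<dots> = 32/9 * twist * \<bar>y\<bar> / s^3"
    using s by (simp add: field_simps power_numeral_reduce)
  also have "\<dots> \<le> 4 * twist * \<bar>y\<bar> / s^3"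
    using s by (intro divide_right_mono mult_right_mono) (auto simp: less_imp_le)
  finally show "\<bar>hy a (vec2 x y)\<bar> \<le> 4 * twist * \<bar>y\<bar> / s^3" .
  have "(hx a (vec2 x y))\<^sup>2 + (hy a (vec2 x y))\<^sup>2 = twist\<^sup>2 * N / N\<^sup>2"
  proof -
    have "twist\<^sup>2 * N = (twist * (s\<^sup>2 - y\<^sup>2))\<^sup>2 + (twist * (2 * x * y))\<^sup>2"
      unfolding N power_mult_distrib by (simp add: distrib_left)
    then show ?thesis by (simp add: hxN hyN power_divide add_divide_distrib)
  qed
  also have "\<dots> = twist\<^sup>2 / N" using Np by (simp add: power2_eq_square)
  also have "\<dots> \<le> twist\<^sup>2 / (9/16 * s^4)" using N1 s by (intro frac_le) auto
  also have "\<dots> \<le> twist\<^sup>2 / (1/4 * s^4)" using s by (intro frac_le) auto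
  finally show "(hx a (vec2 x y))\<^sup>2 + (hy a (vec2 x y))\<^sup>2 \<le> 4 * twist\<^sup>2 / s^4" by (simp add: mult.commute)
qed

lemma height_pos: "0 < x\<^sup>2 + a\<^sup>2 \<Longrightarrow> 0 < height a x"
  by (simp add: height_def radius_def)

lemma height_le: "height a x \<le> radius a x / 2"
  "height a x \<le> radius a x * sqrt (radius a x) / 2^14"
  by (auto simp: height_def)

lemma continuous_on_height [continuous_intros]:
  "continuous_on T f \<Longrightarrow> continuous_on T g \<Longrightarrow> continuous_on T (\<lambda>t. height (f t) (g t))"
  unfolding height_def radius_def by (intro continuous_intros) auto

text \<open>Reflection principle on a vertical segment. It makes the surfaces symmetric under the rotation by
  \<open>pi\<close> about the axis, so that one half of each slice determines the other.\<close>

lemma cnj_of_primitive: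
  fixes f g :: "complex \<Rightarrow> complex"
  assumes D: "\<And>t. \<bar>t\<bar> \<le> \<bar>y\<bar> \<Longrightarrow> (f has_field_derivative g (Complex x t)) (at (Complex x t))"
    and g: "\<And>t. \<bar>t\<bar> \<le> \<bar>y\<bar> \<Longrightarrow> g (cnj (Complex x t)) = cnj (g (Complex x t))"
    and 0: "Im (f (of_real x)) = 0"
  shows "f (cnj (Complex x y)) = cnj (f (Complex x y))"
proof -
  define \<phi> where "\<phi> t = f (Complex x (- t)) - cnj (f (Complex x t))" for t
  have path: "((\<lambda>t. Complex x (e * t)) has_vector_derivative (of_real e * \<i>)) (at t within T)" for e t T
  proof -
    have "((\<lambda>t. of_real x + \<i> * of_real (e * t)) has_vector_derivative (of_real e * \<i>)) (at t within T)"
      by (auto intro!: derivative_eq_intros)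
    then show ?thesis by (simp add: Complex_eq)
  qed
  have "(\<phi> has_vector_derivative 0) (at t within closed_segment 0 y)" if t: "t \<in> closed_segment 0 y" for t
  proof -
    have ty: "\<bar>t\<bar> \<le> \<bar>y\<bar>" using t by (auto simp: closed_segment_eq_real_ivl split: if_splits)
    have 1: "((\<lambda>t. f (Complex x (e * t))) has_vector_derivative (of_real e * \<i> * g (Complex x (e * t))))
        (at t within closed_segment 0 y)" if "\<bar>e\<bar> = 1" for e
      using field_vector_diff_chain_within[OF path has_field_derivative_at_within[OF D], of e t]
        ty that by (simp add: o_def abs_mult)
    have "g (Complex x (-t)) = cnj (g (Complex x t))"
      using g[OF ty] by (simp add: cnj.code)
    then show ?thesis
      unfolding \<phi>_def
      using has_vector_derivative_diff[OF 1[of "-1"] has_vector_derivative_cnj[OF 1[of 1]]] by simp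
  qed
  then have "\<phi> y = \<phi> 0"
    using has_vector_derivative_zero_constant[of "closed_segment 0 y" \<phi>] by force
  moreover have "\<phi> 0 = 0" using 0 by (simp add: \<phi>_def complex_eq_iff Complex_eq)
  ultimately show ?thesis by (simp add: \<phi>_def cnj.code)
qed

text \<open>The fourth power is the one for which the length of the slices is bounded below independently
  of \<open>s\<close> when \<open>y\<close> is a multiple of \<open>s\<^sup>3\<^sup>/\<^sup>2\<close>.\<close>

lemma sinh_lower_bound:
  fixes t :: real assumes "0 \<le> t" shows "t^4 / 512 \<le> sinh t"
proof -
  have "(1 + t/4)^4 \<le> exp t"
    using exp_ge_one_plus_x_over_n_power_n[of 4 t] assms by simp
  moreover have "1 + t^4 / 256 \<le> (1 + t/4)^4"
    using assms by (simp add: power4_eq_xxxx field_simps)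
  ultimately have "1 + t^4 / 256 \<le> exp t" by linarith
  moreover have "exp (-t) \<le> 1" using assms by simp
  ultimately have "(exp t - 1) / 2 \<le> (exp t - exp (-t)) / 2"
    by (intro divide_right_mono diff_left_mono) auto
  moreover have "t^4 / 512 \<le> (exp t - 1) / 2" using \<open>1 + t^4 / 256 \<le> exp t\<close> by simp
  ultimately show ?thesis unfolding sinh_field_def by (rule order_trans[rotated])
qed

definition height_domain :: "real set \<Rightarrow> real set \<Rightarrow> (real \<times> (real^2)) set" where
  "height_domain A J = {(a, p). a \<in> A \<and> p$1 \<in> J \<and> \<bar>p$2\<bar> < height a (p$1)}"

text \<open>A family of immersions \<open>(Im (S a), - Im (C a), Re)\<close> over the interval \<open>J\<close> of heights. It is used
  for a single positive parameter with \<open>J\<close> the whole line, and for a sequence of parameters together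
  with its limit \<open>0\<close> on a half line. Only joint continuity of \<open>h\<close> is demanded; that of the derivatives
  follows from the formula for \<open>h'\<close>.\<close>

locale helicoidal_family =
  fixes A J :: "real set" and h S C :: "real \<Rightarrow> complex \<Rightarrow> complex"
  assumes J: "open J" "convex J" "J \<noteq> {}"
    and radius: "a \<in> A \<Longrightarrow> x \<in> J \<Longrightarrow> 0 < x\<^sup>2 + a\<^sup>2"
    and h': "(a, p) \<in> height_domain A J \<Longrightarrow>
      (h a has_field_derivative of_real twist / ((cvec p)\<^sup>2 + (of_real a)\<^sup>2)) (at (cvec p))"
    and S': "(a, p) \<in> height_domain A J \<Longrightarrow> (S a has_field_derivative sin (h a (cvec p))) (at (cvec p))"
    and C': "(a, p) \<in> height_domain A J \<Longrightarrow> (C a has_field_derivative cos (h a (cvec p))) (at (cvec p))"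
    and real_on_axis: "a \<in> A \<Longrightarrow> x \<in> J \<Longrightarrow> Im (h a (of_real x)) = 0"
      "a \<in> A \<Longrightarrow> x \<in> J \<Longrightarrow> Im (S a (of_real x)) = 0"
      "a \<in> A \<Longrightarrow> x \<in> J \<Longrightarrow> Im (C a (of_real x)) = 0"
    and cont_h: "continuous_on (height_domain A J) (\<lambda>(a, p). h a (cvec p))"
begin

abbreviation "tube \<equiv> height_domain A J"

lemmas tube_def = height_domain_def[of A J]

definition u where "u a p = Re (h a (cvec p))"
definition v where "v a p = Im (h a (cvec p))"
definition W1 where "W1 a p = Im (S a (cvec p))"
definition W2 where "W2 a p = - Im (C a (cvec p))"

lemma tubeI: "a \<in> A \<Longrightarrow> x \<in> J \<Longrightarrow> \<bar>y\<bar> < height a x \<Longrightarrow> (a, vec2 x y) \<in> tube"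
  by (simp add: tube_def)

lemma tube_iff: "(a, vec2 x y) \<in> tube \<longleftrightarrow> a \<in> A \<and> x \<in> J \<and> \<bar>y\<bar> < height a x"
  by (simp add: tube_def)

lemma open_Collect_J: "open {p::real^2. p$1 \<in> J}"
proof -
  have "open ((\<lambda>p::real^2. p$1) -` J)"
    by (intro open_vimage J(1) continuous_intros)
  then show ?thesis by (simp add: vimage_def)
qed

lemma tube_open: "open_slices tube"
  unfolding open_slices_def
proof
  fix a
  have "open ({p::real^2. p$1 \<in> J} \<inter> {p. \<bar>p$2\<bar> < height a (p$1)})"
    by (intro open_Int open_Collect_J open_Collect_less continuous_intros)
  then show "open {p. (a, p) \<in> tube}"
    by (cases "a \<in> A") (auto simp: tube_def Int_def)
qed

lemma u': "(a, p) \<in> tube \<Longrightarrow> (u a has_derivative (\<lambda>d. d$1 * hx a p + d$2 * (- hy a p))) (at p)"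
  and v': "(a, p) \<in> tube \<Longrightarrow> (v a has_derivative (\<lambda>d. d$1 * hy a p + d$2 * hx a p)) (at p)"
  using has_derivative_Re_Im_cvec[OF h'] by (auto simp: u_def[abs_def] v_def[abs_def] Re_Im_derivative_h)

lemma W1': "(a, p) \<in> tube \<Longrightarrow> (W1 a has_derivative
      (\<lambda>d. d$1 * (cos (u a p) * sinh (v a p)) + d$2 * (sin (u a p) * cosh (v a p)))) (at p)"
  using has_derivative_Re_Im_cvec(2)[OF S'] by (auto simp: W1_def[abs_def] Re_Im_sin_cos u_def v_def)

lemma W2': "(a, p) \<in> tube \<Longrightarrow> (W2 a has_derivative
      (\<lambda>d. d$1 * (sin (u a p) * sinh (v a p)) + d$2 * (- (cos (u a p) * cosh (v a p))))) (at p)"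
  using has_derivative_minus[OF has_derivative_Re_Im_cvec(2)[OF C']]
  by (auto simp: W2_def[abs_def] Re_Im_sin_cos u_def v_def elim!: has_derivative_eq_rhs)

lemma denom_nz: "(a, p) \<in> tube \<Longrightarrow> denom a p \<noteq> 0"
  using denom_pos[of "p$1" a "p$2"] radius by (auto simp: tube_def)

lemma Ck_param_sq: "Ck_family k (\<lambda>a p. a\<^sup>2) tube"
  by (rule Ck_family_param[OF tube_open]) (auto intro!: continuous_intros)

lemma Ck_h': "Ck_family k hx tube" "Ck_family k hy tube"
  unfolding hx_def[abs_def] hy_def[abs_def]
  by (intro Ck_family_minus Ck_family_divide Ck_family_mult Ck_family_const Ck_family_diff
      Ck_family_add Ck_family_power Ck_family_coord Ck_param_sq tube_open denom_nz
      | simp add: denom_def[abs_def])+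

lemma Ck_uv: "Ck_family k u tube" "Ck_family k v tube"
proof -
  have c: "continuous_on tube (\<lambda>(a, p). u a p)" "continuous_on tube (\<lambda>(a, p). v a p)"
    using cont_h by (auto simp: u_def v_def case_prod_unfold intro!: continuous_intros)
  have "Ck_family (Suc k) u tube"
    by (rule Ck_family_SucI[OF tube_open c(1) u' Ck_h'(1) Ck_family_minus[OF tube_open Ck_h'(2)]])
  then show "Ck_family k u tube" by (rule Ck_family_mono_Suc)
  have "Ck_family (Suc k) v tube"
    by (rule Ck_family_SucI[OF tube_open c(2) v' Ck_h'(2) Ck_h'(1)])
  then show "Ck_family k v tube" by (rule Ck_family_mono_Suc)
qed

lemma W_axis [simp]: "a \<in> A \<Longrightarrow> x \<in> J \<Longrightarrow> W1 a (vec2 x 0) = 0" "a \<in> A \<Longrightarrow> x \<in> J \<Longrightarrow> W2 a (vec2 x 0) = 0"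
  "a \<in> A \<Longrightarrow> x \<in> J \<Longrightarrow> v a (vec2 x 0) = 0"
  using real_on_axis by (simp_all add: W1_def W2_def v_def cvec_def complex_of_real_def)

text \<open>A function that vanishes on the axis is an integral of its \<open>y\<close>-derivative over a fixed interval,
  and therefore as continuous in the parameters as the derivative.\<close>

lemma continuous_on_W:
  assumes D: "\<And>a p. (a, p) \<in> tube \<Longrightarrow> (W a has_derivative (\<lambda>d. d$1 * Wx a p + d$2 * Wy a p)) (at p)"
    and 0: "\<And>a x. a \<in> A \<Longrightarrow> x \<in> J \<Longrightarrow> W a (vec2 x 0) = 0"
    and cont: "continuous_on tube (\<lambda>(a, p). Wy a p)"
  shows "continuous_on tube (\<lambda>(a, p). W a p)"
proof -
  have shrink: "(a, vec2 (p$1) (t * p$2)) \<in> tube" if "(a, p) \<in> tube" "t \<in> {0..1}" for a p t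
  proof -
    have "\<bar>t * p$2\<bar> \<le> 1 * \<bar>p$2\<bar>" using that(2) unfolding abs_mult by (intro mult_right_mono) auto
    then show ?thesis using that(1) by (auto simp: tube_def)
  qed
  have eq: "W a p = p$2 * integral (cbox 0 1) (\<lambda>t. Wy a (vec2 (p$1) (t * p$2)))"
    if ap: "(a, p) \<in> tube" for a p
  proof -
    have "((\<lambda>t. W a (vec2 (p$1) (t * p$2))) has_vector_derivative p$2 * Wy a (vec2 (p$1) (t * p$2)))
        (at t within {0..1})" if "t \<in> {0..1}" for t
    proof -
      have "((\<lambda>t. t * p$2) has_real_derivative p$2) (at t)"
        by (auto intro!: derivative_eq_intros)
      from DERIV_chain2[OF has_real_derivative_partials(1)[OF D[OF shrink[OF ap that]]] this]
      show ?thesis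
        by (simp add: has_real_derivative_iff_has_vector_derivative has_vector_derivative_at_within mult.commute)
    qed
    from fundamental_theorem_of_calculus[OF _ this]
    have "((\<lambda>t. p$2 * Wy a (vec2 (p$1) (t * p$2))) has_integral W a p) {0..1}"
      using 0[of a "p$1"] ap by (simp add: tube_def)
    then show ?thesis unfolding cbox_interval by (metis integral_mult_right integral_unique)
  qed
  have "continuous_on (tube \<times> cbox 0 1)
      (\<lambda>r. (\<lambda>(a, p). Wy a p) (fst (fst r), vec2 (snd (fst r)$1) (snd r * snd (fst r)$2)))"
  proof (rule continuous_on_compose2[OF cont])
    show "continuous_on (tube \<times> cbox 0 1)
        (\<lambda>r::(real \<times> (real^2)) \<times> real. (fst (fst r), vec2 (snd (fst r)$1) (snd r * snd (fst r)$2)))"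
      by (intro continuous_intros)
  qed (use shrink in auto)
  then have "continuous_on (tube \<times> cbox 0 1) (\<lambda>(q, t). Wy (fst q) (vec2 (snd q$1) (t * snd q$2)))"
    by (simp add: case_prod_unfold)
  from integral_continuous_on_param[OF this]
  have "continuous_on tube (\<lambda>q. snd q$2 * integral (cbox 0 1) (\<lambda>t. Wy (fst q) (vec2 (snd q$1) (t * snd q$2))))"
    by (intro continuous_intros)
  then show ?thesis
    by (rule continuous_on_eq) (auto simp: eq)
qed

lemma Ck_W: "Ck_family k W1 tube" "Ck_family k W2 tube"
proof -
  note trig = Ck_family_sin_cos[OF tube_open Ck_uv(1)] Ck_family_sinh_cosh[OF tube_open Ck_uv(2)]
  note rules = Ck_family_minus Ck_family_mult tube_open trig
  have "continuous_on tube (\<lambda>(a, p). sin (u a p) * cosh (v a p))"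
    "continuous_on tube (\<lambda>(a, p). - (cos (u a p) * cosh (v a p)))"
    by (rule Ck_family_continuous[of 0], intro rules)+
  then have c: "continuous_on tube (\<lambda>(a, p). W1 a p)" "continuous_on tube (\<lambda>(a, p). W2 a p)"
    using continuous_on_W[where W=W1, OF W1' W_axis(1)] continuous_on_W[where W=W2, OF W2' W_axis(2)] by blast+
  have "Ck_family (Suc k) W1 tube"
    by (rule Ck_family_SucI[OF tube_open c(1) W1'], assumption) (intro rules)+
  then show "Ck_family k W1 tube" by (rule Ck_family_mono_Suc)
  have "Ck_family (Suc k) W2 tube"
    by (rule Ck_family_SucI[OF tube_open c(2) W2'], assumption) (intro rules)+
  then show "Ck_family k W2 tube" by (rule Ck_family_mono_Suc)
qed

lemma h_cnj:
  assumes "(a, vec2 x y) \<in> tube"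
  shows "h a (cnj (Complex x y)) = cnj (h a (Complex x y))"
proof (rule cnj_of_primitive[where g="\<lambda>z. of_real twist / (z\<^sup>2 + (of_real a)\<^sup>2)"])
  fix r assume "\<bar>r\<bar> \<le> \<bar>y\<bar>"
  then have "(a, vec2 x r) \<in> tube" using assms by (simp add: tube_iff)
  then show "(h a has_field_derivative of_real twist / ((Complex x r)\<^sup>2 + (of_real a)\<^sup>2)) (at (Complex x r))"
    using h' by (fastforce simp: cvec_def)
qed (use assms real_on_axis in \<open>auto simp: tube_iff\<close>)

lemma u_even: "(a, vec2 x y) \<in> tube \<Longrightarrow> u a (vec2 x (- y)) = u a (vec2 x y)"
  and v_odd: "(a, vec2 x y) \<in> tube \<Longrightarrow> v a (vec2 x (- y)) = - v a (vec2 x y)"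
  using h_cnj[of a x y] by (simp_all add: u_def v_def cvec_def cnj.code)

lemma W_odd:
  assumes "(a, vec2 x y) \<in> tube"
  shows "W1 a (vec2 x (- y)) = - W1 a (vec2 x y)" "W2 a (vec2 x (- y)) = - W2 a (vec2 x y)"
proof -
  have c: "cvec (vec2 x t) = Complex x t" for t by (simp add: cvec_def)
  have dm: "(a, vec2 x t) \<in> tube" if "\<bar>t\<bar> \<le> \<bar>y\<bar>" for t using assms that by (auto simp: tube_def)
  have aJ: "a \<in> A" "x \<in> J" using assms by (auto simp: tube_def)
  note h = h_cnj[OF dm]
  have "S a (cnj (Complex x y)) = cnj (S a (Complex x y))"
  proof (rule cnj_of_primitive[where g="\<lambda>z. sin (h a z)"])
    fix r assume r: "\<bar>r\<bar> \<le> \<bar>y\<bar>"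
    show "(S a has_field_derivative sin (h a (Complex x r))) (at (Complex x r))"
      using S'[OF dm[OF r]] by (simp add: c)
    show "sin (h a (cnj (Complex x r))) = cnj (sin (h a (Complex x r)))"
      by (simp add: h[OF r] complex_eq_iff Re_Im_sin_cos)
  qed (use real_on_axis aJ in auto)
  then show "W1 a (vec2 x (- y)) = - W1 a (vec2 x y)" by (simp add: W1_def c cnj.code)
  have "C a (cnj (Complex x y)) = cnj (C a (Complex x y))"
  proof (rule cnj_of_primitive[where g="\<lambda>z. cos (h a z)"])
    fix r assume r: "\<bar>r\<bar> \<le> \<bar>y\<bar>"
    show "(C a has_field_derivative cos (h a (Complex x r))) (at (Complex x r))"
      using C'[OF dm[OF r]] by (simp add: c)
    show "cos (h a (cnj (Complex x r))) = cnj (cos (h a (Complex x r)))"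
      by (simp add: h[OF r] complex_eq_iff Re_Im_sin_cos)
  qed (use real_on_axis aJ in auto)
  then show "W2 a (vec2 x (- y)) = - W2 a (vec2 x y)" by (simp add: W2_def c cnj.code)
qed

section \<open>Estimates along horizontal slices\<close>

context
  fixes a x assumes a: "a \<in> A" and x: "x \<in> J"
begin

lemma slice_derivatives:
  assumes "\<bar>y\<bar> < height a x"
  shows "((\<lambda>y. u a (vec2 x y)) has_real_derivative - hy a (vec2 x y)) (at y)"
    "((\<lambda>y. v a (vec2 x y)) has_real_derivative hx a (vec2 x y)) (at y)"
    "((\<lambda>y. W1 a (vec2 x y)) has_real_derivative sin (u a (vec2 x y)) * cosh (v a (vec2 x y))) (at y)"
    "((\<lambda>y. W2 a (vec2 x y)) has_real_derivative - (cos (u a (vec2 x y)) * cosh (v a (vec2 x y)))) (at y)"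
  using tubeI[OF a x assms]
  by (auto intro!: has_real_derivative_partials(1)[OF u'] has_real_derivative_partials(1)[OF v']
      has_real_derivative_partials(1)[OF W1'] has_real_derivative_partials(1)[OF W2'])

lemma v_lower:
  assumes "0 \<le> y" "y < height a x"
  shows "twist / (4 * (radius a x)\<^sup>2) * y \<le> v a (vec2 x y)"
proof -
  let ?b = "twist / (4 * (radius a x)\<^sup>2)"
  have "v a (vec2 x 0) - ?b * 0 \<le> v a (vec2 x y) - ?b * y"
  proof (rule DERIV_nonneg_imp_nondecreasing[OF assms(1)])
    fix t assume t: "0 \<le> t" "t \<le> y"
    then have "\<bar>t\<bar> < height a x" using assms by simp
    then have "((\<lambda>y. v a (vec2 x y) - ?b * y) has_real_derivative hx a (vec2 x t) - ?b * 1) (at t)"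
      by (intro DERIV_diff slice_derivatives DERIV_cmult DERIV_ident)
    moreover have "0 \<le> hx a (vec2 x t) - ?b * 1"
      using hx_lower[OF radius[OF a x] \<open>\<bar>t\<bar> < height a x\<close>] by simp
    ultimately show "\<exists>D. ((\<lambda>y. v a (vec2 x y) - ?b * y) has_real_derivative D) (at t) \<and> 0 \<le> D"
      by blast
  qed
  then show ?thesis using a x by simp
qed

lemma v_mono:
  assumes "0 \<le> t" "t \<le> y" "y < height a x"
  shows "v a (vec2 x t) \<le> v a (vec2 x y)"
proof (rule DERIV_nonneg_imp_nondecreasing[OF assms(2)])
  fix r assume r: "t \<le> r" "r \<le> y"
  then have r': "\<bar>r\<bar> < height a x" using assms by simp
  have "0 \<le> twist / (4 * (radius a x)\<^sup>2)" by (simp add: less_imp_le)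
  also have "\<dots> \<le> hx a (vec2 x r)" by (rule hx_lower[OF radius[OF a x] r'])
  finally show "\<exists>D. ((\<lambda>y. v a (vec2 x y)) has_real_derivative D) (at r) \<and> 0 \<le> D"
    using slice_derivatives(2)[OF r'] by blast
qed

lemma v_pos:
  assumes "0 < y" "y < height a x" shows "0 < v a (vec2 x y)"
proof -
  have "0 < twist / (4 * (radius a x)\<^sup>2) * y"
    using assms radius[OF a x] by (simp add: radius_def)
  then show ?thesis using v_lower[of y] assms by simp
qed

lemma u_variation:
  assumes "0 \<le> y" "y < height a x"
  shows "\<bar>u a (vec2 x y) - u a (vec2 x 0)\<bar> \<le> 1/2"
proof -
  define s where "s = radius a x"
  have s: "0 < s" using radius[OF a x] by (simp add: s_def radius_def)
  define k where "k = 2 * twist / s^3"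
  have *: "\<epsilon> * u a (vec2 x 0) + k * 0\<^sup>2 \<le> \<epsilon> * u a (vec2 x y) + k * y\<^sup>2" if \<epsilon>: "\<bar>\<epsilon>\<bar> = 1" for \<epsilon>
  proof (rule DERIV_nonneg_imp_nondecreasing[OF assms(1)])
    fix t assume t: "0 \<le> t" "t \<le> y"
    then have t': "\<bar>t\<bar> < height a x" using assms by simp
    have "\<bar>hy a (vec2 x t)\<bar> \<le> k * (2 * t)"
      using hy_bound[OF radius[OF a x] t'] t by (simp add: s_def k_def algebra_simps)
    moreover have "\<epsilon> * (- hy a (vec2 x t)) \<ge> - \<bar>hy a (vec2 x t)\<bar>"
      using \<epsilon> by (auto simp: abs_if split: if_splits)
    ultimately have "0 \<le> \<epsilon> * (- hy a (vec2 x t)) + k * (2 * t)" by linarith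
    then show "\<exists>D. ((\<lambda>y. \<epsilon> * u a (vec2 x y) + k * y\<^sup>2) has_real_derivative D) (at t) \<and> 0 \<le> D"
      by (intro exI[of _ "\<epsilon> * (- hy a (vec2 x t)) + k * (2 * t)"] conjI)
        (rule derivative_eq_intros slice_derivatives t' refl | simp)+
  qed
  have "y\<^sup>2 \<le> (s * sqrt s / 2^14)\<^sup>2"
    using assms height_le(2)[of a x] by (intro power_mono) (auto simp: s_def)
  also have "\<dots> = s^3 / 2^28" using s by (simp add: power_divide power_mult_distrib power_numeral_reduce)
  finally have "k * y\<^sup>2 \<le> k * (s^3 / 2^28)"
    using s by (intro mult_left_mono) (auto simp: k_def less_imp_le)
  also have "\<dots> = 1/2" using s by (simp add: twist_def k_def)
  finally have "k * y\<^sup>2 \<le> 1/2" .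
  then show ?thesis using *[of 1] *[of "-1"] by (auto simp: abs_if)
qed

lemma cos_ge_half: "\<bar>r\<bar> \<le> 1 \<Longrightarrow> 1/2 \<le> cos (r::real)"
proof -
  assume r: "\<bar>r\<bar> \<le> 1"
  have "1 \<le> pi/3" using pi_gt3 by simp
  then have "cos (pi/3) \<le> cos \<bar>r\<bar>" using r by (intro cos_monotone_0_pi_le) auto
  then show ?thesis by (simp add: cos_60)
qed

text \<open>The component of the slice in the direction of its velocity at the axis.\<close>

definition slice_p where
  "slice_p y = W1 a (vec2 x y) * sin (u a (vec2 x 0)) - W2 a (vec2 x y) * cos (u a (vec2 x 0))"

lemma slice_p':
  assumes "\<bar>y\<bar> < height a x"
  shows "(slice_p has_real_derivative cosh (v a (vec2 x y)) * cos (u a (vec2 x y) - u a (vec2 x 0))) (at y)"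
proof -
  have "((\<lambda>y. W1 a (vec2 x y) * sin (u a (vec2 x 0)) - W2 a (vec2 x y) * cos (u a (vec2 x 0)))
      has_real_derivative sin (u a (vec2 x y)) * cosh (v a (vec2 x y)) * sin (u a (vec2 x 0))
        - - (cos (u a (vec2 x y)) * cosh (v a (vec2 x y))) * cos (u a (vec2 x 0))) (at y)"
    by (intro DERIV_diff DERIV_cmult_right slice_derivatives assms)
  then show ?thesis by (simp add: slice_p_def[abs_def] cos_diff algebra_simps)
qed

lemma slice_p'_ge:
  assumes "0 \<le> y" "y < height a x"
  shows "cosh (v a (vec2 x y)) / 2 \<le> cosh (v a (vec2 x y)) * cos (u a (vec2 x y) - u a (vec2 x 0))"
proof -
  have "1/2 \<le> cos (u a (vec2 x y) - u a (vec2 x 0))"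
    using u_variation[OF assms] by (intro cos_ge_half) simp
  then have "cosh (v a (vec2 x y)) * (1/2) \<le> cosh (v a (vec2 x y)) * cos (u a (vec2 x y) - u a (vec2 x 0))"
    by (intro mult_left_mono) (auto simp: cosh_real_nonneg)
  then show ?thesis by simp
qed

lemma slice_p_0 [simp]: "slice_p 0 = 0"
  using a x by (simp add: slice_p_def)

lemma slice_p_strict_mono:
  assumes "\<bar>s\<bar> < height a x" "\<bar>t\<bar> < height a x" "s < t"
  shows "slice_p s < slice_p t"
proof (rule DERIV_pos_imp_increasing[OF assms(3)])
  fix y assume "s \<le> y" "y \<le> t"
  then have y: "\<bar>y\<bar> < height a x" using assms by auto
  have "u a (vec2 x \<bar>y\<bar>) = u a (vec2 x y)" using u_even[OF tubeI[OF a x y]] by (simp add: abs_if)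
  then have "\<bar>u a (vec2 x y) - u a (vec2 x 0)\<bar> \<le> 1/2" using u_variation[of "\<bar>y\<bar>"] y by simp
  then have "1/2 \<le> cos (u a (vec2 x y) - u a (vec2 x 0))" by (intro cos_ge_half) simp
  then have "0 < cosh (v a (vec2 x y)) * cos (u a (vec2 x y) - u a (vec2 x 0))"
    by (intro mult_pos_pos) (auto simp: cosh_real_pos)
  then show "\<exists>D. (slice_p has_real_derivative D) (at y) \<and> 0 < D"
    using slice_p'[OF y] by blast
qed

lemma slice_p_lower:
  assumes "0 \<le> y" "y < height a x" "b = twist / (4 * (radius a x)\<^sup>2)"
  shows "sinh (b * y) / (2 * b) \<le> slice_p y" "y / 2 \<le> slice_p y"
proof -
  have b: "0 < b" using radius[OF a x] by (simp add: assms(3) radius_def)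
  have *: "slice_p 0 - sinh (b * 0) / (2 * b) \<le> slice_p y - sinh (b * y) / (2 * b)"
  proof (rule DERIV_nonneg_imp_nondecreasing[OF assms(1)])
    fix t assume t: "0 \<le> t" "t \<le> y"
    then have t': "\<bar>t\<bar> < height a x" "t < height a x" using assms by simp_all
    have "0 \<le> b * t" using b t by simp
    moreover have "b * t \<le> v a (vec2 x t)" using v_lower[OF t(1) t'(2)] by (simp add: assms(3))
    ultimately have "cosh (b * t) \<le> cosh (v a (vec2 x t))"
      by (subst cosh_real_nonneg_le_iff) auto
    then have "cosh (b * t) / 2 \<le> cosh (v a (vec2 x t)) * cos (u a (vec2 x t) - u a (vec2 x 0))"
      using slice_p'_ge[OF t(1) t'(2)] by linarith
    moreover have "((\<lambda>y. slice_p y - sinh (b * y) / (2 * b)) has_real_derivative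
        cosh (v a (vec2 x t)) * cos (u a (vec2 x t) - u a (vec2 x 0)) - cosh (b * t) / 2) (at t)"
      using b by (auto intro!: derivative_eq_intros slice_p' t')
    ultimately show "\<exists>D. ((\<lambda>y. slice_p y - sinh (b * y) / (2 * b)) has_real_derivative D) (at t) \<and> 0 \<le> D"
      by force
  qed
  then show "sinh (b * y) / (2 * b) \<le> slice_p y" by simp
  have "slice_p 0 - 0 / 2 \<le> slice_p y - y / 2"
  proof (rule DERIV_nonneg_imp_nondecreasing[OF assms(1)])
    fix t assume t: "0 \<le> t" "t \<le> y"
    then have t': "\<bar>t\<bar> < height a x" "t < height a x" using assms by simp_all
    have "1 / 2 \<le> cosh (v a (vec2 x t)) * cos (u a (vec2 x t) - u a (vec2 x 0))"
      using slice_p'_ge[OF t(1) t'(2)] cosh_real_ge_1[of "v a (vec2 x t)"] by linarith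
    moreover have "((\<lambda>y. slice_p y - y / 2) has_real_derivative
        cosh (v a (vec2 x t)) * cos (u a (vec2 x t) - u a (vec2 x 0)) - 1 / 2) (at t)"
      by (auto intro!: derivative_eq_intros slice_p' t')
    ultimately show "\<exists>D. ((\<lambda>y. slice_p y - y / 2) has_real_derivative D) (at t) \<and> 0 \<le> D"
      by force
  qed
  then show "y / 2 \<le> slice_p y" by simp
qed

text \<open>Already at half the height bound the slice is outside of the unit cylinder. If the bound is \<open>s / 2\<close>,
  then \<open>s\<close> is huge and the trivial estimate \<open>cosh v \<ge> 1\<close> suffices. Otherwise \<open>y\<close> is \<open>s\<^sup>3\<^sup>/\<^sup>2 / 2\<^sup>1\<^sup>5\<close>, and the
  powers of \<open>s\<close> cancel in the lower bound \<open>sinh (b y) / (2 b) \<ge> (b y)\<^sup>4 / (1024 b)\<close>, whose value is \<open>4\<close>.\<close>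

lemma slice_p_exceeds_1: "1 < slice_p (height a x / 2)"
proof -
  define s where "s = radius a x"
  define y where "y = height a x / 2"
  define b where "b = twist / (4 * s\<^sup>2)"
  have s: "0 < s" using radius[OF a x] by (simp add: s_def radius_def)
  have y: "0 \<le> y" "y < height a x" using height_pos[OF radius[OF a x]] by (auto simp: y_def)
  have y_eq: "y = min (s/2) (s * sqrt s / 2^14) / 2" by (simp add: y_def height_def s_def)
  have "1 < slice_p y"
  proof (cases "s/2 \<le> s * sqrt s / 2^14")
    case True
    then have "2^13 \<le> sqrt s" using s by (simp add: field_simps)
    then have "(2^13)\<^sup>2 \<le> (sqrt s)\<^sup>2" by (intro power_mono) auto
    then have "2^26 \<le> s" using s by simp
    moreover have "y = s / 4" using True by (simp add: y_eq)
    ultimately have "1 < y / 2" by simp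
    with slice_p_lower(2)[OF y refl] show ?thesis by linarith
  next
    case False
    then have ys: "y = s * sqrt s / 2^15" by (simp add: y_eq)
    have b: "0 < b" using s by (simp add: b_def)
    have "(b * y)^4 / 512 / (2 * b) = b^3 * y^4 / 1024"
      using b by (simp add: field_simps power_numeral_reduce)
    also have "\<dots> = (b * s\<^sup>2)^3 / 2^70"
    proof -
      have "y^4 = s^4 * (sqrt s)^4 / 2^60" by (simp add: ys power_divide power_mult_distrib)
      also have "(sqrt s)^4 = s\<^sup>2" using s by (simp add: power4_eq_xxxx power2_eq_square)
      finally show ?thesis by (simp add: power_mult_distrib flip: power_add power_mult)
    qed
    also have "b * s\<^sup>2 = 2^24" using s by (simp add: b_def twist_def)
    finally have "1 < (b * y)^4 / 512 / (2 * b)" by simp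
    also have "\<dots> \<le> sinh (b * y) / (2 * b)"
      using b y by (intro divide_right_mono sinh_lower_bound) auto
    also have "\<dots> \<le> slice_p y"
      by (rule slice_p_lower(1)[OF y]) (simp add: b_def s_def)
    finally show ?thesis .
  qed
  then show ?thesis by (simp add: y_def)
qed

definition slice_Q where "slice_Q y = (W1 a (vec2 x y))\<^sup>2 + (W2 a (vec2 x y))\<^sup>2"

lemma slice_p_le_Q: "(slice_p y)\<^sup>2 \<le> slice_Q y"
proof -
  let ?c = "cos (u a (vec2 x 0))" and ?s = "sin (u a (vec2 x 0))"
  have "slice_Q y = slice_Q y * (?s\<^sup>2 + ?c\<^sup>2)" by simp
  also have "\<dots> = (slice_p y)\<^sup>2 + (W1 a (vec2 x y) * ?c + W2 a (vec2 x y) * ?s)\<^sup>2"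
    unfolding slice_Q_def slice_p_def by algebra
  finally show ?thesis by simp
qed

text \<open>The distance to the axis grows along a slice: the position is an integral of velocities whose
  directions differ from the present one by at most \<open>1\<close>, an acute angle.\<close>

lemma radial_speed:
  assumes "0 < y" "y < height a x"
  shows "0 < W1 a (vec2 x y) * sin (u a (vec2 x y)) - W2 a (vec2 x y) * cos (u a (vec2 x y))"
proof -
  let ?U = "u a (vec2 x y)"
  let ?k = "\<lambda>t. W1 a (vec2 x t) * sin ?U - W2 a (vec2 x t) * cos ?U"
  have "?k 0 < ?k y"
  proof (rule DERIV_pos_imp_increasing[OF assms(1)])
    fix t assume t: "0 \<le> t" "t \<le> y"
    then have t': "\<bar>t\<bar> < height a x" using assms by simp
    have "((\<lambda>t. W1 a (vec2 x t) * sin ?U - W2 a (vec2 x t) * cos ?U)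
        has_real_derivative sin (u a (vec2 x t)) * cosh (v a (vec2 x t)) * sin ?U
          - - (cos (u a (vec2 x t)) * cosh (v a (vec2 x t))) * cos ?U) (at t)"
      by (intro DERIV_diff DERIV_cmult_right slice_derivatives t')
    then have D: "(?k has_real_derivative cosh (v a (vec2 x t)) * cos (u a (vec2 x t) - ?U)) (at t)"
      by (simp add: cos_diff algebra_simps)
    have "\<bar>u a (vec2 x t) - ?U\<bar> \<le> 1"
      using u_variation[of t] u_variation[of y] t assms by (auto simp: abs_if split: if_splits)
    then have "1/2 \<le> cos (u a (vec2 x t) - ?U)" by (rule cos_ge_half)
    then have "0 < cosh (v a (vec2 x t)) * cos (u a (vec2 x t) - ?U)"
      by (intro mult_pos_pos) (auto simp: cosh_real_pos)
    with D show "\<exists>D. (?k has_real_derivative D) (at t) \<and> 0 < D" by blast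
  qed
  then show ?thesis using a x by simp
qed

lemma slice_Q':
  assumes "\<bar>y\<bar> < height a x"
  shows "(slice_Q has_real_derivative 2 * cosh (v a (vec2 x y)) *
    (W1 a (vec2 x y) * sin (u a (vec2 x y)) - W2 a (vec2 x y) * cos (u a (vec2 x y)))) (at y)"
  unfolding slice_Q_def[abs_def]
  by (rule derivative_eq_intros slice_derivatives assms refl)+ (simp add: algebra_simps)

lemma slice_Q_strict_mono:
  assumes "0 \<le> s" "s < t" "t < height a x"
  shows "slice_Q s < slice_Q t"
proof -
  have "continuous_on {s..t} slice_Q"
    by (intro continuous_at_imp_continuous_on ballI DERIV_isCont[OF slice_Q']) (use assms in auto)
  then show ?thesis
  proof (rule DERIV_pos_imp_increasing_open[OF assms(2), rotated])
    fix y assume y: "s < y" "y < t"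
    then have "0 < y" "y < height a x" "\<bar>y\<bar> < height a x" using assms by auto
    then show "\<exists>D. (slice_Q has_real_derivative D) (at y) \<and> 0 < D"
      using slice_Q' radial_speed cosh_real_pos by (metis mult_pos_pos zero_less_numeral)
  qed
qed

text \<open>The distance to the axis is at most the length of the slice, and \<open>v\<close> is increasing on it.\<close>

lemma slice_Q_upper:
  assumes "0 \<le> y" "y < height a x"
  shows "slice_Q y \<le> (y * cosh (v a (vec2 x y)))\<^sup>2"
proof -
  define r where "r = sqrt (slice_Q y)"
  have Q0: "0 \<le> slice_Q y" by (simp add: slice_Q_def)
  have rr: "r * r = slice_Q y" using Q0 by (simp add: r_def)
  let ?c = "cosh (v a (vec2 x y))"
  let ?w1 = "W1 a (vec2 x y)" and ?w2 = "W2 a (vec2 x y)"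
  let ?g = "\<lambda>t. r * ?c * t - (W1 a (vec2 x t) * ?w1 + W2 a (vec2 x t) * ?w2)"
  have "?g 0 \<le> ?g y"
  proof (rule DERIV_nonneg_imp_nondecreasing[OF assms(1)])
    fix t assume t: "0 \<le> t" "t \<le> y"
    then have t': "\<bar>t\<bar> < height a x" using assms by simp
    let ?U = "u a (vec2 x t)" and ?V = "v a (vec2 x t)"
    have "((\<lambda>t. r * ?c * t - (W1 a (vec2 x t) * ?w1 + W2 a (vec2 x t) * ?w2)) has_real_derivative
        r * ?c * 1 - (sin ?U * cosh ?V * ?w1 + - (cos ?U * cosh ?V) * ?w2)) (at t)"
      by (intro DERIV_diff DERIV_add DERIV_cmult DERIV_cmult_right DERIV_ident slice_derivatives t')
    then have D: "(?g has_real_derivative r * ?c - cosh ?V * (sin ?U * ?w1 - cos ?U * ?w2)) (at t)"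
      by (simp add: algebra_simps)
    have "(sin ?U * ?w1 - cos ?U * ?w2)\<^sup>2 \<le> (sin ?U * ?w1 - cos ?U * ?w2)\<^sup>2 + (cos ?U * ?w1 + sin ?U * ?w2)\<^sup>2"
      by simp
    also have "\<dots> = (?w1\<^sup>2 + ?w2\<^sup>2) * ((sin ?U)\<^sup>2 + (cos ?U)\<^sup>2)" by algebra
    also have "\<dots> = slice_Q y" by (simp add: slice_Q_def)
    finally have "\<bar>sin ?U * ?w1 - cos ?U * ?w2\<bar> \<le> r"
      unfolding r_def by (rule real_le_rsqrt[of "\<bar>_\<bar>", simplified])
    then have "cosh ?V * (sin ?U * ?w1 - cos ?U * ?w2) \<le> cosh ?V * r"
      by (intro mult_left_mono) (auto simp: cosh_real_nonneg)
    also have "cosh ?V * r \<le> ?c * r"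
    proof (rule mult_right_mono)
      have "0 \<le> ?V" using v_mono[of 0 t] t assms a x by simp
      then show "cosh ?V \<le> ?c" using v_mono[OF t assms(2)] by (simp add: cosh_real_nonneg_le_iff)
    qed (use Q0 in \<open>simp add: r_def\<close>)
    finally show "\<exists>D. (?g has_real_derivative D) (at t) \<and> 0 \<le> D"
      using D by (intro exI[of _ "r * ?c - cosh ?V * (sin ?U * ?w1 - cos ?U * ?w2)"]) (simp add: mult.commute)
  qed
  then have "slice_Q y \<le> r * ?c * y" using a x by (simp add: slice_Q_def power2_eq_square)
  then have le: "r * r \<le> r * (y * ?c)" by (simp add: rr mult_ac)
  have "r \<le> y * ?c"
  proof (cases "r = 0")
    case False
    then have "0 < r" using Q0 by (simp add: r_def)
    with le show ?thesis by simp
  qed (use assms in \<open>simp add: cosh_real_nonneg\<close>)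
  then have "r\<^sup>2 \<le> (y * ?c)\<^sup>2" using Q0 by (intro power_mono) (auto simp: r_def)
  then show ?thesis using rr by (simp add: power2_eq_square)
qed

end

end

section \<open>The distance to the axis as a coordinate\<close>

lemma implicit_function_derivative:
  fixes Q :: "real^2 \<Rightarrow> real" and \<eta> :: "real \<Rightarrow> real"
  assumes Q: "(Q has_derivative (\<lambda>d. d$1 * Qx + d$2 * Qy)) (at (vec2 x (\<eta> x)))" and "Qy \<noteq> 0"
    and "continuous (at x) \<eta>" "open W" "x \<in> W" and eq: "\<And>z. z \<in> W \<Longrightarrow> Q (vec2 z (\<eta> z)) = c"
  shows "(\<eta> has_real_derivative - Qx / Qy) (at x)"
proof -
  define G where "G q = vec2 (q$1) ((Q q - Qx * q$1) / Qy)" for q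
  have "(G has_derivative (\<lambda>d. vec2 (d$1) ((d$1 * Qx + d$2 * Qy - Qx * d$1) / Qy))) (at (vec2 x (\<eta> x)))"
    unfolding G_def[abs_def] divide_inverse
    by (intro derivative_intros bounded_linear_imp_has_derivative bounded_linear_vec_nth Q)
  moreover have "(\<lambda>d. vec2 (d$1) ((d$1 * Qx + d$2 * Qy - Qx * d$1) / Qy)) = (\<lambda>d. d)"
    using \<open>Qy \<noteq> 0\<close> by (auto simp: vec_eq_iff forall_2)
  ultimately have G: "(G has_derivative (\<lambda>d. d)) (at (vec2 x (\<eta> x)))" by simp
  have g: "((\<lambda>z. vec2 z ((c - Qx * z) / Qy)) has_derivative (\<lambda>d. vec2 d ((0 - Qx * d) / Qy))) (at x)"
    unfolding divide_inverse by (intro derivative_intros)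
  have "continuous (at x) (\<lambda>z. vec2 z (\<eta> z))"
    unfolding vec2_conv using assms(3) by (intro continuous_intros)
  then have "((\<lambda>z. vec2 z (\<eta> z)) has_derivative (\<lambda>d. vec2 d ((0 - Qx * d) / Qy))) (at x)"
    by (rule has_derivative_lift[where t="\<lambda>z. vec2 z (\<eta> z)" and u=x, OF G g _ assms(4,5)])
      (simp add: G_def eq)
  note bounded_linear.has_derivative[OF bounded_linear_vec_nth this, of 2]
  moreover have "(\<lambda>d. (0 - Qx * d) / Qy) = (*) (- Qx / Qy)" by auto
  ultimately have "(\<eta> has_derivative (*) (- Qx / Qy)) (at x)" by simp
  then show ?thesis
    by (simp only: has_field_derivative_def)
qed

context helicoidal_family
begin

text \<open>The square of the distance to the axis, and its partial derivatives.\<close>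

definition Q where "Q a p = (W1 a p)\<^sup>2 + (W2 a p)\<^sup>2"
definition Qx where "Qx a p = 2 * sinh (v a p) * (W1 a p * cos (u a p) + W2 a p * sin (u a p))"
definition Qy where "Qy a p = 2 * cosh (v a p) * (W1 a p * sin (u a p) - W2 a p * cos (u a p))"

lemma slice_Q_eq: "slice_Q a x y = Q a (vec2 x y)" if "a \<in> A" "x \<in> J"
  using slice_Q_def[OF that] by (simp add: Q_def)

lemma Q': "(a, p) \<in> tube \<Longrightarrow> (Q a has_derivative (\<lambda>d. d$1 * Qx a p + d$2 * Qy a p)) (at p)"
  unfolding Q_def[abs_def] power2_eq_square
  by (rule has_derivative_eq_rhs, rule has_derivative_add,
      (rule has_derivative_mult[OF W1' W1'], assumption, assumption),
      (rule has_derivative_mult[OF W2' W2'], assumption, assumption))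
    (auto simp: Qx_def Qy_def algebra_simps)

lemma Ck_Q: "Ck_family k Q tube" "Ck_family k Qx tube" "Ck_family k Qy tube"
  unfolding Q_def[abs_def] Qx_def[abs_def] Qy_def[abs_def]
  by (intro Ck_family_add Ck_family_diff Ck_family_mult Ck_family_power Ck_family_const Ck_W
      Ck_family_sin_cos Ck_family_sinh_cosh Ck_uv tube_open)+

lemma Qy_pos: "a \<in> A \<Longrightarrow> x \<in> J \<Longrightarrow> 0 < y \<Longrightarrow> y < height a x \<Longrightarrow> 0 < Qy a (vec2 x y)"
  using radial_speed[of a x y] by (simp add: Qy_def cosh_real_pos)

text \<open>The positive parameter at which the slice at height \<open>x\<close> has distance \<open>\<rho>\<close> from the axis.\<close>

definition eta where "eta a x \<rho> = (THE y. 0 < y \<and> y < height a x \<and> Q a (vec2 x y) = \<rho>\<^sup>2)"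

lemma Q_mono: "a \<in> A \<Longrightarrow> x \<in> J \<Longrightarrow> 0 \<le> s \<Longrightarrow> s < t \<Longrightarrow> t < height a x \<Longrightarrow> Q a (vec2 x s) < Q a (vec2 x t)"
  using slice_Q_strict_mono slice_Q_eq by simp

lemma Q_axis [simp]: "a \<in> A \<Longrightarrow> x \<in> J \<Longrightarrow> Q a (vec2 x 0) = 0"
  by (simp add: Q_def)

lemma Q_even: "(a, vec2 x y) \<in> tube \<Longrightarrow> Q a (vec2 x (- y)) = Q a (vec2 x y)"
  using W_odd by (simp add: Q_def)

lemma eta_unique:
  assumes "a \<in> A" "x \<in> J" "0 < y" "y < height a x" "Q a (vec2 x y) = \<rho>\<^sup>2"
  shows "eta a x \<rho> = y"
  unfolding eta_def
proof (rule the_equality)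
  fix z assume "0 < z \<and> z < height a x \<and> Q a (vec2 x z) = \<rho>\<^sup>2"
  then show "z = y" using assms Q_mono[of a x y z] Q_mono[of a x z y] by (cases z y rule: linorder_cases) auto
qed (use assms in auto)

lemma eta:
  assumes "a \<in> A" "x \<in> J" "0 < \<rho>" "\<rho> \<le> 1"
  shows "0 < eta a x \<rho>" "eta a x \<rho> < height a x" "Q a (vec2 x (eta a x \<rho>)) = \<rho>\<^sup>2"
proof -
  let ?H = "height a x / 2"
  have H: "0 < ?H" "?H < height a x" using height_pos[OF radius[OF assms(1,2)]] by auto
  have "1 < (slice_p a x ?H)\<^sup>2" using slice_p_exceeds_1[OF assms(1,2)] by (simp add: power2_eq_square less_1_mult)
  also have "\<dots> \<le> Q a (vec2 x ?H)" using slice_p_le_Q[OF assms(1,2)] slice_Q_eq[OF assms(1,2)] by metis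
  finally have "\<rho>\<^sup>2 \<le> Q a (vec2 x ?H)" using assms(3,4) power_le_one[of \<rho> 2] by simp
  moreover have "continuous_on {0..?H} (\<lambda>y. Q a (vec2 x y))"
  proof (intro continuous_at_imp_continuous_on ballI)
    fix y assume "y \<in> {0..?H}"
    then have "\<bar>y\<bar> < height a x" using H by auto
    from has_real_derivative_partials(1)[OF Q'[OF tubeI[OF assms(1,2) this]]]
    show "isCont (\<lambda>y. Q a (vec2 x y)) y" by (rule DERIV_isCont)
  qed
  ultimately obtain y where y: "0 \<le> y" "y \<le> ?H" "Q a (vec2 x y) = \<rho>\<^sup>2"
    using IVT'[of "\<lambda>y. Q a (vec2 x y)" 0 "\<rho>\<^sup>2" ?H] H assms by auto
  then have "y \<noteq> 0" using assms by auto
  with y H have "0 < y" "y < height a x" by auto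
  with eta_unique[OF assms(1,2) this y(3)] y(3)
  show "0 < eta a x \<rho>" "eta a x \<rho> < height a x" "Q a (vec2 x (eta a x \<rho>)) = \<rho>\<^sup>2" by auto
qed

lemma continuous_on_slice:
  assumes "continuous_on tube (\<lambda>(a, p). f a p)" "(\<alpha> \<longlongrightarrow> a) F" "(\<xi> \<longlongrightarrow> x) F" "(a, vec2 x y) \<in> tube"
    "\<forall>\<^sub>F e in F. \<alpha> e \<in> A" "\<forall>\<^sub>F e in F. \<xi> e \<in> J"
  shows "((\<lambda>e. f (\<alpha> e) (vec2 (\<xi> e) y)) \<longlongrightarrow> f a (vec2 x y)) F"
    and "\<forall>\<^sub>F e in F. \<bar>y\<bar> < height (\<alpha> e) (\<xi> e)"
proof -
  have lim: "((\<lambda>e. (\<alpha> e, vec2 (\<xi> e) y)) \<longlongrightarrow> (a, vec2 x y)) F"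
    unfolding vec2_conv by (intro tendsto_intros assms)
  have "continuous_on UNIV (\<lambda>q. height (fst q) (snd q))" by (intro continuous_intros)
  then have "((\<lambda>e. height (fst (\<alpha> e, \<xi> e)) (snd (\<alpha> e, \<xi> e))) \<longlongrightarrow> height (fst (a, x)) (snd (a, x))) F"
    by (rule continuous_on_tendsto_compose) (auto intro!: tendsto_intros assms)
  then show ev: "\<forall>\<^sub>F e in F. \<bar>y\<bar> < height (\<alpha> e) (\<xi> e)"
    using assms(4) by (intro order_tendstoD) (auto simp: tube_iff)
  have "\<forall>\<^sub>F e in F. (\<alpha> e, vec2 (\<xi> e) y) \<in> tube"
    using assms(5,6) ev by eventually_elim (simp add: tube_iff)
  from continuous_on_tendsto_compose[OF assms(1) lim assms(4) this]
  show "((\<lambda>e. f (\<alpha> e) (vec2 (\<xi> e) y)) \<longlongrightarrow> f a (vec2 x y)) F" by simp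
qed

lemma continuous_on_eta:
  "continuous_on {(a, x, \<rho>). a \<in> A \<and> x \<in> J \<and> 0 < \<rho> \<and> \<rho> \<le> 1} (\<lambda>(a, x, \<rho>). eta a x \<rho>)"
proof -
  let ?E = "{(a, x, \<rho>::real). a \<in> A \<and> x \<in> J \<and> 0 < \<rho> \<and> \<rho> \<le> 1}"
  have "continuous_on ?E (\<lambda>e::real \<times> real \<times> real. eta (fst e) (fst (snd e)) (snd (snd e)))"
  proof (rule continuous_on_implicit[where I="\<lambda>e. {0<..<height (fst e) (fst (snd e))}"
        and f="\<lambda>e y. Q (fst e) (vec2 (fst (snd e)) y) - (snd (snd e))\<^sup>2"])
    fix e :: "real \<times> real \<times> real" and y assume e: "e \<in> ?E" and y: "y \<in> {0<..<height (fst e) (fst (snd e))}"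
    have d: "(fst e, vec2 (fst (snd e)) y) \<in> tube" using e y by (auto simp: tube_iff)
    have ev: "\<forall>\<^sub>F e' in at e within ?E. e' \<in> ?E" by (simp add: eventually_at_filter)
    have ev1: "\<forall>\<^sub>F e' in at e within ?E. fst e' \<in> A" "\<forall>\<^sub>F e' in at e within ?E. fst (snd e') \<in> J"
      using ev by (auto elim: eventually_mono)
    note lims = tendsto_fst[OF tendsto_ident_at] tendsto_fst[OF tendsto_snd[OF tendsto_ident_at]]
      tendsto_snd[OF tendsto_snd[OF tendsto_ident_at]]
    note cs = continuous_on_slice[OF Ck_family_continuous[OF Ck_Q(1)[of 0]] lims(1,2) d ev1]
    show "((\<lambda>e'. Q (fst e') (vec2 (fst (snd e')) y) - (snd (snd e'))\<^sup>2) \<longlongrightarrow>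
        Q (fst e) (vec2 (fst (snd e)) y) - (snd (snd e))\<^sup>2) (at e within ?E)"
      by (intro tendsto_diff tendsto_power cs(1) lims)
    show "\<forall>\<^sub>F e' in at e within ?E. y \<in> {0<..<height (fst e') (fst (snd e'))}"
      using cs(2) y by (auto elim: eventually_mono)
  qed (use eta Q_mono in auto)
  then show ?thesis by (simp add: case_prod_unfold)
qed

lemma eta':
  assumes "a \<in> A" "x \<in> J" "0 < \<rho>" "\<rho> \<le> 1"
  defines "q \<equiv> vec2 x (eta a x \<rho>)"
  shows "((\<lambda>x. eta a x \<rho>) has_real_derivative - Qx a q / Qy a q) (at x)"
proof (rule implicit_function_derivative[of "Q a" _ _ _ _ J "\<rho>\<^sup>2"])
  note e = eta[OF assms(1-4)]
  show "(Q a has_derivative (\<lambda>d. d$1 * Qx a q + d$2 * Qy a q)) (at (vec2 x (eta a x \<rho>)))"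
    unfolding q_def using e assms by (intro Q') (simp add: tube_iff)
  show "Qy a q \<noteq> 0" using Qy_pos[OF assms(1,2) e(1,2)] by (simp add: q_def)
  have "continuous_on J (\<lambda>x. (\<lambda>(a, x, \<rho>). eta a x \<rho>) (a, x, \<rho>))"
    by (rule continuous_on_compose2[OF continuous_on_eta]) (use assms in \<open>auto intro!: continuous_intros\<close>)
  then show "continuous (at x) (\<lambda>x. eta a x \<rho>)"
    using J(1) assms(2) by (simp add: continuous_on_eq_continuous_at)
qed (use J assms eta in auto)

definition Y where "Y a x = eta a x 1"

lemma Y: "a \<in> A \<Longrightarrow> x \<in> J \<Longrightarrow> 0 < Y a x" "a \<in> A \<Longrightarrow> x \<in> J \<Longrightarrow> Y a x < height a x"
  "a \<in> A \<Longrightarrow> x \<in> J \<Longrightarrow> Q a (vec2 x (Y a x)) = 1"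
  using eta[of a x 1] by (auto simp: Y_def)

definition strip where "strip = {(a, p::real^2). a \<in> A \<and> p$1 \<in> J}"

lemma strip_open: "open_slices strip"
  unfolding open_slices_def
proof
  fix a
  show "open {p. (a, p) \<in> strip}"
    using open_Collect_J by (cases "a \<in> A") (auto simp: strip_def)
qed

text \<open>The derivative of \<open>Y\<close> is a smooth function of \<open>x\<close> and \<open>Y\<close>, so that each order of differentiability
  yields the next.\<close>

lemma Ck_Y: "Ck_family k (\<lambda>a p. Y a (p$1)) strip"
proof (induction k)
  case 0
  have "continuous_on strip (\<lambda>q. (\<lambda>(a, x, \<rho>). eta a x \<rho>) (fst q, snd q$1, 1))"
    by (rule continuous_on_compose2[OF continuous_on_eta])
      (auto intro!: continuous_intros simp: strip_def)
  then show ?case by (simp add: Y_def case_prod_unfold)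
next
  case (Suc k)
  let ?D = "{(a, p). (a, p) \<in> tube \<and> 0 < p$2}"
  have D: "open_slices ?D"
    unfolding open_slices_def
  proof
    fix a
    have "open ({p. (a, p) \<in> tube} \<inter> {p::real^2. 0 < p$2})"
      using tube_open by (intro open_Int open_Collect_less continuous_intros) (auto simp: open_slices_def)
    then show "open {p. (a, p) \<in> ?D}" by (simp add: Int_def)
  qed
  have slope: "Ck_family k (\<lambda>a p. - Qx a p / Qy a p) ?D"
  proof (intro Ck_family_divide Ck_family_minus D)
    show "Ck_family k Qx ?D" "Ck_family k Qy ?D"
      by (rule Ck_family_subset[OF Ck_Q(2)] Ck_family_subset[OF Ck_Q(3)]; auto)+
    fix a p assume "(a, p) \<in> ?D"
    then show "Qy a p \<noteq> 0" using Qy_pos[of a "p$1" "p$2"] by (auto simp: tube_def)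
  qed
  show ?case
  proof (rule Ck_family_SucI[OF strip_open Ck_family_continuous[OF Suc]])
    fix a p assume "(a, p) \<in> strip"
    then have *: "a \<in> A" "p$1 \<in> J" by (auto simp: strip_def)
    have "((\<lambda>x. Y a x) has_derivative (\<lambda>d. d * (- Qx a (vec2 (p$1) (Y a (p$1))) / Qy a (vec2 (p$1) (Y a (p$1))))))
        (at (p$1))"
    proof -
      let ?r = "- Qx a (vec2 (p$1) (Y a (p$1))) / Qy a (vec2 (p$1) (Y a (p$1)))"
      have "((\<lambda>x. Y a x) has_derivative (*) ?r) (at (p$1))"
        using eta'[OF *, of 1] by (simp only: Y_def[abs_def] has_field_derivative_def)
      moreover have "(*) ?r = (\<lambda>d. d * ?r)" by (rule mult_commute_abs[symmetric])
      ultimately show ?thesis by (simp only:)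
    qed
    from has_derivative_compose[OF bounded_linear_imp_has_derivative[OF bounded_linear_vec_nth] this]
    show "((\<lambda>p. Y a (p$1)) has_derivative (\<lambda>d. d$1 * (- Qx a (vec2 (p$1) (Y a (p$1))) / Qy a (vec2 (p$1) (Y a (p$1))))
        + d$2 * 0)) (at p)" by simp
  next
    show "Ck_family k (\<lambda>a p. - Qx a (vec2 (p$1) (Y a (p$1))) / Qy a (vec2 (p$1) (Y a (p$1)))) strip"
      by (rule Ck_family_compose[OF strip_open slope Ck_family_coord[OF strip_open] Suc])
        (auto simp: strip_def tube_iff Y less_imp_le abs_of_pos)
  qed (rule Ck_family_const[OF strip_open])
qed

section \<open>The Gauss map and the fundamental forms\<close>

text \<open>The partial derivatives of the immersion \<open>F\<close>, and the normal, which is the stereographic image of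
  the Gauss map \<open>exp (i h)\<close>.\<close>

definition Fx :: "real \<Rightarrow> real^2 \<Rightarrow> real^3" where "Fx a q = vector [cos (u a q) * sinh (v a q), sin (u a q) * sinh (v a q), 1 :: real]"
definition Fy :: "real \<Rightarrow> real^2 \<Rightarrow> real^3" where "Fy a q = vector [sin (u a q) * cosh (v a q), - (cos (u a q) * cosh (v a q)), 0 :: real]"
definition F :: "real \<Rightarrow> real^2 \<Rightarrow> real^3" where "F a q = vector [W1 a q, W2 a q, q$1]"
definition nrm :: "real \<Rightarrow> real^2 \<Rightarrow> real^3" where "nrm a q = vector [cos (u a q) / cosh (v a q), sin (u a q) / cosh (v a q), - tanh (v a q)]"

lemma vector3_eq: "(vector [x, y, z] :: real^3) = x *\<^sub>R axis 1 1 + y *\<^sub>R axis 2 1 + z *\<^sub>R axis 3 1"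
  by (simp add: vec_eq_iff forall_3 vector_3 axis_def)

lemma F':
  assumes "(a, q) \<in> tube"
  shows "(F a has_derivative (\<lambda>d. d$1 *\<^sub>R Fx a q + d$2 *\<^sub>R Fy a q)) (at q)"
proof -
  have "(F a has_derivative (\<lambda>d. (d$1 * (cos (u a q) * sinh (v a q)) + d$2 * (sin (u a q) * cosh (v a q))) *\<^sub>R axis 1 1
      + (d$1 * (sin (u a q) * sinh (v a q)) + d$2 * (- (cos (u a q) * cosh (v a q)))) *\<^sub>R axis 2 1
      + (d$1) *\<^sub>R axis 3 1)) (at q)"
    unfolding F_def[abs_def] vector3_eq
    by (intro has_derivative_add has_derivative_scaleR_left W1' W2' assms
        bounded_linear_imp_has_derivative bounded_linear_vec_nth)
  then show ?thesis
    by (rule has_derivative_eq_rhs) (auto simp: vec_eq_iff forall_3 Fx_def Fy_def axis_def vector_3)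
qed

lemma cosh_sq: "(cosh x)\<^sup>2 = (sinh x)\<^sup>2 + (1::real)"
  by (rule cosh_square_eq)

lemma isothermal_patch_F:
  assumes a: "a \<in> A"
  shows "\<exists>nx ny. isothermal_patch {q. (a, q) \<in> tube} (F a) (Fx a) (Fy a) (nrm a) nx ny
    (\<lambda>q. (cosh (v a q))\<^sup>2) (hy a) (hx a)"
proof -
  define nx :: "real^2 \<Rightarrow> real^3" where "nx q = vector [- sin (u a q) / cosh (v a q) * hx a q - cos (u a q) * sinh (v a q) / (cosh (v a q))\<^sup>2 * hy a q,
      cos (u a q) / cosh (v a q) * hx a q - sin (u a q) * sinh (v a q) / (cosh (v a q))\<^sup>2 * hy a q,
      - (1 / (cosh (v a q))\<^sup>2) * hy a q]" for q
  define ny :: "real^2 \<Rightarrow> real^3" where "ny q = vector [- sin (u a q) / cosh (v a q) * (- hy a q) - cos (u a q) * sinh (v a q) / (cosh (v a q))\<^sup>2 * hx a q,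
      cos (u a q) / cosh (v a q) * (- hy a q) - sin (u a q) * sinh (v a q) / (cosh (v a q))\<^sup>2 * hx a q,
      - (1 / (cosh (v a q))\<^sup>2) * hx a q]" for q
  have n': "(nrm a has_derivative (\<lambda>d. d$1 *\<^sub>R nx q + d$2 *\<^sub>R ny q)) (at q)" if q: "(a, q) \<in> tube" for q
  proof -
    let ?u = "\<lambda>d. d$1 * hx a q + d$2 * (- hy a q)" and ?v = "\<lambda>d. d$1 * hy a q + d$2 * hx a q"
    let ?s = "sin (u a q)" and ?c = "cos (u a q)" and ?S = "sinh (v a q)" and ?C = "cosh (v a q)"
    have C: "?C \<noteq> 0" using cosh_real_pos[of "v a q"] by simp
    have "(sinh has_field_derivative ?C) (at (v a q))" "(cosh has_field_derivative ?S) (at (v a q))"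
      by (auto intro!: derivative_eq_intros)
    note hyp = this[unfolded has_field_derivative_def]
    have sin: "((\<lambda>q. sin (u a q)) has_derivative (\<lambda>d. ?c * ?u d)) (at q)"
      and cos: "((\<lambda>q. cos (u a q)) has_derivative (\<lambda>d. - ?s * ?u d)) (at q)"
      and sinh: "((\<lambda>q. sinh (v a q)) has_derivative (\<lambda>d. ?C * ?v d)) (at q)"
      and cosh: "((\<lambda>q. cosh (v a q)) has_derivative (\<lambda>d. ?S * ?v d)) (at q)"
      using has_derivative_compose[OF u'[OF q] DERIV_sin[unfolded has_field_derivative_def]]
        has_derivative_compose[OF u'[OF q] DERIV_cos[unfolded has_field_derivative_def]]
        has_derivative_compose[OF v'[OF q] hyp(1)] has_derivative_compose[OF v'[OF q] hyp(2)]
      by simp_all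
    let ?D = "\<lambda>d::real^2. ((- ?s * ?u d * ?C - ?c * (?S * ?v d)) / (?C * ?C)) *\<^sub>R axis 1 1
      + ((?c * ?u d * ?C - ?s * (?S * ?v d)) / (?C * ?C)) *\<^sub>R axis 2 1
      + (- ((?C * ?v d * ?C - ?S * (?S * ?v d)) / (?C * ?C))) *\<^sub>R (axis 3 1 :: real^3)"
    have "(nrm a has_derivative ?D) (at q)"
      unfolding nrm_def[abs_def] vector3_eq tanh_def
      by (intro has_derivative_add has_derivative_scaleR_left has_derivative_minus has_derivative_divide' sin cos sinh cosh C)
    moreover have "?D d = d$1 *\<^sub>R nx q + d$2 *\<^sub>R ny q" for d
    proof -
      have k: "?C * (r * ?C) - ?S * (r * ?S) = r" for r
        using cosh_sq[of "v a q"] by (simp add: power2_eq_square) algebra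
      have e: "?C * ?v d * ?C - ?S * (?S * ?v d) = ?v d"
        using k[of "?v d"] by (simp add: mult_ac)
      show ?thesis
        unfolding e using C by (simp add: vec_eq_iff forall_3 nx_def ny_def vector_3 axis_def power2_eq_square field_simps)
    qed
    ultimately show ?thesis by simp
  qed
  have sub: "continuous_on {q. (a, q) \<in> tube} (f a)" if "Ck_family 0 f tube" for f
  proof -
    have "continuous_on {q. (a, q) \<in> tube} (\<lambda>q. (\<lambda>(a, p). f a p) (a, q))"
      by (rule continuous_on_compose2[OF Ck_family_continuous[OF that]]) (auto intro!: continuous_intros)
    then show ?thesis by simp
  qed
  note c1 = sub[OF Ck_uv(1)] sub[OF Ck_uv(2)]
  have "isothermal_patch {q. (a, q) \<in> tube} (F a) (Fx a) (Fy a) (nrm a) nx ny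
    (\<lambda>q. (cosh (v a q))\<^sup>2) (hy a) (hx a)"
  proof
    show "continuous_on {q. (a, q) \<in> tube} (Fx a)" "continuous_on {q. (a, q) \<in> tube} (Fy a)"
      "continuous_on {q. (a, q) \<in> tube} (\<lambda>q. (cosh (v a q))\<^sup>2)"
      unfolding Fx_def[abs_def] Fy_def[abs_def] vector3_eq
      by (intro continuous_intros c1)+
    show "continuous_on {q. (a, q) \<in> tube} (hy a)" "continuous_on {q. (a, q) \<in> tube} (hx a)"
      by (rule sub[OF Ck_h'(2)], rule sub[OF Ck_h'(1)])
    fix q assume "q \<in> {q. (a, q) \<in> tube}"
    have c: "cosh (v a q) > 0" by (rule cosh_real_pos)
    have s: "sin (u a q) * sin (u a q) = 1 - cos (u a q) * cos (u a q)"
      using sin_cos_squared_add[of "u a q"] by (simp add: power2_eq_square)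
    have h: "cosh (v a q) * cosh (v a q) = sinh (v a q) * sinh (v a q) + 1"
      using cosh_sq[of "v a q"] by (simp add: power2_eq_square)
    show "Fx a q \<bullet> Fx a q = (cosh (v a q))\<^sup>2"
      unfolding cosh_sq Fx_def using s by (simp add: inner_vec_def sum_3 vector_3) algebra
    show "Fy a q \<bullet> Fy a q = (cosh (v a q))\<^sup>2"
      unfolding Fy_def using s by (simp add: inner_vec_def sum_3 vector_3) algebra
    show "Fx a q \<bullet> Fy a q = 0"
      unfolding Fx_def Fy_def by (simp add: inner_vec_def sum_3 vector_3)
    show "cross3 (Fx a q) (Fy a q) = (cosh (v a q))\<^sup>2 *\<^sub>R nrm a q"
      using c s by (simp add: vec_eq_iff forall_3 cross3_def Fx_def Fy_def nrm_def vector_3 tanh_def power2_eq_square) algebra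
    have "nrm a q \<bullet> nrm a q = (cos (u a q) * cos (u a q) + sin (u a q) * sin (u a q)
        + sinh (v a q) * sinh (v a q)) / (cosh (v a q) * cosh (v a q))"
      using s by (simp add: nrm_def inner_vec_def sum_3 vector_3 tanh_def add_divide_distrib)
        (simp add: s flip: add_divide_distrib)
    also have "\<dots> = (cosh (v a q) * cosh (v a q)) / (cosh (v a q) * cosh (v a q))"
      unfolding h using s by (simp add: add.commute)
    also have "\<dots> = 1" using c by simp
    finally show "norm (nrm a q) = 1" by (simp add: norm_eq_1)
    show "Fx a q \<bullet> nx q = - hy a q"
    proof -
      have "Fx a q \<bullet> nx q = - hy a q * (((cos (u a q))\<^sup>2 + (sin (u a q))\<^sup>2) * (sinh (v a q))\<^sup>2 + 1) / (cosh (v a q))\<^sup>2"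
        using c s by (simp add: Fx_def nx_def inner_vec_def sum_3 vector_3 power2_eq_square field_simps; algebra)
      then show ?thesis using c by (simp flip: cosh_sq)
    qed
    show "Fx a q \<bullet> ny q = - hx a q"
    proof -
      have "Fx a q \<bullet> ny q = - hx a q * (((cos (u a q))\<^sup>2 + (sin (u a q))\<^sup>2) * (sinh (v a q))\<^sup>2 + 1) / (cosh (v a q))\<^sup>2"
        using c s by (simp add: Fx_def ny_def inner_vec_def sum_3 vector_3 power2_eq_square field_simps; algebra)
      then show ?thesis using c by (simp flip: cosh_sq)
    qed
    show "Fy a q \<bullet> nx q = - hx a q"
    proof -
      have "Fy a q \<bullet> nx q = - hx a q * ((cos (u a q))\<^sup>2 + (sin (u a q))\<^sup>2)"
        using c s by (simp add: Fy_def nx_def inner_vec_def sum_3 vector_3 power2_eq_square field_simps; algebra)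
      then show ?thesis by simp
    qed
    show "Fy a q \<bullet> ny q = hy a q"
    proof -
      have "Fy a q \<bullet> ny q = hy a q * ((cos (u a q))\<^sup>2 + (sin (u a q))\<^sup>2)"
        using c s by (simp add: Fy_def ny_def inner_vec_def sum_3 vector_3 power2_eq_square field_simps; algebra)
      then show ?thesis by simp
    qed
  qed (use F' n' cosh_real_pos in auto)
  then show ?thesis by blast
qed

end

context helicoidal_family
begin

section \<open>The surfaces are embedded minimal disks\<close>

text \<open>Rescaling each slice moves the boundary of the parameter domain to \<open>\<bar>t\<bar> = 1\<close>, independently of \<open>a\<close>.\<close>

definition G :: "real \<Rightarrow> real^2 \<Rightarrow> real^3" where
  "G a p = F a (vec2 (p$1) (p$2 * Y a (p$1)))"

definition Dom :: "(real^2) set" where "Dom = {p. p$1 \<in> J \<and> \<bar>p$2\<bar> \<le> 1}"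

definition surf :: "real \<Rightarrow> (real^3) set" where "surf a = G a ` Dom"

text \<open>The open set of parameters, beyond the closed strip \<open>Dom\<close>, on which \<open>G\<close> is smooth.\<close>

definition ext :: "(real \<times> (real^2)) set" where
  "ext = {(a, p). a \<in> A \<and> p$1 \<in> J \<and> \<bar>p$2 * Y a (p$1)\<bar> < height a (p$1)}"

lemma ext_open: "open_slices ext"
  unfolding open_slices_def
proof
  fix a
  let ?S = "{p::real^2. p$1 \<in> J}"
  show "open {p. (a, p) \<in> ext}"
  proof (cases "a \<in> A")
    case True
    have "continuous_on ?S (\<lambda>p. (\<lambda>(a, p). Y a (p$1)) (a, p))"
      by (rule continuous_on_compose2[OF Ck_family_continuous[OF Ck_Y[of 0]]])
        (use True in \<open>auto simp: strip_def intro!: continuous_intros\<close>)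
    then have "continuous_on ?S (\<lambda>p. height a (p$1) - \<bar>p$2 * Y a (p$1)\<bar>)"
      by (auto intro!: continuous_intros)
    from continuous_open_preimage[OF this open_Collect_J open_greaterThan[of 0]]
    have "open (?S \<inter> (\<lambda>p. height a (p$1) - \<bar>p$2 * Y a (p$1)\<bar>) -` {0<..})" .
    moreover have "?S \<inter> (\<lambda>p. height a (p$1) - \<bar>p$2 * Y a (p$1)\<bar>) -` {0<..} = {p. (a, p) \<in> ext}"
      using True by (auto simp: ext_def)
    ultimately show ?thesis by simp
  qed (simp add: ext_def)
qed

lemma ext_tube: "(a, p) \<in> ext \<Longrightarrow> (a, vec2 (p$1) (p$2 * Y a (p$1))) \<in> tube"
  by (simp add: ext_def tube_iff)

lemma Dom_ext: "a \<in> A \<Longrightarrow> p \<in> Dom \<Longrightarrow> (a, p) \<in> ext"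
proof -
  assume a: "a \<in> A" "p \<in> Dom"
  then have J: "p$1 \<in> J" "\<bar>p$2\<bar> \<le> 1" by (auto simp: Dom_def)
  have "\<bar>p$2 * Y a (p$1)\<bar> \<le> 1 * Y a (p$1)"
    unfolding abs_mult using Y(1)[OF a(1) J(1)] J(2) by (intro mult_mono) auto
  then show "(a, p) \<in> ext" using Y(2)[OF a(1) J(1)] a J by (simp add: ext_def)
qed

lemma F_nth [simp]: "F a q $ 1 = W1 a q" "F a q $ 2 = W2 a q" "F a q $ 3 = q$1"
  by (simp_all add: F_def vector_3)

lemma Ck_G: "Ck_family k (\<lambda>a p. G a p $ j) ext"
proof -
  have Yext: "Ck_family k (\<lambda>a p. Y a (p$1)) ext"
    by (rule Ck_family_subset[OF Ck_Y]) (auto simp: ext_def strip_def)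
  have "Ck_family k (\<lambda>a p. F a (vec2 (p$1) (p$2 * Y a (p$1))) $ j) ext"
  proof (rule Ck_family_compose[OF ext_open _ _ _ ext_tube])
    show "Ck_family k (\<lambda>a q. F a q $ j) tube"
      using exhaust_3[of j] Ck_W Ck_family_coord[OF tube_open] by auto
  qed (auto intro!: Ck_family_mult Ck_family_coord ext_open Yext)
  then show ?thesis by (simp add: G_def)
qed

text \<open>The inverse of \<open>F\<close>: the third coordinate is \<open>x\<close>, and along a slice the component \<open>slice_p\<close> is
  strictly increasing.\<close>

definition yof where "yof a X = (THE y. \<bar>y\<bar> < height a (X$3) \<and>
  slice_p a (X$3) y = X$1 * sin (u a (vec2 (X$3) 0)) - X$2 * cos (u a (vec2 (X$3) 0)))"

lemma yof_F:
  assumes "(a, q) \<in> tube" shows "yof a (F a q) = q$2"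
  unfolding yof_def
proof (rule the_equality)
  have q: "a \<in> A" "q$1 \<in> J" "\<bar>q$2\<bar> < height a (q$1)" using assms by (auto simp: tube_def)
  show eq: "\<bar>q$2\<bar> < height a (F a q $ 3) \<and> slice_p a (F a q $ 3) (q$2) =
      F a q $ 1 * sin (u a (vec2 (F a q $ 3) 0)) - F a q $ 2 * cos (u a (vec2 (F a q $ 3) 0))"
    using q by (simp add: slice_p_def)
  fix y assume "\<bar>y\<bar> < height a (F a q $ 3) \<and> slice_p a (F a q $ 3) y =
      F a q $ 1 * sin (u a (vec2 (F a q $ 3) 0)) - F a q $ 2 * cos (u a (vec2 (F a q $ 3) 0))"
  with eq have "\<bar>y\<bar> < height a (q$1)" "slice_p a (q$1) y = slice_p a (q$1) (q$2)" by auto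
  then show "y = q$2"
    using slice_p_strict_mono[OF q(1,2), of y "q$2"] slice_p_strict_mono[OF q(1,2), of "q$2" y] q(3)
    by (cases y "q$2" rule: linorder_cases) auto
qed

definition Finv where "Finv a X = vec2 (X$3) (yof a X)"

lemma Finv_F: "(a, q) \<in> tube \<Longrightarrow> Finv a (F a q) = q"
  by (simp add: Finv_def yof_F)

lemma surf_F:
  assumes "a \<in> A" "X \<in> surf a"
  obtains q where "(a, q) \<in> tube" "X = F a q"
proof -
  from assms(2) obtain p where "p \<in> Dom" "X = G a p" by (auto simp: surf_def)
  with that ext_tube[OF Dom_ext[OF assms(1)]] show ?thesis by (auto simp: G_def)
qed

lemma F_Finv: "a \<in> A \<Longrightarrow> X \<in> surf a \<Longrightarrow> (a, Finv a X) \<in> tube" "a \<in> A \<Longrightarrow> X \<in> surf a \<Longrightarrow> F a (Finv a X) = X"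
  using surf_F Finv_F by metis+

lemma continuous_on_uaxis:
  assumes "a \<in> A" shows "continuous_on J (\<lambda>x. u a (vec2 x 0))"
proof -
  have "continuous_on J (\<lambda>x. (\<lambda>(a, p). u a p) (a, vec2 x 0))"
    by (rule continuous_on_compose2[OF Ck_family_continuous[OF Ck_uv(1)[of 0]]])
      (use assms height_pos[OF radius] in \<open>auto simp: tube_iff intro!: continuous_intros\<close>)
  then show ?thesis by simp
qed

lemma continuous_on_yof:
  assumes a: "a \<in> A" shows "continuous_on (surf a) (yof a)"
proof (rule continuous_on_implicit[where I="\<lambda>X. {y. \<bar>y\<bar> < height a (X$3)}"
      and f="\<lambda>X y. slice_p a (X$3) y - (X$1 * sin (u a (vec2 (X$3) 0)) - X$2 * cos (u a (vec2 (X$3) 0)))"])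
  have J: "X$3 \<in> J" if "X \<in> surf a" for X
    using that by (auto simp: surf_def Dom_def G_def)
  fix X assume X: "X \<in> surf a"
  show "open {y. \<bar>y\<bar> < height a (X$3)}" by (intro open_Collect_less continuous_intros)
  obtain q where q: "(a, q) \<in> tube" "X = F a q" using surf_F[OF a X] .
  then show "yof a X \<in> {y. \<bar>y\<bar> < height a (X$3)}"
    by (simp add: yof_F) (simp add: tube_def)
  show "slice_p a (X$3) (yof a X) - (X$1 * sin (u a (vec2 (X$3) 0)) - X$2 * cos (u a (vec2 (X$3) 0))) = 0"
    using q J[OF X] a by (simp add: yof_F slice_p_def)
  show "slice_p a (X$3) s - (X$1 * sin (u a (vec2 (X$3) 0)) - X$2 * cos (u a (vec2 (X$3) 0)))
      < slice_p a (X$3) t - (X$1 * sin (u a (vec2 (X$3) 0)) - X$2 * cos (u a (vec2 (X$3) 0)))"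
    if "s \<in> {y. \<bar>y\<bar> < height a (X$3)}" "t \<in> {y. \<bar>y\<bar> < height a (X$3)}" "s < t" for s t
    using slice_p_strict_mono[OF a J[OF X]] that by simp
  fix t assume t: "t \<in> {y. \<bar>y\<bar> < height a (X$3)}"
  have d: "(a, vec2 (X$3) t) \<in> tube" using t a J[OF X] by (simp add: tube_iff)
  have ev: "\<forall>\<^sub>F X' in at X within surf a. X' \<in> surf a" by (simp add: eventually_at_filter)
  have evJ: "\<forall>\<^sub>F X' in at X within surf a. X'$3 \<in> J"
    using ev by eventually_elim (rule J)
  have evA: "\<forall>\<^sub>F X' in at X within surf a. a \<in> A" using a by simp
  have l: "((\<lambda>X'. X'$i) \<longlongrightarrow> X$i) (at X within surf a)" for i
    by (intro tendsto_vec_nth tendsto_ident_at)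
  note cs = continuous_on_slice[OF _ tendsto_const l[of 3] d evA evJ]
  show "\<forall>\<^sub>F X' in at X within surf a. t \<in> {y. \<bar>y\<bar> < height a (X'$3)}"
    using cs(2)[OF Ck_family_continuous[OF Ck_uv(1)[of 0]]] by simp
  have lu: "((\<lambda>X'. u a (vec2 (X'$3) 0)) \<longlongrightarrow> u a (vec2 (X$3) 0)) (at X within surf a)"
    by (rule continuous_on_tendsto_compose[OF continuous_on_uaxis[OF a] l J[OF X] evJ])
  have "((\<lambda>X'. W1 a (vec2 (X'$3) t) * sin (u a (vec2 (X'$3) 0)) - W2 a (vec2 (X'$3) t) * cos (u a (vec2 (X'$3) 0))
        - (X'$1 * sin (u a (vec2 (X'$3) 0)) - X'$2 * cos (u a (vec2 (X'$3) 0))))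
      \<longlongrightarrow> W1 a (vec2 (X$3) t) * sin (u a (vec2 (X$3) 0)) - W2 a (vec2 (X$3) t) * cos (u a (vec2 (X$3) 0))
        - (X$1 * sin (u a (vec2 (X$3) 0)) - X$2 * cos (u a (vec2 (X$3) 0)))) (at X within surf a)"
    by (intro tendsto_diff tendsto_mult tendsto_sin tendsto_cos lu l
        cs(1)[OF Ck_family_continuous[OF Ck_W(1)[of 0]]] cs(1)[OF Ck_family_continuous[OF Ck_W(2)[of 0]]])
  moreover have "\<forall>\<^sub>F X' in at X within surf a.
      W1 a (vec2 (X'$3) t) * sin (u a (vec2 (X'$3) 0)) - W2 a (vec2 (X'$3) t) * cos (u a (vec2 (X'$3) 0))
        - (X'$1 * sin (u a (vec2 (X'$3) 0)) - X'$2 * cos (u a (vec2 (X'$3) 0)))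
      = slice_p a (X'$3) t - (X'$1 * sin (u a (vec2 (X'$3) 0)) - X'$2 * cos (u a (vec2 (X'$3) 0)))"
    using evJ by eventually_elim (simp add: slice_p_def a)
  ultimately show "((\<lambda>X'. slice_p a (X'$3) t - (X'$1 * sin (u a (vec2 (X'$3) 0)) - X'$2 * cos (u a (vec2 (X'$3) 0))))
      \<longlongrightarrow> slice_p a (X$3) t - (X$1 * sin (u a (vec2 (X$3) 0)) - X$2 * cos (u a (vec2 (X$3) 0)))) (at X within surf a)"
    by (subst slice_p_def[OF a J[OF X], of t]) (rule Lim_transform_eventually)
qed

definition Ginv where "Ginv a X = vec2 (X$3) (yof a X / Y a (X$3))"

lemma continuous_on_Yx: "a \<in> A \<Longrightarrow> continuous_on J (Y a)"
proof -
  assume a: "a \<in> A"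
  have "continuous_on J (\<lambda>x. (\<lambda>(a, p). Y a (p$1)) (a, vec2 x 0))"
    by (rule continuous_on_compose2[OF Ck_family_continuous[OF Ck_Y[of 0]]])
      (use a in \<open>auto simp: strip_def intro!: continuous_intros\<close>)
  then show ?thesis by simp
qed

lemma Ginv_G: "a \<in> A \<Longrightarrow> p \<in> Dom \<Longrightarrow> Ginv a (G a p) = p"
proof -
  assume a: "a \<in> A" "p \<in> Dom"
  have "0 < Y a (p$1)" using Y(1) a by (auto simp: Dom_def)
  then show "Ginv a (G a p) = p"
    using yof_F[OF ext_tube[OF Dom_ext[OF a]]] by (simp add: Ginv_def G_def)
qed

lemma continuous_on_G: "a \<in> A \<Longrightarrow> continuous_on Dom (G a)"
proof -
  assume a: "a \<in> A"
  have "continuous_on ext (\<lambda>q. G (fst q) (snd q))"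
    using Ck_family_continuous[OF Ck_G[of 0]]
    by (simp add: continuous_on_componentwise_vec case_prod_unfold)
  then have "continuous_on Dom (\<lambda>p. G (fst (a, p)) (snd (a, p)))"
    by (rule continuous_on_compose2) (use Dom_ext a in \<open>auto intro!: continuous_intros\<close>)
  then show "continuous_on Dom (G a)" by simp
qed

lemma homeomorphism_G:
  assumes a: "a \<in> A" shows "homeomorphism Dom (surf a) (G a) (Ginv a)"
proof (rule homeomorphismI)
  show "continuous_on Dom (G a)" by (rule continuous_on_G[OF a])
  have J: "X$3 \<in> J" if "X \<in> surf a" for X
    using that by (auto simp: surf_def Dom_def G_def)
  have "continuous_on (surf a) (\<lambda>X. Y a (X$3))"
    by (rule continuous_on_compose2[OF continuous_on_Yx[OF a]]) (auto intro!: continuous_intros J)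
  moreover have "\<forall>X\<in>surf a. Y a (X$3) \<noteq> 0" using Y(1)[OF a J] by (metis less_irrefl)
  ultimately show "continuous_on (surf a) (Ginv a)"
    unfolding Ginv_def by (intro continuous_intros continuous_on_yof a)
qed (auto simp: surf_def Ginv_G a)

lemma surf_iff:
  assumes a: "a \<in> A"
  shows "X \<in> surf a \<longleftrightarrow> (\<exists>q. (a, q) \<in> tube \<and> X = F a q \<and> Q a q \<le> 1)"
proof
  assume "X \<in> surf a"
  then obtain p where p: "p \<in> Dom" "X = G a p" by (auto simp: surf_def)
  let ?y = "p$2 * Y a (p$1)"
  have q: "(a, vec2 (p$1) ?y) \<in> tube" using ext_tube[OF Dom_ext[OF a p(1)]] .
  have J: "p$1 \<in> J" "\<bar>p$2\<bar> \<le> 1" using p by (auto simp: Dom_def)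
  have "Q a (vec2 (p$1) ?y) = Q a (vec2 (p$1) \<bar>?y\<bar>)" using Q_even[OF q] by (simp add: abs_if)
  also have "\<dots> \<le> 1"
  proof -
    have "\<bar>?y\<bar> \<le> 1 * Y a (p$1)"
      unfolding abs_mult using Y(1)[OF a J(1)] J(2) by (intro mult_mono) auto
    then have "\<bar>?y\<bar> < Y a (p$1) \<or> \<bar>?y\<bar> = Y a (p$1)" by auto
    then show ?thesis
      using Q_mono[OF a J(1), of "\<bar>?y\<bar>" "Y a (p$1)"] Y[OF a J(1)] by auto
  qed
  finally show "\<exists>q. (a, q) \<in> tube \<and> X = F a q \<and> Q a q \<le> 1"
    using q p(2) by (auto simp: G_def)
next
  assume "\<exists>q. (a, q) \<in> tube \<and> X = F a q \<and> Q a q \<le> 1"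
  then obtain q where q: "(a, q) \<in> tube" "X = F a q" "Q a q \<le> 1" by blast
  have J: "q$1 \<in> J" "\<bar>q$2\<bar> < height a (q$1)" using q by (auto simp: tube_def)
  note Y = Y[OF a J(1)]
  have "Q a (vec2 (q$1) \<bar>q$2\<bar>) \<le> 1" using q(3) Q_even[of a "q$1" "q$2"] q(1) by (simp add: abs_if)
  then have "\<not> Y a (q$1) < \<bar>q$2\<bar>"
    using Q_mono[OF a J(1), of "Y a (q$1)" "\<bar>q$2\<bar>"] J Y by auto
  then have "vec2 (q$1) (q$2 / Y a (q$1)) \<in> Dom"
    using J Y by (simp add: Dom_def abs_divide abs_of_pos)
  moreover have "G a (vec2 (q$1) (q$2 / Y a (q$1))) = X" using Y by (simp add: G_def q)
  ultimately show "X \<in> surf a" by (auto simp: surf_def)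
qed

lemma Q_G:
  assumes "a \<in> A" "p \<in> Dom"
  shows "(G a p $ 1)\<^sup>2 + (G a p $ 2)\<^sup>2 \<le> 1" "(G a p $ 1)\<^sup>2 + (G a p $ 2)\<^sup>2 = 1 \<longleftrightarrow> \<bar>p$2\<bar> = 1"
proof -
  have J: "p$1 \<in> J" "\<bar>p$2\<bar> \<le> 1" using assms by (auto simp: Dom_def)
  note Y = Y[OF assms(1) J(1)]
  let ?y = "p$2 * Y a (p$1)"
  have q: "(a, vec2 (p$1) ?y) \<in> tube" using ext_tube[OF Dom_ext[OF assms]] .
  have y: "\<bar>?y\<bar> = \<bar>p$2\<bar> * Y a (p$1)" using Y by (simp add: abs_mult)
  have "(G a p $ 1)\<^sup>2 + (G a p $ 2)\<^sup>2 = Q a (vec2 (p$1) ?y)" by (simp add: G_def Q_def)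
  also have "\<dots> = Q a (vec2 (p$1) \<bar>?y\<bar>)" using Q_even[OF q] by (simp add: abs_if)
  finally have e: "(G a p $ 1)\<^sup>2 + (G a p $ 2)\<^sup>2 = Q a (vec2 (p$1) (\<bar>p$2\<bar> * Y a (p$1)))" unfolding y .
  have "\<bar>p$2\<bar> < 1 \<Longrightarrow> Q a (vec2 (p$1) (\<bar>p$2\<bar> * Y a (p$1))) < 1"
    using Q_mono[OF assms(1) J(1), of "\<bar>p$2\<bar> * Y a (p$1)" "Y a (p$1)"] Y by simp
  with e J Y show "(G a p $ 1)\<^sup>2 + (G a p $ 2)\<^sup>2 \<le> 1" "(G a p $ 1)\<^sup>2 + (G a p $ 2)\<^sup>2 = 1 \<longleftrightarrow> \<bar>p$2\<bar> = 1"
    by (cases "\<bar>p$2\<bar> = 1"; force)+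
qed

lemma Fy_nz: "Fy a q \<noteq> 0"
proof
  assume "Fy a q = 0"
  then have "Fy a q $ 1 = 0" "Fy a q $ 2 = 0" by simp_all
  then have "sin (u a q) = 0" "cos (u a q) = 0"
    using cosh_real_pos[of "v a q"] by (auto simp: Fy_def vector_3)
  then show False using sin_cos_squared_add[of "u a q"] by simp
qed

text \<open>Charts must have their domain in the half plane. Translations and a reflection of the second
  parameter bring the interior and both boundary lines of the strip \<open>Dom\<close> there.\<close>

lemma regular_param_affine:
  assumes a: "a \<in> A" and \<sigma>: "\<sigma> * \<sigma> = 1" and D: "\<And>p. p \<in> D \<Longrightarrow> vec2 (p$1) (\<beta> + \<sigma> * p$2) \<in> Dom"
  defines "f \<equiv> \<lambda>p. G a (vec2 (p$1) (\<beta> + \<sigma> * p$2))"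
  shows "regular_param f D (f ` D)"
  unfolding regular_param_def
proof (intro conjI)
  let ?T = "\<lambda>p::real^2. vec2 (p$1) (\<beta> + \<sigma> * p$2)"
  let ?V = "{(a, p). (a, ?T p) \<in> ext}"
  have V: "open_slices ?V"
    unfolding open_slices_def
  proof
    fix a
    have "open (?T -` {p. (a, p) \<in> ext})"
      using ext_open by (intro open_vimage continuous_intros) (auto simp: open_slices_def)
    then show "open {p. (a, p) \<in> ?V}" by (simp add: vimage_def)
  qed
  have "Ck_family k (\<lambda>a p. G a (?T p) $ j) ?V" for k j
    by (rule Ck_family_compose[OF V Ck_G])
      (auto intro!: Ck_family_add Ck_family_mult Ck_family_const Ck_family_coord V)
  then have "smooth_on f {p. (a, p) \<in> ?V}"
    using Ck_family_imp_Ck_on[OF V, of _ "\<lambda>a p. G a (?T p)" a] by (simp add: smooth_on_def f_def)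
  moreover have "open {p. (a, p) \<in> ?V}" "D \<subseteq> {p. (a, p) \<in> ?V}"
    using V Dom_ext[OF a D] by (auto simp: open_slices_def)
  ultimately show "\<exists>V. open V \<and> D \<subseteq> V \<and> smooth_on f V" by blast
  show "\<forall>p\<in>D. inj (frechet_derivative f (at p))"
  proof
    fix p assume p: "p \<in> D"
    have J: "p$1 \<in> J" using D[OF p] by (simp add: Dom_def)
    define q where "q = vec2 (p$1) ((\<beta> + \<sigma> * p$2) * Y a (p$1))"
    have q: "(a, q) \<in> tube" using ext_tube[OF Dom_ext[OF a D[OF p]]] by (simp add: q_def)
    obtain Y' where "(Y a has_real_derivative Y') (at (p$1))"
      using eta'[OF a J, of 1] by (auto simp: Y_def[abs_def])
    from has_derivative_compose[OF bounded_linear_imp_has_derivative[OF bounded_linear_vec_nth]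
        this[unfolded has_field_derivative_def]]
    have Y': "((\<lambda>p. Y a (p$1)) has_derivative (\<lambda>d. Y' * d$1)) (at p)" .
    have "((\<lambda>p. vec2 (p$1) ((\<beta> + \<sigma> * p$2) * Y a (p$1))) has_derivative
        (\<lambda>d. vec2 (d$1) ((\<beta> + \<sigma> * p$2) * (Y' * d$1) + (0 + \<sigma> * d$2) * Y a (p$1)))) (at p)"
      by (intro derivative_intros Y' bounded_linear_imp_has_derivative bounded_linear_vec_nth)
    from has_derivative_compose[OF this F'[OF q[unfolded q_def]]]
    have f': "(f has_derivative (\<lambda>d. d$1 *\<^sub>R Fx a q
        + ((\<beta> + \<sigma> * p$2) * (Y' * d$1) + \<sigma> * d$2 * Y a (p$1)) *\<^sub>R Fy a q)) (at p)"
      by (simp add: f_def G_def[abs_def] q_def)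
    show "inj (frechet_derivative f (at p))"
      unfolding frechet_derivative_at[OF f', symmetric]
    proof (rule injI)
      fix d e :: "real^2"
      assume eq: "d$1 *\<^sub>R Fx a q + ((\<beta> + \<sigma> * p$2) * (Y' * d$1) + \<sigma> * d$2 * Y a (p$1)) *\<^sub>R Fy a q
        = e$1 *\<^sub>R Fx a q + ((\<beta> + \<sigma> * p$2) * (Y' * e$1) + \<sigma> * e$2 * Y a (p$1)) *\<^sub>R Fy a q"
      from arg_cong[OF this, of "\<lambda>X. X$3"] have 1: "d$1 = e$1"
        by (simp add: Fx_def Fy_def vector_3)
      with eq Fy_nz have "\<sigma> * d$2 * Y a (p$1) = \<sigma> * e$2 * Y a (p$1)" by simp
      moreover have "\<sigma> \<noteq> 0" using \<sigma> by auto
      ultimately have "d$2 = e$2" using Y(1)[OF a J] by simp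
      with 1 show "d = e" by (simp add: vec_eq_iff forall_2)
    qed
  qed
  show "\<exists>g. homeomorphism D (f ` D) f g"
  proof (intro exI homeomorphismI)
    have "continuous_on D ?T" by (intro continuous_intros)
    then show "continuous_on D f"
      unfolding f_def by (rule continuous_on_compose2[OF continuous_on_G[OF a]]) (use D in auto)
    have sub: "f ` D \<subseteq> surf a" using D by (auto simp: f_def surf_def)
    have "continuous_on (f ` D) (Ginv a)"
      using homeomorphism_G[OF a] sub by (auto simp: homeomorphism_def intro: continuous_on_subset)
    then show "continuous_on (f ` D) (\<lambda>X. vec2 (Ginv a X $ 1) (\<sigma> * (Ginv a X $ 2 - \<beta>)))"
      by (intro continuous_intros)
    have r: "vec2 (Ginv a (f p) $ 1) (\<sigma> * (Ginv a (f p) $ 2 - \<beta>)) = p" if "p \<in> D" for p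
      using Ginv_G[OF a D[OF that]] \<sigma> by (simp add: f_def vec_eq_iff forall_2 mult.assoc[symmetric])
    then show "vec2 (Ginv a (f p) $ 1) (\<sigma> * (Ginv a (f p) $ 2 - \<beta>)) = p" if "p \<in> D" for p
      using that .
    show "(\<lambda>X. vec2 (Ginv a X $ 1) (\<sigma> * (Ginv a X $ 2 - \<beta>))) ` f ` D \<subseteq> D"
      using r by auto
    show "f (vec2 (Ginv a X $ 1) (\<sigma> * (Ginv a X $ 2 - \<beta>))) = X" if "X \<in> f ` D" for X
      using that r by auto
  qed auto
qed

lemma surface_chart_affine:
  assumes a: "a \<in> A" and \<sigma>: "\<sigma> * \<sigma> = 1"
    and D: "openin (top_of_set half_plane) D"
    and image: "(\<lambda>p. vec2 (p$1) (\<beta> + \<sigma> * p$2)) ` D = E" and E: "openin (top_of_set Dom) E"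
  shows "surface_chart (surf a) (\<lambda>p. G a (vec2 (p$1) (\<beta> + \<sigma> * p$2))) D"
    "(\<lambda>p. G a (vec2 (p$1) (\<beta> + \<sigma> * p$2))) ` D = G a ` E"
proof -
  have sub: "E \<subseteq> Dom" using E openin_imp_subset by blast
  show im: "(\<lambda>p. G a (vec2 (p$1) (\<beta> + \<sigma> * p$2))) ` D = G a ` E"
    using image by (auto simp: image_iff)
  have "openin (top_of_set (surf a)) (G a ` E)"
    by (rule homeomorphism_imp_open_map[OF homeomorphism_G[OF a] E])
  then show "surface_chart (surf a) (\<lambda>p. G a (vec2 (p$1) (\<beta> + \<sigma> * p$2))) D"
    unfolding surface_chart_def im[symmetric]
    using D regular_param_affine[OF a \<sigma>] image sub by blast
qed

lemma openin_Dom_strip: "open T \<Longrightarrow> openin (top_of_set Dom) {p \<in> Dom. p$2 \<in> T}"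
proof -
  assume "open T"
  then have "open ((\<lambda>p::real^2. p$2) -` T)" by (intro open_vimage continuous_intros)
  then have "openin (top_of_set Dom) (Dom \<inter> (\<lambda>p::real^2. p$2) -` T)" by (rule openin_open_Int)
  moreover have "Dom \<inter> (\<lambda>p::real^2. p$2) -` T = {p \<in> Dom. p$2 \<in> T}" by auto
  ultimately show ?thesis by simp
qed

lemma half_plane_strip:
  assumes "open T"
  shows "openin (top_of_set half_plane) {p. p$1 \<in> J \<and> 0 \<le> p$2 \<and> p$2 \<in> T}"
proof -
  have "open ({p::real^2. p$1 \<in> J} \<inter> (\<lambda>p::real^2. p$2) -` T)"
    using assms by (intro open_Int open_Collect_J open_vimage continuous_intros)
  then have "openin (top_of_set half_plane) (half_plane \<inter> ({p::real^2. p$1 \<in> J} \<inter> (\<lambda>p::real^2. p$2) -` T))"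
    by (rule openin_open_Int)
  moreover have "half_plane \<inter> ({p::real^2. p$1 \<in> J} \<inter> (\<lambda>p::real^2. p$2) -` T)
      = {p. p$1 \<in> J \<and> 0 \<le> p$2 \<and> p$2 \<in> T}"
    by (auto simp: half_plane_def)
  ultimately show ?thesis by simp
qed

lemma interior_chart:
  assumes "a \<in> A"
  shows "\<exists>f D. surface_chart (surf a) f D \<and> f ` D = G a ` {p \<in> Dom. p$2 \<in> {-1<..<1}}"
proof -
  let ?D = "{p::real^2. p$1 \<in> J \<and> 0 \<le> p$2 \<and> p$2 \<in> {1<..<3}}"
  have im: "(\<lambda>p. vec2 (p$1) (- 2 + 1 * p$2)) ` ?D = {p \<in> Dom. p$2 \<in> {-1<..<1}}" (is "?L = ?R")
  proof
    show "?R \<subseteq> ?L"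
    proof
      fix p assume "p \<in> ?R"
      then have "p = vec2 (vec2 (p$1) (p$2 + 2) $ 1) (- 2 + 1 * vec2 (p$1) (p$2 + 2) $ 2)"
        "vec2 (p$1) (p$2 + 2) \<in> ?D" by (auto simp: Dom_def)
      then show "p \<in> ?L" by (rule image_eqI)
    qed
  qed (auto simp: Dom_def)
  have s: "1 * 1 = (1::real)" by simp
  show ?thesis
    using surface_chart_affine[OF assms s half_plane_strip[OF open_greaterThanLessThan] im
        openin_Dom_strip[OF open_greaterThanLessThan]] by blast
qed

lemma boundary_chart:
  assumes "a \<in> A" "\<bar>\<tau>\<bar> = 1"
  shows "\<exists>f D. surface_chart (surf a) f D \<and> f ` D = G a ` {p \<in> Dom. 0 < \<tau> * p$2} \<and>
    (\<forall>x\<in>J. vec2 x 0 \<in> D \<and> f (vec2 x 0) = G a (vec2 x \<tau>))"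
proof -
  have tt: "\<tau> * \<tau> = 1" using assms(2) by (auto simp: abs_if split: if_splits)
  let ?D = "{p::real^2. p$1 \<in> J \<and> 0 \<le> p$2 \<and> p$2 \<in> {..<1}}"
  have E: "{p \<in> Dom. 0 < \<tau> * p$2} = {p \<in> Dom. p$2 \<in> {t. 0 < \<tau> * t}}" by simp
  have im: "(\<lambda>p. vec2 (p$1) (\<tau> + (- \<tau>) * p$2)) ` ?D = {p \<in> Dom. p$2 \<in> {t. 0 < \<tau> * t}}" (is "?L = ?R")
  proof
    show "?R \<subseteq> ?L"
    proof
      fix p assume p: "p \<in> ?R"
      have "\<tau> * (\<tau> * p$2) = p$2" using tt by (simp add: mult.assoc[symmetric])
      then have "p = vec2 (vec2 (p$1) (1 - \<tau> * p$2) $ 1) (\<tau> + (- \<tau>) * vec2 (p$1) (1 - \<tau> * p$2) $ 2)"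
        using tt by (simp add: vec_eq_iff forall_2 algebra_simps)
      moreover have "vec2 (p$1) (1 - \<tau> * p$2) \<in> ?D"
        using p assms(2) by (auto simp: Dom_def abs_if split: if_splits)
      ultimately show "p \<in> ?L" by (rule image_eqI)
    qed
    show "?L \<subseteq> ?R" using assms(2) by (auto simp: Dom_def abs_if split: if_splits)
  qed
  have s: "- \<tau> * - \<tau> = 1" using tt by simp
  have o: "open {t. 0 < \<tau> * t}" by (intro open_Collect_less continuous_intros)
  note ch = surface_chart_affine[OF assms(1) s half_plane_strip[OF open_lessThan] im openin_Dom_strip[OF o]]
  show ?thesis
    unfolding E
  proof (intro exI conjI ballI)
    fix x assume "x \<in> J"
    then show "vec2 x 0 \<in> {p. p$1 \<in> J \<and> 0 \<le> p$2 \<and> p$2 \<in> {..<1}}" by simp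
    show "G a (vec2 (vec2 x 0 $ 1) (\<tau> + (- \<tau>) * vec2 x 0 $ 2)) = G a (vec2 x \<tau>)" by simp
  qed (fact ch)+
qed

lemma embedded_surface_surf:
  assumes a: "a \<in> A" shows "embedded_surface (surf a)"
  unfolding embedded_surface_def
proof
  fix X assume "X \<in> surf a"
  then obtain p where p: "p \<in> Dom" "X = G a p" by (auto simp: surf_def)
  then consider "p$2 \<in> {-1<..<1}" | "0 < 1 * p$2" | "0 < -1 * p$2" by (force simp: Dom_def)
  then show "\<exists>f D. surface_chart (surf a) f D \<and> X \<in> f ` D"
  proof cases
    case 1 then show ?thesis using interior_chart[OF a] p by blast
  next
    case 2
    then have "X \<in> G a ` {p \<in> Dom. 0 < 1 * p$2}" using p by blast
    moreover obtain f D where ch: "surface_chart (surf a) f D"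
      and "f ` D = G a ` {p \<in> Dom. 0 < 1 * p$2}"
      using boundary_chart[OF a, of "1"] by auto
    ultimately have "X \<in> f ` D" by (simp only:)
    with ch show ?thesis by blast
  next
    case 3
    then have "X \<in> G a ` {p \<in> Dom. 0 < -1 * p$2}" using p by blast
    moreover obtain f D where ch: "surface_chart (surf a) f D"
      and "f ` D = G a ` {p \<in> Dom. 0 < -1 * p$2}"
      using boundary_chart[OF a, of "-1"] by auto
    ultimately have "X \<in> f ` D" by (simp only:)
    with ch show ?thesis by blast
  qed
qed

text \<open>A point over the open strip cannot be a boundary point in another chart: by invariance of domain
  its preimage under that chart would have a neighbourhood in the plane, not only in the half plane.\<close>

lemma surface_boundary_surf:
  assumes a: "a \<in> A" shows "surface_boundary (surf a) = G a ` {p \<in> Dom. \<bar>p$2\<bar> = 1}"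
proof
  show "G a ` {p \<in> Dom. \<bar>p$2\<bar> = 1} \<subseteq> surface_boundary (surf a)"
  proof
    fix X assume "X \<in> G a ` {p \<in> Dom. \<bar>p$2\<bar> = 1}"
    then obtain p where p: "p \<in> Dom" "\<bar>p$2\<bar> = 1" "X = G a p" by blast
    from boundary_chart[OF a p(2)] obtain f D where "surface_chart (surf a) f D"
      "\<forall>x\<in>J. vec2 x 0 \<in> D \<and> f (vec2 x 0) = G a (vec2 x (p$2))" by blast
    moreover have "p$1 \<in> J" using p by (simp add: Dom_def)
    ultimately have "surface_chart (surf a) f D" "vec2 (p$1) 0 \<in> D" "vec2 (p$1) 0 $ 2 = 0" "f (vec2 (p$1) 0) = X"
      using p(3) by auto
    then show "X \<in> surface_boundary (surf a)" unfolding surface_boundary_def by blast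
  qed
  show "surface_boundary (surf a) \<subseteq> G a ` {p \<in> Dom. \<bar>p$2\<bar> = 1}"
  proof
    fix X assume "X \<in> surface_boundary (surf a)"
    then obtain f D w where ch: "surface_chart (surf a) f D" and w: "w \<in> D" "w$2 = 0" "f w = X"
      by (auto simp: surface_boundary_def)
    from ch obtain g where D: "openin (top_of_set half_plane) D" "openin (top_of_set (surf a)) (f ` D)"
      and hom: "homeomorphism D (f ` D) f g"
      by (auto simp: surface_chart_def regular_param_def)
    have fD: "f ` D \<subseteq> surf a" using D(2) openin_imp_subset by blast
    then obtain p where p: "p \<in> Dom" "X = G a p" using w by (auto simp: surf_def)
    have "\<bar>p$2\<bar> = 1"
    proof (rule ccontr)
      assume "\<bar>p$2\<bar> \<noteq> 1"
      then have p1: "p$2 \<in> {-1<..<1}" using p by (auto simp: Dom_def)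
      let ?I = "{p \<in> Dom. p$2 \<in> {-1<..<1}}"
      have "?I = {p::real^2. p$1 \<in> J} \<inter> (\<lambda>p. p$2) -` {-1<..<1}" by (auto simp: Dom_def)
      also have "open \<dots>" by (intro open_Int open_Collect_J open_vimage continuous_intros)
      finally have I: "open ?I" .
      \<comment> \<open>the parameters in \<open>Dom\<close> of the interior points covered by the chart\<close>
      define E where "E = ?I \<inter> G a -` (f ` D)"
      have "openin (top_of_set Dom) (Dom \<inter> G a -` (f ` D))"
        by (rule continuous_openin_preimage[OF continuous_on_G[OF a] _ D(2)]) (auto simp: surf_def)
      then obtain T where T: "open T" "Dom \<inter> G a -` (f ` D) = Dom \<inter> T"
        by (auto simp: openin_open)
      have "E = ?I \<inter> T" using T(2) by (auto simp: E_def)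
      then have E: "open E" using I T(1) by auto
      have "continuous_on E (\<lambda>p. g (G a p))"
      proof (rule continuous_on_compose2[of "f ` D" g])
        show "continuous_on (f ` D) g" using hom by (simp add: homeomorphism_def)
        show "continuous_on E (G a)"
          by (rule continuous_on_subset[OF continuous_on_G[OF a]]) (auto simp: E_def)
      qed (auto simp: E_def)
      moreover have "inj_on (\<lambda>p. g (G a p)) E"
      proof (rule inj_onI)
        fix x y assume xy: "x \<in> E" "y \<in> E" "g (G a x) = g (G a y)"
        then have "f (g (G a x)) = G a x" "f (g (G a y)) = G a y"
          using hom by (auto simp: E_def homeomorphism_def)
        then have "G a x = G a y" using xy(3) by metis
        then show "x = y" using Ginv_G[OF a] xy by (metis (no_types, lifting) E_def IntD1 mem_Collect_eq)
      qed
      ultimately have "open ((\<lambda>p. g (G a p)) ` E)" using E by (intro invariance_of_domain)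
      moreover have "p \<in> E" using p p1 w imageI[OF w(1), of f] by (auto simp: E_def)
      then have "w \<in> (\<lambda>p. g (G a p)) ` E"
        using w p hom by (intro image_eqI[of _ _ p]) (auto simp: homeomorphism_def)
      ultimately obtain e where e: "e > 0" "ball w e \<subseteq> (\<lambda>p. g (G a p)) ` E"
        unfolding open_contains_ball by blast
      have "(\<lambda>p. g (G a p)) ` E \<subseteq> D" using hom by (auto simp: E_def homeomorphism_def)
      also have "D \<subseteq> half_plane" using D(1) openin_imp_subset by blast
      finally have "ball w e \<subseteq> half_plane" using e(2) by blast
      moreover have "w - (e/2) *\<^sub>R axis 2 1 \<in> ball w e" using e(1) by (simp add: dist_norm)
      ultimately have "w - (e/2) *\<^sub>R axis 2 1 \<in> half_plane" by (rule subsetD)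
      then have "0 \<le> (w - (e/2) *\<^sub>R axis 2 1) $ 2" by (simp add: half_plane_def)
      then show False using w(2) e(1) by (simp add: axis_def)
    qed
    then show "X \<in> G a ` {p \<in> Dom. \<bar>p$2\<bar> = 1}" using p by blast
  qed
qed

lemma surface_interior_surf:
  assumes a: "a \<in> A" shows "surface_interior (surf a) = G a ` {p. p$1 \<in> J \<and> \<bar>p$2\<bar> < 1}"
proof -
  have "inj_on (G a) Dom" using Ginv_G[OF a] by (metis inj_on_inverseI)
  then have "surface_interior (surf a) = G a ` (Dom - {p \<in> Dom. \<bar>p$2\<bar> = 1})"
    unfolding surface_interior_def surface_boundary_surf[OF a] unfolding surf_def
    by (intro inj_on_image_set_diff[symmetric, of _ Dom]) auto
  also have "Dom - {p \<in> Dom. \<bar>p$2\<bar> = 1} = {p. p$1 \<in> J \<and> \<bar>p$2\<bar> < 1}" by (auto simp: Dom_def)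
  finally show ?thesis .
qed

lemma strip_homeomorphic_ball:
  assumes "J homeomorphic (UNIV :: real set)"
  shows "{p::real^2. p$1 \<in> J \<and> \<bar>p$2\<bar> < 1} homeomorphic (ball 0 1 :: (real^2) set)"
proof -
  obtain f g where 1: "homeomorphism J (UNIV::real set) f g"
    using assms by (auto simp: homeomorphic_def)
  have "ball (0::real) 1 homeomorphic (UNIV :: real set)" by (rule homeomorphic_ball01_UNIV)
  then obtain f' g' where 2: "homeomorphism (ball (0::real) 1) (UNIV::real set) f' g'"
    by (auto simp: homeomorphic_def)
  let ?S = "{p::real^2. p$1 \<in> J \<and> \<bar>p$2\<bar> < 1}"
  have "homeomorphism ?S (UNIV :: (real^2) set) (\<lambda>p. vec2 (f (p$1)) (f' (p$2))) (\<lambda>q. vec2 (g (q$1)) (g' (q$2)))"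
  proof (rule homeomorphismI)
    have c: "continuous_on J f" "continuous_on (ball 0 1) f'" "continuous_on UNIV g" "continuous_on UNIV g'"
      using 1 2 by (auto simp: homeomorphism_def)
    show "continuous_on ?S (\<lambda>p. vec2 (f (p$1)) (f' (p$2)))"
      by (intro continuous_on_vec2 continuous_on_compose2[OF c(1)] continuous_on_compose2[OF c(2)])
        (auto intro!: continuous_intros)
    show "continuous_on UNIV (\<lambda>q::real^2. vec2 (g (q$1)) (g' (q$2)))"
      by (intro continuous_on_vec2 continuous_on_compose2[OF c(3)] continuous_on_compose2[OF c(4)])
        (auto intro!: continuous_intros)
    have "g x \<in> J" "\<bar>g' x\<bar> < 1" for x
      using 1 2 by (auto simp: homeomorphism_def)
    then show "(\<lambda>q::real^2. vec2 (g (q$1)) (g' (q$2))) ` UNIV \<subseteq> ?S" by auto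
  qed (use 1 2 in \<open>auto simp: homeomorphism_def vec_eq_iff forall_2\<close>)
  then have "?S homeomorphic (UNIV :: (real^2) set)" by (auto simp: homeomorphic_def)
  then show ?thesis using homeomorphic_ball01_UNIV homeomorphic_sym homeomorphic_trans by blast
qed

lemma embedded_disk_surf:
  assumes a: "a \<in> A" and J': "J homeomorphic (UNIV :: real set)"
  shows "embedded_disk (surf a)"
  unfolding embedded_disk_def
proof (intro conjI embedded_surface_surf a)
  have "convex Dom"
  proof -
    have "Dom = (\<lambda>p. p$1) -` J \<inter> (\<lambda>p. p$2) -` {-1..1}" by (auto simp: Dom_def)
    moreover have "linear (\<lambda>p::real^2. p$i)" for i
      by (simp add: bounded_linear.linear bounded_linear_vec_nth)
    ultimately show ?thesis using J(2) by (auto intro!: convex_Int convex_linear_vimage)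
  qed
  then have "simply_connected Dom" by (rule convex_imp_simply_connected)
  then show "simply_connected (surf a)"
    using homeomorphism_G[OF a] homeomorphic_simply_connected by (auto simp: homeomorphic_def)
  let ?S = "{p::real^2. p$1 \<in> J \<and> \<bar>p$2\<bar> < 1}"
  have "homeomorphism ?S (G a ` ?S) (G a) (Ginv a)"
    by (rule homeomorphism_of_subsets[OF homeomorphism_G[OF a]]) (auto simp: Dom_def surf_def)
  then have "?S homeomorphic (G a ` ?S)" by (auto simp: homeomorphic_def)
  then show "surface_interior (surf a) homeomorphic (ball 0 1 :: (real^2) set)"
    unfolding surface_interior_surf[OF a]
    using strip_homeomorphic_ball[OF J'] homeomorphic_sym homeomorphic_trans by blast
qed

lemma curvature_surf:
  assumes a: "a \<in> A"
  shows "minimal_surface (surf a)"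
    and "(a, q) \<in> tube \<Longrightarrow> F a q \<in> surf a \<Longrightarrow>
      norm_A_sq (surf a) (F a q) = 2 * ((hx a q)\<^sup>2 + (hy a q)\<^sup>2) / (cosh (v a q))^4"
proof -
  obtain nx ny where "isothermal_patch {q. (a, q) \<in> tube} (F a) (Fx a) (Fy a) (nrm a) nx ny
    (\<lambda>q. (cosh (v a q))\<^sup>2) (hy a) (hx a)"
    using isothermal_patch_F[OF a] by blast
  then interpret P: isothermal_patch "{q. (a, q) \<in> tube}" "F a" "Fx a" "Fy a" "nrm a" nx ny
    "\<lambda>q. (cosh (v a q))\<^sup>2" "hy a" "hx a" .
  have c: "continuous_on (surf a) (Finv a)"
    unfolding Finv_def by (intro continuous_intros continuous_on_yof a)
  note K = P.surface_curvature[OF embedded_surface_surf[OF a] c]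
  show "minimal_surface (surf a)" using K(1) F_Finv[OF a] by simp
  show "norm_A_sq (surf a) (F a q) = 2 * ((hx a q)\<^sup>2 + (hy a q)\<^sup>2) / (cosh (v a q))^4"
    if "(a, q) \<in> tube" "F a q \<in> surf a"
    using K(2)[OF _ _ that(2)] F_Finv[OF a] Finv_F[OF that(1)] by (simp add: add.commute)
qed

text \<open>Over a compact interval of heights the surface is compact, so limit points can only be missing
  at the ends of \<open>J\<close>.\<close>

lemma closure_surf:
  assumes a: "a \<in> A" and X: "X \<in> closure (surf a)" "X$3 \<in> J"
  shows "X \<in> surf a"
proof -
  obtain e where e: "e > 0" "cball (X$3) e \<subseteq> J" using J(1) X(2) open_contains_cball by blast
  define K where "K = {p::real^2. p$1 \<in> cball (X$3) e \<and> \<bar>p$2\<bar> \<le> 1}"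
  have Kc: "K = cbox (vec2 (X$3 - e) (-1)) (vec2 (X$3 + e) 1)"
    by (auto simp: K_def mem_box_cart forall_2 dist_real_def abs_le_iff)
  have KD: "K \<subseteq> Dom" using e by (auto simp: K_def Dom_def)
  then have "compact (G a ` K)"
    unfolding Kc by (intro compact_continuous_image continuous_on_subset[OF continuous_on_G[OF a]] compact_cbox)
  then have cl: "closed (G a ` K)" by (rule compact_imp_closed)
  let ?U = "{X'::real^3. \<bar>X'$3 - X$3\<bar> < e}"
  have "open ?U" by (intro open_Collect_less continuous_intros)
  then have "?U \<inter> closure (surf a) \<subseteq> closure (?U \<inter> surf a)" by (rule open_Int_closure_subset)
  also have "\<dots> \<subseteq> G a ` K"
  proof (rule closure_minimal[OF _ cl])
    show "?U \<inter> surf a \<subseteq> G a ` K"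
      by (auto simp: surf_def Dom_def G_def K_def dist_real_def intro!: imageI)
  qed
  finally have "X \<in> G a ` K" using X e by auto
  then show ?thesis using KD by (auto simp: surf_def)
qed

lemma properly_embedded_surf:
  assumes a: "a \<in> A" and JU: "J = UNIV"
  shows "properly_embedded_disk (surf a)"
  unfolding properly_embedded_disk_def
proof (intro conjI)
  show "embedded_disk (surf a)"
    by (rule embedded_disk_surf[OF a]) (simp add: JU homeomorphic_refl)
  show sub: "surf a \<subseteq> solid_cylinder"
    using Q_G(1)[OF a] by (auto simp: surf_def solid_cylinder_def)
  show "surface_boundary (surf a) \<subseteq> {x. (x$1)\<^sup>2 + (x$2)\<^sup>2 = 1}"
    unfolding surface_boundary_surf[OF a] using Q_G(2)[OF a] by auto
  show "surface_interior (surf a) \<subseteq> {x. (x$1)\<^sup>2 + (x$2)\<^sup>2 < 1}"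
    unfolding surface_interior_surf[OF a]
  proof
    fix X assume "X \<in> G a ` {p. p$1 \<in> J \<and> \<bar>p$2\<bar> < 1}"
    then obtain p where "X = G a p" "p \<in> Dom" "\<bar>p$2\<bar> < 1" by (auto simp: Dom_def)
    then show "X \<in> {x. (x$1)\<^sup>2 + (x$2)\<^sup>2 < 1}" using Q_G[OF a \<open>p \<in> Dom\<close>] by auto
  qed
  have "closed (surf a)"
    using closure_surf[OF a] JU by (metis UNIV_I closure_subset closure_eq subsetI subset_antisym)
  then have cl: "closedin (top_of_set solid_cylinder) (surf a)" using sub by (simp add: closed_subset)
  have "proper_map (subtopology (top_of_set solid_cylinder) (surf a)) (top_of_set solid_cylinder) id"
    using cl sub by (subst proper_map_inclusion) (auto simp: closed_Int_compactin)
  moreover have "subtopology (top_of_set solid_cylinder) (surf a) = top_of_set (surf a)"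
    using sub by (simp add: subtopology_subtopology inf.absorb2)
  ultimately show "proper_map (top_of_set (surf a)) (top_of_set solid_cylinder) (\<lambda>x. x)"
    by (simp add: id_def)
qed

lemma axis_in_surf: "a \<in> A \<Longrightarrow> x \<in> J \<Longrightarrow> vector [0, 0, x] \<in> surf a"
proof -
  assume "a \<in> A" "x \<in> J"
  then have "G a (vec2 x 0) = vector [0, 0, x]" "vec2 x 0 \<in> Dom"
    by (simp_all add: G_def F_def Dom_def)
  then show ?thesis by (metis imageI surf_def)
qed

end

lemma strict_mono_on_convex_DERIV:
  fixes f :: "real \<Rightarrow> real"
  assumes "convex J" "x \<in> J" "y \<in> J" "x < y"
    and "\<And>t. t \<in> J \<Longrightarrow> \<exists>D. (f has_real_derivative D) (at t) \<and> 0 < D"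
  shows "f x < f y"
proof (rule DERIV_pos_imp_increasing[OF assms(4)])
  fix t assume "x \<le> t" "t \<le> y"
  then have "t \<in> J"
    using assms(1-3) by (metis (no_types) connected_iff_interval convex_connected)
  then show "\<exists>D. (f has_real_derivative D) (at t) \<and> 0 < D" by (rule assms(5))
qed

context helicoidal_family
begin

section \<open>Polar coordinates and multi-valued graphs\<close>

text \<open>At distance \<open>\<rho>\<close> from the axis, the components of the slice parallel and orthogonal to its velocity
  at the axis. The first is positive, so that \<open>theta\<close> is a continuous branch of the polar angle within
  \<open>pi / 2\<close> of the direction \<open>u - pi / 2\<close> of that velocity.\<close>

definition radial where
  "radial a x \<rho> = W1 a (vec2 x (eta a x \<rho>)) * sin (u a (vec2 x 0)) - W2 a (vec2 x (eta a x \<rho>)) * cos (u a (vec2 x 0))"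
definition angular where
  "angular a x \<rho> = W1 a (vec2 x (eta a x \<rho>)) * cos (u a (vec2 x 0)) + W2 a (vec2 x (eta a x \<rho>)) * sin (u a (vec2 x 0))"
definition theta where
  "theta a x \<rho> = u a (vec2 x 0) - pi/2 + arctan (angular a x \<rho> / radial a x \<rho>)"

context
  fixes a x \<rho> :: real assumes a: "a \<in> A" and x: "x \<in> J" and \<rho>: "0 < \<rho>" "\<rho> \<le> 1"
begin

lemma radial_pos: "0 < radial a x \<rho>"
proof -
  note e = eta[OF a x \<rho>]
  have "0 < slice_p a x (eta a x \<rho>)"
    using slice_p_strict_mono[OF a x, of 0 "eta a x \<rho>"] e slice_p_0[OF a x] by simp
  then show ?thesis by (simp add: radial_def slice_p_def[OF a x])
qed

lemma polar_coordinates: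
  "W1 a (vec2 x (eta a x \<rho>)) = \<rho> * cos (theta a x \<rho>)"
  "W2 a (vec2 x (eta a x \<rho>)) = \<rho> * sin (theta a x \<rho>)"
proof -
  define w1 w2 where "w1 = W1 a (vec2 x (eta a x \<rho>))" and "w2 = W2 a (vec2 x (eta a x \<rho>))"
  define t \<phi> where "t = u a (vec2 x 0)" and "\<phi> = arctan (angular a x \<rho> / radial a x \<rho>)"
  have p: "radial a x \<rho> = w1 * sin t - w2 * cos t" and r: "angular a x \<rho> = w1 * cos t + w2 * sin t"
    by (simp_all add: radial_def angular_def w1_def w2_def t_def)
  have "w1\<^sup>2 + w2\<^sup>2 = \<rho>\<^sup>2" using eta(3)[OF a x \<rho>] by (simp add: Q_def w1_def w2_def)
  have sc: "sin t * sin t = 1 - cos t * cos t"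
    using sin_cos_squared_add[of t] by (simp add: power2_eq_square)
  have "(radial a x \<rho>)\<^sup>2 + (angular a x \<rho>)\<^sup>2 = (w1\<^sup>2 + w2\<^sup>2) * ((sin t)\<^sup>2 + (cos t)\<^sup>2)"
    unfolding p r by algebra
  then have n: "(radial a x \<rho>)\<^sup>2 + (angular a x \<rho>)\<^sup>2 = \<rho>\<^sup>2"
    using \<open>w1\<^sup>2 + w2\<^sup>2 = \<rho>\<^sup>2\<close> by simp
  have "1 + (angular a x \<rho> / radial a x \<rho>)\<^sup>2 = (\<rho> / radial a x \<rho>)\<^sup>2"
    using radial_pos n by (simp add: power_divide field_simps)
  then have s: "sqrt (1 + (angular a x \<rho> / radial a x \<rho>)\<^sup>2) = \<rho> / radial a x \<rho>"
    using radial_pos \<rho> by simp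
  have c: "\<rho> * cos \<phi> = w1 * sin t - w2 * cos t" "\<rho> * sin \<phi> = w1 * cos t + w2 * sin t"
    unfolding \<phi>_def cos_arctan sin_arctan s using radial_pos \<rho> p r by simp_all
  have th: "theta a x \<rho> = (t + \<phi>) - pi/2" by (simp add: theta_def t_def \<phi>_def)
  have "\<rho> * cos (theta a x \<rho>) = sin t * (\<rho> * cos \<phi>) + cos t * (\<rho> * sin \<phi>)"
    unfolding th cos_diff by (simp add: sin_add algebra_simps)
  also have "\<dots> = w1" unfolding c using sc by algebra
  finally show "W1 a (vec2 x (eta a x \<rho>)) = \<rho> * cos (theta a x \<rho>)" by (simp add: w1_def)
  have "\<rho> * sin (theta a x \<rho>) = - cos t * (\<rho> * cos \<phi>) + sin t * (\<rho> * sin \<phi>)"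
    unfolding th sin_diff by (simp add: cos_add algebra_simps)
  also have "\<dots> = w2" unfolding c using sc by algebra
  finally show "W2 a (vec2 x (eta a x \<rho>)) = \<rho> * sin (theta a x \<rho>)" by (simp add: w2_def)
qed

lemma theta_bounds: "u a (vec2 x 0) - pi < theta a x \<rho>" "theta a x \<rho> < u a (vec2 x 0)"
  using arctan_bounded[of "angular a x \<rho> / radial a x \<rho>"] by (auto simp: theta_def)

end

lemma W_along_level:
  assumes a: "a \<in> A" and x: "x \<in> J" and \<rho>: "0 < \<rho>" "\<rho> \<le> 1"
  defines "q \<equiv> vec2 x (eta a x \<rho>)"
  shows "((\<lambda>x. W1 a (vec2 x (eta a x \<rho>))) has_real_derivative
      cos (u a q) * sinh (v a q) + (- Qx a q / Qy a q) * (sin (u a q) * cosh (v a q))) (at x)"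
    and "((\<lambda>x. W2 a (vec2 x (eta a x \<rho>))) has_real_derivative
      sin (u a q) * sinh (v a q) + (- Qx a q / Qy a q) * (- (cos (u a q) * cosh (v a q)))) (at x)"
proof -
  have q: "(a, vec2 x (eta a x \<rho>)) \<in> tube" using eta[OF a x \<rho>] a x by (simp add: tube_iff)
  have "((\<lambda>x. vec2 x (eta a x \<rho>)) has_derivative (\<lambda>d. vec2 d ((- Qx a q / Qy a q) * d))) (at x)"
    using eta'[OF a x \<rho>] unfolding has_field_derivative_def q_def by (intro derivative_intros)
  note D = has_derivative_compose[OF this W1'[OF q]] has_derivative_compose[OF this W2'[OF q]]
  show "((\<lambda>x. W1 a (vec2 x (eta a x \<rho>))) has_real_derivative
      cos (u a q) * sinh (v a q) + (- Qx a q / Qy a q) * (sin (u a q) * cosh (v a q))) (at x)"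
    unfolding has_field_derivative_def
    by (rule has_derivative_eq_rhs[OF D(1)]) (auto simp: q_def algebra_simps)
  show "((\<lambda>x. W2 a (vec2 x (eta a x \<rho>))) has_real_derivative
      sin (u a q) * sinh (v a q) + (- Qx a q / Qy a q) * (- (cos (u a q) * cosh (v a q)))) (at x)"
    unfolding has_field_derivative_def
    by (rule has_derivative_eq_rhs[OF D(2)]) (auto simp: q_def algebra_simps)
qed

text \<open>Along the curve \<open>\<rho> = const\<close> the derivative of the angle is, up to a positive factor, the negative of
  the Jacobian of \<open>(W1, W2)\<close>, that is \<open>sinh v cosh v\<close>, and \<open>v\<close> is positive on this half of the surface.\<close>

lemma theta_derivative:
  assumes a: "a \<in> A" and x: "x \<in> J" and \<rho>: "0 < \<rho>" "\<rho> \<le> 1"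
  shows "\<exists>D. ((\<lambda>x. theta a x \<rho>) has_real_derivative D) (at x) \<and> 0 < D"
proof -
  define q where "q = vec2 x (eta a x \<rho>)"
  define m where "m = - Qx a q / Qy a q"
  let ?s1 = "cos (u a q) * sinh (v a q)" and ?c1 = "sin (u a q) * cosh (v a q)"
  let ?s2 = "sin (u a q) * sinh (v a q)" and ?c2 = "- (cos (u a q) * cosh (v a q))"
  note e = eta[OF a x \<rho>]
  have W: "((\<lambda>x. W1 a (vec2 x (eta a x \<rho>))) has_real_derivative ?s1 + m * ?c1) (at x)"
    "((\<lambda>x. W2 a (vec2 x (eta a x \<rho>))) has_real_derivative ?s2 + m * ?c2) (at x)"
    unfolding m_def q_def by (rule W_along_level[OF a x \<rho>])+
  have "(a, vec2 x 0) \<in> tube" using height_pos[OF radius[OF a x]] a x by (simp add: tube_iff)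
  note U = has_real_derivative_partials(2)[OF u'[OF this]]
  have p0: "W1 a (vec2 x (eta a x \<rho>)) * sin (u a (vec2 x 0)) - W2 a (vec2 x (eta a x \<rho>)) * cos (u a (vec2 x 0)) \<noteq> 0"
    using radial_pos[OF a x \<rho>] by (simp add: radial_def)
  have "\<exists>D. ((\<lambda>x. theta a x \<rho>) has_real_derivative D) (at x)"
    unfolding theta_def radial_def angular_def
    by (rule exI) (rule derivative_intros DERIV_chain2[OF DERIV_arctan] W U p0
        DERIV_chain2[OF DERIV_sin] DERIV_chain2[OF DERIV_cos])+
  then obtain D where D: "((\<lambda>x. theta a x \<rho>) has_real_derivative D) (at x)" by blast
  have ev: "\<forall>\<^sub>F z in nhds x. z \<in> J" using J(1) x by (simp add: eventually_nhds_in_open)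
  \<comment> \<open>the derivative of the angle is found by comparing the two expressions for that of \<open>(W1, W2)\<close>\<close>
  have D1: "((\<lambda>x. \<rho> * cos (theta a x \<rho>)) has_real_derivative \<rho> * (- sin (theta a x \<rho>) * D)) (at x)"
    by (rule DERIV_cmult[OF DERIV_chain2[OF DERIV_cos D]])
  have ev1: "\<forall>\<^sub>F z in nhds x. W1 a (vec2 z (eta a z \<rho>)) = \<rho> * cos (theta a z \<rho>)"
    using ev by eventually_elim (rule polar_coordinates[OF a _ \<rho>])
  have 1: "\<rho> * (- sin (theta a x \<rho>) * D) = ?s1 + m * ?c1"
    by (rule DERIV_unique[OF D1 DERIV_cong_ev[OF refl ev1 refl, THEN iffD1, OF W(1)]])
  have D2: "((\<lambda>x. \<rho> * sin (theta a x \<rho>)) has_real_derivative \<rho> * (cos (theta a x \<rho>) * D)) (at x)"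
    by (rule DERIV_cmult[OF DERIV_chain2[OF DERIV_sin D]])
  have ev2: "\<forall>\<^sub>F z in nhds x. W2 a (vec2 z (eta a z \<rho>)) = \<rho> * sin (theta a z \<rho>)"
    using ev by eventually_elim (rule polar_coordinates[OF a _ \<rho>])
  have 2: "\<rho> * (cos (theta a x \<rho>) * D) = ?s2 + m * ?c2"
    by (rule DERIV_unique[OF D2 DERIV_cong_ev[OF refl ev2 refl, THEN iffD1, OF W(2)]])
  define w1 w2 where "w1 = \<rho> * cos (theta a x \<rho>)" and "w2 = \<rho> * sin (theta a x \<rho>)"
  have w: "W1 a q = w1" "W2 a q = w2"
    using polar_coordinates[OF a x \<rho>] by (simp_all add: q_def w1_def w2_def)
  have qy: "0 < Qy a q" using Qy_pos[OF a x e(1,2)] by (simp add: q_def)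
  have m: "m * Qy a q = - Qx a q" using qy by (simp add: m_def)
  have "\<rho>\<^sup>2 * D * Qy a q = (w1 * (\<rho> * (cos (theta a x \<rho>) * D)) - w2 * (\<rho> * (- sin (theta a x \<rho>) * D))) * Qy a q"
    using sin_cos_squared_add[of "theta a x \<rho>"] unfolding w1_def w2_def power2_eq_square by algebra
  also have "\<dots> = (w1 * ?s2 - w2 * ?s1) * Qy a q + (w1 * ?c2 - w2 * ?c1) * (m * Qy a q)"
    unfolding 1 2 by (simp add: algebra_simps)
  also have "\<dots> = 2 * (w1\<^sup>2 + w2\<^sup>2) * (((sin (u a q))\<^sup>2 + (cos (u a q))\<^sup>2) * sinh (v a q) * cosh (v a q))"
    unfolding m unfolding Qx_def Qy_def w by algebra
  also have "\<dots> = 2 * \<rho>\<^sup>2 * (sinh (v a q) * cosh (v a q))"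
  proof -
    have "w1\<^sup>2 + w2\<^sup>2 = \<rho>\<^sup>2" using e(3) w by (simp add: Q_def q_def)
    then show ?thesis by simp
  qed
  finally have "\<rho>\<^sup>2 * (D * Qy a q) = \<rho>\<^sup>2 * (2 * (sinh (v a q) * cosh (v a q)))"
    by (simp add: algebra_simps)
  then have "D * Qy a q = 2 * (sinh (v a q) * cosh (v a q))" using \<rho> by simp
  moreover have "0 < sinh (v a q)" using v_pos[OF a x e(1,2)] by (simp add: q_def)
  then have "0 < 2 * (sinh (v a q) * cosh (v a q))" using cosh_real_pos by simp
  ultimately have "0 < D * Qy a q" by (simp only:)
  then have "0 < D" using qy by (rule zero_less_mult_pos2)
  with D show ?thesis by blast
qed

lemma theta_strict_mono:
  assumes "a \<in> A" "0 < \<rho>" "\<rho> \<le> 1" "x \<in> J" "y \<in> J" "x < y"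
  shows "theta a x \<rho> < theta a y \<rho>"
  by (rule strict_mono_on_convex_DERIV[OF J(2) assms(4-6)]) (rule theta_derivative[OF assms(1) _ assms(2,3)])

lemma continuous_on_theta:
  assumes a: "a \<in> A"
  shows "continuous_on (J \<times> {0<..1}) (\<lambda>(x, \<rho>). theta a x \<rho>)"
proof -
  have e: "continuous_on (J \<times> {0<..1}) (\<lambda>z. eta a (fst z) (snd z))"
  proof -
    have "continuous_on (J \<times> {0<..1}) (\<lambda>z. (\<lambda>(a, x, \<rho>). eta a x \<rho>) (a, fst z, snd z))"
      by (rule continuous_on_compose2[OF continuous_on_eta]) (use a in \<open>auto intro!: continuous_intros\<close>)
    then show ?thesis by (simp add: case_prod_unfold)
  qed
  have w: "continuous_on (J \<times> {0<..1}) (\<lambda>z. f a (vec2 (fst z) (eta a (fst z) (snd z))))"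
    if "Ck_family 0 f tube" for f
  proof -
    have "continuous_on (J \<times> {0<..1}) (\<lambda>z. (\<lambda>(a, p). f a p) (a, vec2 (fst z) (eta a (fst z) (snd z))))"
      by (rule continuous_on_compose2[OF Ck_family_continuous[OF that]])
        (use a eta in \<open>auto intro!: continuous_intros e simp: tube_iff abs_of_pos\<close>)
    then show ?thesis by simp
  qed
  have u0: "continuous_on (J \<times> {0<..1::real}) (\<lambda>z. u a (vec2 (fst z) 0))"
    by (rule continuous_on_compose2[OF continuous_on_uaxis[OF a]]) (auto intro!: continuous_intros)
  have "continuous_on (J \<times> {0<..1}) (\<lambda>z. theta a (fst z) (snd z))"
    unfolding theta_def
  proof (intro continuous_intros u0)
    show "continuous_on (J \<times> {0<..1}) (\<lambda>z. angular a (fst z) (snd z))"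
      "continuous_on (J \<times> {0<..1}) (\<lambda>z. radial a (fst z) (snd z))"
      unfolding angular_def radial_def by (intro continuous_intros u0 w Ck_W)+
    show "\<forall>z\<in>J \<times> {0<..1}. radial a (fst z) (snd z) \<noteq> 0"
      using radial_pos[OF a] by force
  qed
  then show ?thesis by (simp add: case_prod_unfold)
qed

text \<open>The parameter \<open>s\<close> is \<open>0\<close> for one half of the surface and \<open>pi\<close> for the opposite one.\<close>

definition sheet :: "real \<Rightarrow> real \<Rightarrow> (real \<times> real) set" where
  "sheet a s = {(\<rho>, \<theta>). 0 < \<rho> \<and> \<rho> \<le> 1 \<and> (\<exists>x\<in>J. theta a x \<rho> + s = \<theta>)}"

definition level where
  "level a s z = (THE x. x \<in> J \<and> theta a x (fst z) + s = snd z)"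

lemma level_eq:
  assumes "a \<in> A" "x \<in> J" "0 < \<rho>" "\<rho> \<le> 1"
  shows "level a s (\<rho>, theta a x \<rho> + s) = x"
  unfolding level_def
proof (rule the_equality)
  fix y assume "y \<in> J \<and> theta a y (fst (\<rho>, theta a x \<rho> + s)) + s = snd (\<rho>, theta a x \<rho> + s)"
  then show "y = x"
    using theta_strict_mono[OF assms(1,3,4), of x y] theta_strict_mono[OF assms(1,3,4), of y x] assms(2)
    by (cases x y rule: linorder_cases) auto
qed (use assms in auto)

lemma level:
  assumes "a \<in> A" "(\<rho>, \<theta>) \<in> sheet a s"
  shows "level a s (\<rho>, \<theta>) \<in> J" "theta a (level a s (\<rho>, \<theta>)) \<rho> + s = \<theta>" "0 < \<rho>" "\<rho> \<le> 1"
  using assms level_eq by (auto simp: sheet_def)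

lemma continuous_on_theta_rho:
  assumes "a \<in> A" "x \<in> J" shows "continuous_on {0<..1} (\<lambda>\<rho>. theta a x \<rho>)"
proof -
  have "continuous_on {0<..1} (\<lambda>\<rho>. (\<lambda>(x, \<rho>). theta a x \<rho>) (x, \<rho>))"
    by (rule continuous_on_compose2[OF continuous_on_theta[OF assms(1)]])
      (use assms in \<open>auto intro!: continuous_intros\<close>)
  then show ?thesis by simp
qed

lemma continuous_on_level:
  assumes a: "a \<in> A" shows "continuous_on (sheet a s) (level a s)"
proof (rule continuous_on_implicit[where I="\<lambda>_. J" and f="\<lambda>z x. theta a x (fst z) + s - snd z"])
  fix z x assume z: "z \<in> sheet a s" and x: "x \<in> J"
  have r: "fst z' \<in> {0<..1}" if "z' \<in> sheet a s" for z' using that by (auto simp: sheet_def)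
  have "\<forall>\<^sub>F z' in at z within sheet a s. fst z' \<in> {0<..1}"
    using r by (simp add: eventually_at_filter)
  from continuous_on_tendsto_compose[OF continuous_on_theta_rho[OF a x] tendsto_fst[OF tendsto_ident_at] r[OF z] this]
  show "((\<lambda>z'. theta a x (fst z') + s - snd z') \<longlongrightarrow> theta a x (fst z) + s - snd z) (at z within sheet a s)"
    by (intro tendsto_intros tendsto_snd[OF tendsto_ident_at])
next
  fix z assume z: "z \<in> sheet a s"
  obtain \<rho> \<theta> where zz: "z = (\<rho>, \<theta>)" by (cases z)
  note l = level[OF a z[unfolded zz]]
  show "level a s z \<in> J" "theta a (level a s z) (fst z) + s - snd z = 0"
    using l(1,2) by (simp_all add: zz)
  fix x y assume "x \<in> J" "y \<in> J" "x < y"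
  from theta_strict_mono[OF a l(3,4) this]
  show "theta a x (fst z) + s - snd z < theta a y (fst z) + s - snd z" by (simp add: zz)
qed (use J in auto)

lemma sheet_between:
  assumes a: "a \<in> A" and \<rho>: "0 < \<rho>" "\<rho> \<le> 1" and "x1 \<in> J" "x2 \<in> J"
    and "theta a x1 \<rho> + s \<le> \<theta>" "\<theta> \<le> theta a x2 \<rho> + s"
  shows "(\<rho>, \<theta>) \<in> sheet a s"
proof -
  have "continuous_on J (\<lambda>x. (\<lambda>(x, \<rho>). theta a x \<rho>) (x, \<rho>))"
    by (rule continuous_on_compose2[OF continuous_on_theta[OF a]])
      (use \<rho> in \<open>auto intro!: continuous_intros\<close>)
  then have "connected ((\<lambda>x. theta a x \<rho> + s) ` J)"
    by (intro connected_continuous_image convex_connected J continuous_intros) simp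
  then have "\<theta> \<in> (\<lambda>x. theta a x \<rho> + s) ` J"
    using assms(4-7) unfolding connected_iff_interval by blast
  then show ?thesis using \<rho> by (auto simp: sheet_def)
qed

lemma open_sheet_interior:
  assumes a: "a \<in> A" shows "open (sheet a s \<inter> {..<1} \<times> UNIV)"
proof (subst open_subopen, intro ballI)
  fix z assume z: "z \<in> sheet a s \<inter> {..<1} \<times> UNIV"
  obtain \<rho> \<theta> where zz: "z = (\<rho>, \<theta>)" by (cases z)
  then have \<rho>: "0 < \<rho>" "\<rho> < 1" and "\<exists>x\<in>J. theta a x \<rho> + s = \<theta>"
    using z by (auto simp: sheet_def)
  then obtain x where x: "x \<in> J" "theta a x \<rho> + s = \<theta>" by blast
  obtain e where e: "e > 0" "cball x e \<subseteq> J" using J(1) x(1) open_contains_cball by blast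
  then have xe: "x - e \<in> J" "x + e \<in> J" by (auto simp: subset_iff dist_real_def)
  let ?R = "{0<..<1::real} \<times> (UNIV::real set)"
  let ?f = "\<lambda>z. min (snd z - (theta a (x - e) (fst z) + s)) (theta a (x + e) (fst z) + s - snd z)"
  have c: "continuous_on ?R (\<lambda>z. theta a y (fst z))" if "y \<in> J" for y
    by (rule continuous_on_compose2[OF continuous_on_theta_rho[OF a that]]) (auto intro!: continuous_intros)
  have "continuous_on ?R ?f" by (intro continuous_intros c xe)
  then have "open (?R \<inter> ?f -` {0<..})"
    by (intro continuous_open_preimage open_Times) auto
  moreover have "z \<in> ?R \<inter> ?f -` {0<..}"
    using \<rho> x e theta_strict_mono[OF a, of \<rho> "x - e" x] theta_strict_mono[OF a, of \<rho> x "x + e"] xe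
    by (simp add: zz)
  moreover have "?R \<inter> ?f -` {0<..} \<subseteq> sheet a s \<inter> {..<1} \<times> UNIV"
  proof
    fix w assume "w \<in> ?R \<inter> ?f -` {0<..}"
    then have w: "0 < fst w" "fst w < 1" "theta a (x - e) (fst w) + s < snd w"
      "snd w < theta a (x + e) (fst w) + s" by auto
    then have "(fst w, snd w) \<in> sheet a s"
      by (intro sheet_between[OF a _ _ xe]) auto
    then show "w \<in> sheet a s \<inter> {..<1} \<times> UNIV" using w by (cases w) auto
  qed
  ultimately show "\<exists>T. open T \<and> z \<in> T \<and> T \<subseteq> sheet a s \<inter> {..<1} \<times> UNIV" by blast
qed

lemma interior_sheet:
  assumes a: "a \<in> A" shows "interior (sheet a s) = sheet a s \<inter> {..<1} \<times> UNIV"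
proof
  show "sheet a s \<inter> {..<1} \<times> UNIV \<subseteq> interior (sheet a s)"
    by (rule interior_maximal[OF _ open_sheet_interior[OF a]]) auto
  have "sheet a s \<subseteq> {..1} \<times> UNIV" by (auto simp: sheet_def)
  then have "interior (sheet a s) \<subseteq> interior ({..1} \<times> UNIV)" by (rule interior_mono)
  then show "interior (sheet a s) \<subseteq> sheet a s \<inter> {..<1} \<times> UNIV"
    using interior_subset[of "sheet a s"] by (auto simp: interior_Times)
qed

lemma region_sheet:
  assumes a: "a \<in> A" shows "region (sheet a s)"
  unfolding region_def interior_sheet[OF a]
proof (intro conjI)
  let ?U = "sheet a s \<inter> {..<1} \<times> UNIV"
  let ?f = "\<lambda>z. (snd z, theta a (fst z) (snd z) + s)"
  obtain x where x: "x \<in> J" using J(3) by blast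
  then have "(1/2, theta a x (1/2) + s) \<in> sheet a s" by (auto simp: sheet_def)
  then show "sheet a s \<noteq> {}" by blast
  have c: "continuous_on (J \<times> {0<..1}) ?f"
    using continuous_on_theta[OF a] by (auto simp: case_prod_unfold intro!: continuous_intros)
  have "?U = ?f ` (J \<times> {0<..<1})"
    by (auto simp: sheet_def image_iff)
  also have "connected \<dots>"
    by (intro connected_continuous_image continuous_on_subset[OF c] connected_Times convex_connected J)
      auto
  finally show "connected ?U" .
  show "sheet a s \<subseteq> closure ?U"
  proof
    fix z assume z: "z \<in> sheet a s"
    obtain \<rho> \<theta> where zz: "z = (\<rho>, \<theta>)" by (cases z)
    show "z \<in> closure ?U"
    proof (cases "\<rho> < 1")
      case True
      then show ?thesis using z zz closure_subset by fastforce
    next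
      case False
      with z zz obtain x where x: "x \<in> J" "z = (1, theta a x 1 + s)" by (auto simp: sheet_def)
      \<comment> \<open>bounded away from \<open>\<rho> = 0\<close>, where the angle has no meaning\<close>
      have "continuous_on {1/2..1} (\<lambda>\<rho>. (\<rho>, theta a x \<rho> + s))"
        by (intro continuous_intros continuous_on_subset[OF continuous_on_theta_rho[OF a x(1)]]) auto
      then have "continuous_on (closure {1/2<..<1}) (\<lambda>\<rho>. (\<rho>, theta a x \<rho> + s))" by simp
      moreover have "(\<lambda>\<rho>. (\<rho>, theta a x \<rho> + s)) ` {1/2<..<1} \<subseteq> closure ?U"
        using x(1) by (intro order_trans[OF _ closure_subset]) (auto simp: sheet_def)
      ultimately have "(\<lambda>\<rho>. (\<rho>, theta a x \<rho> + s)) ` closure {1/2<..<1} \<subseteq> closure ?U"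
        by (intro image_closure_subset) auto
      then show ?thesis using x(2) by (auto simp: image_subset_iff)
    qed
  qed
qed

definition half :: "real \<Rightarrow> real \<Rightarrow> (real^3) set" where
  "half \<tau> a = {X \<in> surf a. 0 < \<tau> * yof a X}"

lemma Q_pos: "(a, q) \<in> tube \<Longrightarrow> q$2 \<noteq> 0 \<Longrightarrow> 0 < Q a q"
proof -
  assume q: "(a, q) \<in> tube" "q$2 \<noteq> 0"
  then have J: "a \<in> A" "q$1 \<in> J" "\<bar>q$2\<bar> < height a (q$1)" by (auto simp: tube_def)
  have "0 < Q a (vec2 (q$1) \<bar>q$2\<bar>)" using Q_mono[OF J(1,2), of 0 "\<bar>q$2\<bar>"] J q(2) by simp
  then show "0 < Q a q" using Q_even[of a "q$1" "q$2"] q(1) by (auto simp: abs_if split: if_splits)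
qed

lemma surf_minus_axis:
  assumes a: "a \<in> A" shows "surf a - x3_axis = half 1 a \<union> half (-1) a"
proof (intro set_eqI iffI)
  fix X assume "X \<in> surf a - x3_axis"
  then have X: "X \<in> surf a" "X \<notin> x3_axis" by auto
  then obtain q where q: "(a, q) \<in> tube" "X = F a q" using surf_F[OF a] by blast
  have "q$2 \<noteq> 0"
  proof
    assume "q$2 = 0"
    then have "q = vec2 (q$1) 0" by (simp add: vec_eq_iff forall_2)
    then have "X = vector [0, 0, q$1]"
      using q by (metis F_def W_axis(1,2) tube_iff vec2_nth(1))
    then show False using X(2) by (auto simp: x3_axis_def)
  qed
  then show "X \<in> half 1 a \<union> half (-1) a"
    using X(1) yof_F[OF q(1)] q(2) by (auto simp: half_def)
next
  fix X assume "X \<in> half 1 a \<union> half (-1) a"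
  then have X: "X \<in> surf a" "yof a X \<noteq> 0" by (auto simp: half_def)
  then obtain q where q: "(a, q) \<in> tube" "X = F a q" using surf_F[OF a] by blast
  then have "0 < Q a q" using Q_pos X(2) yof_F by simp
  then have "X \<notin> x3_axis" using q(2) by (auto simp: Q_def x3_axis_def vector_3 dest: arg_cong[of _ _ "\<lambda>X. (X$1)\<^sup>2 + (X$2)\<^sup>2"])
  then show "X \<in> surf a - x3_axis" using X by simp
qed

lemma half_eq_sheet:
  assumes a: "a \<in> A" and \<tau>: "\<tau> = 1 \<and> s = 0 \<or> \<tau> = -1 \<and> s = pi"
  shows "half \<tau> a = {vector [\<rho> * cos \<theta>, \<rho> * sin \<theta>, level a s (\<rho>, \<theta>)] | \<rho> \<theta>. (\<rho>, \<theta>) \<in> sheet a s}"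
proof (intro set_eqI iffI)
  have F_polar: "F a (vec2 x (\<tau> * eta a x \<rho>)) = vector [\<rho> * cos (theta a x \<rho> + s), \<rho> * sin (theta a x \<rho> + s), x]"
    if "x \<in> J" "0 < \<rho>" "\<rho> \<le> 1" for x \<rho>
  proof -
    have "(a, vec2 x (eta a x \<rho>)) \<in> tube" using eta[OF a that] a that by (simp add: tube_iff)
    then show ?thesis using \<tau> W_odd polar_coordinates[OF a that] by (auto simp: F_def)
  qed
  fix X :: "real^3"
  {
    assume "X \<in> half \<tau> a"
    then have X: "X \<in> surf a" "0 < \<tau> * yof a X" by (auto simp: half_def)
    then obtain q where q: "(a, q) \<in> tube" "X = F a q" "Q a q \<le> 1" using surf_iff[OF a] by blast
    then have J: "q$1 \<in> J" "\<bar>q$2\<bar> < height a (q$1)" by (auto simp: tube_def)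
    have t: "0 < \<tau> * q$2" using X q yof_F by simp
    define \<rho> where "\<rho> = sqrt (Q a q)"
    have Q0: "0 < Q a q" using Q_pos[OF q(1)] t by (metis mult_zero_right less_irrefl)
    have \<rho>: "0 < \<rho>" "\<rho> \<le> 1" "\<rho>\<^sup>2 = Q a q" using Q0 q(3) by (simp_all add: \<rho>_def)
    have "Q a (vec2 (q$1) (\<tau> * q$2)) = \<rho>\<^sup>2" using \<tau> Q_even[of a "q$1" "q$2"] q(1) \<rho>(3) by auto
    then have "eta a (q$1) \<rho> = \<tau> * q$2" using \<tau> J t by (intro eta_unique a J) auto
    then have "vec2 (q$1) (\<tau> * eta a (q$1) \<rho>) = q" using \<tau> by (auto simp: vec_eq_iff forall_2)
    then have "X = vector [\<rho> * cos (theta a (q$1) \<rho> + s), \<rho> * sin (theta a (q$1) \<rho> + s), q$1]"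
      using F_polar[OF J(1) \<rho>(1,2)] q(2) by simp
    moreover have "(\<rho>, theta a (q$1) \<rho> + s) \<in> sheet a s" using J \<rho> by (auto simp: sheet_def)
    moreover have "level a s (\<rho>, theta a (q$1) \<rho> + s) = q$1" by (rule level_eq[OF a J(1) \<rho>(1,2)])
    ultimately show "X \<in> {vector [\<rho> * cos \<theta>, \<rho> * sin \<theta>, level a s (\<rho>, \<theta>)] | \<rho> \<theta>. (\<rho>, \<theta>) \<in> sheet a s}"
      by (intro CollectI exI[of _ \<rho>] exI[of _ "theta a (q$1) \<rho> + s"]) simp
  next
    assume "X \<in> {vector [\<rho> * cos \<theta>, \<rho> * sin \<theta>, level a s (\<rho>, \<theta>)] | \<rho> \<theta>. (\<rho>, \<theta>) \<in> sheet a s}"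
    then obtain \<rho> \<theta> where X: "X = vector [\<rho> * cos \<theta>, \<rho> * sin \<theta>, level a s (\<rho>, \<theta>)]" and z: "(\<rho>, \<theta>) \<in> sheet a s"
      by blast
    define x where "x = level a s (\<rho>, \<theta>)"
    have l: "x \<in> J" "theta a x \<rho> + s = \<theta>" "0 < \<rho>" "\<rho> \<le> 1" using level[OF a z] by (auto simp: x_def)
    note e = eta[OF a l(1,3,4)]
    have XF: "X = F a (vec2 x (\<tau> * eta a x \<rho>))" using F_polar[OF l(1,3,4)] l(2) X by (simp add: x_def)
    have d: "(a, vec2 x (\<tau> * eta a x \<rho>)) \<in> tube" using e a l \<tau> by (auto simp: tube_iff)
    have "Q a (vec2 x (\<tau> * eta a x \<rho>)) = \<rho>\<^sup>2"
      using \<tau> e Q_even[of a x "eta a x \<rho>"] a l by (auto simp: tube_iff)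
    then have "X \<in> surf a" using surf_iff[OF a] XF d l power_le_one[of \<rho> 2] by auto
    moreover have "0 < \<tau> * yof a X" using XF yof_F[OF d] \<tau> e by auto
    ultimately show "X \<in> half \<tau> a" by (simp add: half_def)
  }
qed

lemma embedded_surface_half:
  assumes a: "a \<in> A" shows "embedded_surface (half \<tau> a)"
proof (rule embedded_surface_open_subset[OF embedded_surface_surf[OF a]])
  have "continuous_on (surf a) (\<lambda>X. \<tau> * yof a X)" by (intro continuous_intros continuous_on_yof a)
  then have "openin (top_of_set (surf a)) (surf a \<inter> (\<lambda>X. \<tau> * yof a X) -` {0<..})"
    by (intro continuous_openin_preimage_gen) auto
  moreover have "surf a \<inter> (\<lambda>X. \<tau> * yof a X) -` {0<..} = half \<tau> a" by (auto simp: half_def)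
  ultimately show "openin (top_of_set (surf a)) (half \<tau> a)" by simp
qed

lemma multi_graph_half:
  assumes a: "a \<in> A" and \<tau>: "\<tau> = 1 \<and> s = 0 \<or> \<tau> = -1 \<and> s = pi"
  shows "multi_graph_of (sheet a s) (level a s) (half \<tau> a)"
  unfolding multi_graph_of_def
proof (intro conjI)
  show "sheet a s \<subseteq> polar_cover" by (auto simp: sheet_def polar_cover_def)
  show "half \<tau> a = {vector [\<rho> * cos \<theta>, \<rho> * sin \<theta>, level a s (\<rho>, \<theta>)] | \<rho> \<theta>. (\<rho>, \<theta>) \<in> sheet a s}"
    by (rule half_eq_sheet[OF a \<tau>])
qed (rule region_sheet[OF a] continuous_on_level[OF a] embedded_surface_half[OF a])+

lemma multi_valued_graphs:
  assumes a: "a \<in> A"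
  shows "\<exists>\<Sigma>1 \<Sigma>2. multi_valued_graph \<Sigma>1 \<and> multi_valued_graph \<Sigma>2 \<and> surf a - x3_axis = \<Sigma>1 \<union> \<Sigma>2"
proof (intro exI conjI)
  show "multi_valued_graph (half 1 a)"
    unfolding multi_valued_graph_def by (intro exI) (rule multi_graph_half[OF a, of 1 0], simp)
  show "multi_valued_graph (half (-1) a)"
    unfolding multi_valued_graph_def by (intro exI) (rule multi_graph_half[OF a, of "-1" pi], simp)
qed (rule surf_minus_axis[OF a])

section \<open>Curvature estimate\<close>

text \<open>If the height is at least \<open>\<delta> / 2\<close> in absolute value, then so is \<open>s\<close>, and \<open>\<bar>h'\<bar>\<close> is bounded. Otherwise
  the point has distance at least \<open>\<delta> / 2\<close> from the axis, which is reached at a parameter \<open>y \<le> s\<^sup>3\<^sup>/\<^sup>2\<close>. This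
  forces \<open>cosh v \<ge> \<delta> / (2 s\<^sup>3\<^sup>/\<^sup>2)\<close>, more than enough against \<open>\<bar>h'\<bar> \<le> 2 twist / s\<^sup>2\<close>.\<close>

lemma curvature_bound:
  assumes a: "a \<in> A" "\<bar>a\<bar> \<le> 1" and X: "X \<in> surf a" "\<delta> \<le> norm X" and \<delta>: "0 < \<delta>"
  shows "norm_A_sq (surf a) X \<le> 128 * twist\<^sup>2 * (\<delta>\<^sup>2 + 1) / \<delta>^4"
proof -
  obtain q where q: "(a, q) \<in> tube" "X = F a q" using surf_F[OF a(1) X(1)] .
  define x y where "x = q$1" and "y = \<bar>q$2\<bar>"
  have J: "x \<in> J" "0 \<le> y" "y < height a x" using q by (auto simp: tube_def x_def y_def)
  have yq: "vec2 x y = q \<or> vec2 x (- y) = q" by (auto simp: x_def y_def vec_eq_iff forall_2)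
  define s where "s = radius a x"
  have s: "0 < s" and s2: "s\<^sup>2 = x\<^sup>2 + a\<^sup>2" using radius[OF a(1) J(1)] by (simp_all add: s_def radius_def)
  have d: "(a, vec2 x y) \<in> tube" using a J by (simp add: tube_iff)
  let ?c = "cosh (v a (vec2 x y))"
  have c1: "1 \<le> ?c" by (rule cosh_real_ge_1)
  have cq: "cosh (v a q) = ?c" using yq v_odd[OF d] by (metis cosh_minus)
  have hb: "(hx a q)\<^sup>2 + (hy a q)\<^sup>2 \<le> 4 * twist\<^sup>2 / s^4"
    using h'_bound[OF radius[OF a(1) J(1)], of "q$2"] J by (simp add: x_def y_def s_def)
  have K: "norm_A_sq (surf a) X = 2 * ((hx a q)\<^sup>2 + (hy a q)\<^sup>2) / ?c^4"
    using curvature_surf(2)[OF a(1) q(1)] X(1) q(2) cq by simp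
  also have "\<dots> \<le> 2 * (4 * twist\<^sup>2 / s^4) / ?c^4"
    using hb c1 by (intro divide_right_mono mult_left_mono) auto
  finally have K: "norm_A_sq (surf a) X \<le> 8 * twist\<^sup>2 / (s^4 * ?c^4)" by (simp add: field_simps)
  show ?thesis
  proof (cases "\<delta> / 2 \<le> \<bar>x\<bar>")
    case True
    then have "(\<delta>/2)\<^sup>2 \<le> \<bar>x\<bar>\<^sup>2" using \<delta> by (intro power_mono) auto
    then have "(\<delta>/2)\<^sup>2 \<le> s\<^sup>2" unfolding power2_abs using s2 zero_le_power2[of a] by linarith
    then have "((\<delta>/2)\<^sup>2)\<^sup>2 \<le> (s\<^sup>2)\<^sup>2" by (rule power_mono[OF _ zero_le_power2])
    then have "\<delta>^4 / 16 \<le> s^4" by (simp add: power_divide flip: power_mult)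
    moreover have "1 \<le> ?c^4" using c1 by simp
    ultimately have "\<delta>^4 / 16 * 1 \<le> s^4 * ?c^4" using \<delta> by (intro mult_mono) auto
    then have "8 * twist\<^sup>2 / (s^4 * ?c^4) \<le> 8 * twist\<^sup>2 / (\<delta>^4 / 16)"
      using \<delta> by (intro divide_left_mono mult_pos_pos) (use s c1 in auto)
    also have "\<dots> = 128 * twist\<^sup>2 * 1 / \<delta>^4" by simp
    also have "\<dots> \<le> 128 * twist\<^sup>2 * (\<delta>\<^sup>2 + 1) / \<delta>^4"
      using \<delta> by (intro divide_right_mono mult_left_mono) auto
    finally show ?thesis using K by linarith
  next
    case False
    then have "\<bar>x\<bar>\<^sup>2 \<le> (\<delta>/2)\<^sup>2" by (intro power_mono) auto
    then have x2: "x\<^sup>2 \<le> \<delta>\<^sup>2 / 4" by (simp add: power_divide)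
    have "\<delta>\<^sup>2 \<le> (norm X)\<^sup>2" using X(2) \<delta> by (intro power_mono) auto
    also have "(norm X)\<^sup>2 = Q a q + x\<^sup>2"
      unfolding power2_norm_eq_inner
      by (simp add: inner_vec_def sum_3 q(2) Q_def x_def power2_eq_square)
    finally have "\<delta>\<^sup>2 / 4 \<le> Q a q" using x2 by (simp add: field_simps) (smt (verit) zero_le_power2)
    also have "Q a q = Q a (vec2 x y)" using yq Q_even[OF d] by auto
    also have "\<dots> \<le> (y * ?c)\<^sup>2" using slice_Q_upper[OF a(1) J] slice_Q_eq[OF a(1) J(1)] by simp
    also have "\<dots> \<le> (s * sqrt s * ?c)\<^sup>2"
    proof (intro power_mono mult_right_mono)
      have "y \<le> s * sqrt s / 2^14" using J height_le(2)[of a x] by (simp add: s_def)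
      also have "\<dots> \<le> s * sqrt s" using s by simp
      finally show "y \<le> s * sqrt s" .
    qed (use J c1 in auto)
    also have "\<dots> = s^3 * ?c\<^sup>2" using s by (simp add: power_mult_distrib power_numeral_reduce)
    finally have "(\<delta>\<^sup>2 / 4)\<^sup>2 \<le> (s^3 * ?c\<^sup>2)\<^sup>2" by (intro power_mono) auto
    then have "\<delta>^4 / 16 \<le> s^6 * ?c^4" by (simp add: power_divide power_mult_distrib flip: power_mult)
    then have "8 * twist\<^sup>2 * s\<^sup>2 * (\<delta>^4 / 16) \<le> 8 * twist\<^sup>2 * s\<^sup>2 * (s^6 * ?c^4)"
      by (intro mult_left_mono) auto
    then have "8 * twist\<^sup>2 / (s^4 * ?c^4) \<le> 128 * twist\<^sup>2 * s\<^sup>2 / \<delta>^4"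
      using s \<delta> c1 by (simp add: field_simps power_numeral_reduce)
    also have "\<dots> \<le> 128 * twist\<^sup>2 * (\<delta>\<^sup>2 + 1) / \<delta>^4"
    proof (intro divide_right_mono mult_left_mono)
      have "a\<^sup>2 \<le> 1" using a(2) by (simp add: abs_square_le_1)
      then show "s\<^sup>2 \<le> \<delta>\<^sup>2 + 1" using s2 x2 zero_le_power2[of \<delta>] by linarith
    qed (use \<delta> in auto)
    finally show ?thesis using K by linarith
  qed
qed

lemma curvature_at_origin:
  assumes a: "a \<in> A" "0 \<in> J"
  shows "0 \<in> surf a" "norm_A_sq (surf a) 0 = 2 * twist\<^sup>2 / a^4"
proof -
  have d: "(a, vec2 0 0) \<in> tube" using a height_pos[OF radius[OF a]] by (simp add: tube_iff)
  have F0: "F a (vec2 0 0) = 0" using a by (simp add: F_def vec_eq_iff forall_3 vector_3)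
  moreover have "vector [0, 0, 0] = (0 :: real^3)" by (simp add: vec_eq_iff forall_3 vector_3)
  ultimately show 0: "0 \<in> surf a" using axis_in_surf[OF a] by metis
  have "a \<noteq> 0" using radius[OF a] by simp
  then show "norm_A_sq (surf a) 0 = 2 * twist\<^sup>2 / a^4"
    using curvature_surf(2)[OF a(1) d] F0 0 a
    by (simp add: hx_def hy_def denom_def power2_eq_square power4_eq_xxxx)
qed

section \<open>Convergence\<close>

lemma converges:
  assumes "compact A" "0 \<in> A" and \<alpha>: "\<And>i. \<alpha> i \<in> A" "\<alpha> \<longlonglongrightarrow> 0"
    and \<Sigma>: "\<And>i. \<Sigma> i \<inter> {X. X$3 \<in> J} = surf (\<alpha> i)"
  shows "C2_converges_in {X. X$3 \<in> J} \<Sigma> (surf 0)"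
  unfolding C2_converges_in_def
proof (rule exI[of _ "G 0"], rule exI[of _ Dom], rule exI[of _ "\<lambda>i. G (\<alpha> i)"],
    rule exI[of _ "\<lambda>i. Dom"], intro conjI allI impI)
  have reg: "regular_param (G a) Dom (surf a)" if "a \<in> A" for a
    using regular_param_affine[OF that, of 1 Dom 0] by (simp add: surf_def)
  then show "regular_param (G 0) Dom (surf 0)" using assms(2) .
  show "regular_param (G (\<alpha> i)) Dom (\<Sigma> i \<inter> {X. X$3 \<in> J})" for i
    unfolding \<Sigma> by (rule reg[OF \<alpha>(1)])
  fix K assume K: "compact K \<and> K \<subseteq> Dom"
  then have sub: "A \<times> K \<subseteq> ext" using Dom_ext by auto
  have ul: "uniform_limit K (\<lambda>i. f (\<alpha> i)) (f 0) sequentially"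
    if "\<And>j. Ck_family 0 (\<lambda>a p. f a p $ j) ext" for f :: "real \<Rightarrow> real^2 \<Rightarrow> real^3"
  proof (rule uniform_limit_of_joint_continuity[OF _ assms(1) _ \<alpha>(2,1) assms(2)])
    have "continuous_on ext (\<lambda>(a, p). f a p)"
      using that by (simp add: continuous_on_componentwise_vec case_prod_unfold)
    then show "continuous_on (A \<times> K) (\<lambda>(a, p). f a p)" by (rule continuous_on_subset) (rule sub)
  qed (use K in simp)
  show "uniform_limit K (\<lambda>i. G (\<alpha> i)) (G 0) sequentially"
    by (rule ul[of G]) (rule Ck_G)
  have 1: "Ck_family (Suc 0) (\<lambda>a p. pd i (G a) p $ j) ext" for i j
    by (rule Ck_family_pd(1)[OF ext_open]) (rule Ck_G)
  show "uniform_limit K (\<lambda>i. pd j (G (\<alpha> i))) (pd j (G 0)) sequentially" for j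
    by (rule ul[of "\<lambda>a. pd j (G a)"]) (rule Ck_family_mono_Suc[OF 1])
  show "uniform_limit K (\<lambda>i. pd j (pd k (G (\<alpha> i)))) (pd j (pd k (G 0))) sequentially" for j k
    by (rule ul[of "\<lambda>a. pd j (pd k (G a))"]) (rule Ck_family_pd(1)[OF ext_open 1])
  show "\<forall>\<^sub>F i in sequentially. K \<subseteq> Dom" using K by simp
next
  fix L assume L: "compact L \<and> L \<subseteq> {X::real^3. X$3 \<in> J}"
  define K where "K = (\<lambda>(x, t). vec2 x t) ` (((\<lambda>X. X$3) ` L) \<times> {-1..1})"
  have "compact K"
    unfolding K_def using L
    by (intro compact_continuous_image compact_Times)
      (auto simp: case_prod_unfold intro!: continuous_intros compact_continuous_image)
  moreover have "K \<subseteq> Dom" using L by (auto simp: K_def Dom_def)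
  moreover have "p \<in> K" if "p \<in> Dom" "G (\<alpha> i) p \<in> L" for i p
  proof -
    have "G (\<alpha> i) p $ 3 = p$1" by (simp add: G_def)
    then have "p$1 \<in> (\<lambda>X. X$3) ` L" using that(2) by force
    then have "(p$1, p$2) \<in> ((\<lambda>X. X$3) ` L) \<times> {-1..1}" using that(1) by (auto simp: Dom_def)
    then have "(\<lambda>(x, t). vec2 x t) (p$1, p$2) \<in> K" unfolding K_def by (rule imageI)
    then show ?thesis by simp
  qed
  ultimately show "\<exists>K. compact K \<and> K \<subseteq> Dom \<and>
      (\<forall>\<^sub>F i in sequentially. \<forall>u\<in>Dom. G (\<alpha> i) u \<in> L \<longrightarrow> u \<in> K)"
    by (intro exI[of _ K]) auto
qed

end

section \<open>Limits on half spaces\<close>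

text \<open>The same set for every choice of \<open>h\<close> with the given sine and cosine. This identifies the part of
  a surface in a half space with the member of the family used there.\<close>

definition piece :: "(real \<Rightarrow> complex \<Rightarrow> complex) \<Rightarrow> (real \<Rightarrow> complex \<Rightarrow> complex) \<Rightarrow> real set \<Rightarrow> real \<Rightarrow> (real^3) set"
  where "piece S C J a = {vector [Im (S a (cvec q)), - Im (C a (cvec q)), q$1] | q.
    q$1 \<in> J \<and> \<bar>q$2\<bar> < height a (q$1) \<and> (Im (S a (cvec q)))\<^sup>2 + (Im (C a (cvec q)))\<^sup>2 \<le> 1}"

lemma piece_Int: "piece S C UNIV a \<inter> {X. X$3 \<in> J} = piece S C J a"
  by (auto simp: piece_def vector_3)

context helicoidal_family
begin

lemma surf_eq_piece: "a \<in> A \<Longrightarrow> surf a = piece S C J a"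
  by (intro set_eqI) (simp add: surf_iff piece_def tube_def F_def Q_def W1_def W2_def, blast)

context
  fixes \<epsilon> a :: real
  assumes \<epsilon>: "\<epsilon> = 1 \<or> \<epsilon> = -1" and J\<epsilon>: "J = {x. 0 < \<epsilon> * x}" and a: "a \<in> A"
    and u_axis: "\<And>x. x \<in> J \<Longrightarrow> u a (vec2 x 0) = - twist / x"
begin

text \<open>The direction of the slices at the axis is \<open>- twist / x\<close>, up to a constant. It runs through all
  values beyond the one at \<open>\<epsilon>\<close> before \<open>x\<close> reaches \<open>0\<close>.\<close>

lemma sheet_far:
  assumes \<rho>: "0 < \<rho>" "\<rho> \<le> 1" and \<theta>: "\<epsilon> * (\<theta> - s) < - twist - pi"
  shows "(\<rho>, \<theta>) \<in> sheet a s"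
proof -
  define m where "m = \<bar>\<epsilon> * (\<theta> - s)\<bar> + pi + 1"
  have m: "0 < m" "- m + pi < \<epsilon> * (\<theta> - s)" unfolding m_def
    using pi_gt_zero abs_ge_zero[of "\<epsilon> * (\<theta> - s)"] abs_ge_minus_self[of "\<epsilon> * (\<theta> - s)"] by linarith+
  define r where "r = twist / m"
  have "twist \<noteq> 0" using twist_pos by (metis less_irrefl)
  then have r: "0 < r" "twist / r = m" using m by (auto simp: r_def)
  have J: "\<epsilon> \<in> J" "\<epsilon> * r \<in> J" using \<epsilon> r by (auto simp: J\<epsilon>)
  note b1 = theta_bounds[OF a J(1) \<rho>] and b2 = theta_bounds[OF a J(2) \<rho>]
  show ?thesis
    using \<epsilon>
  proof
    assume "\<epsilon> = 1"
    then show ?thesis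
      using b1 b2 u_axis[OF J(1)] u_axis[OF J(2)] \<theta> m(2) r
      by (intro sheet_between[OF a \<rho> J(2,1)]) auto
  next
    assume "\<epsilon> = -1"
    then show ?thesis
      using b1 b2 u_axis[OF J(1)] u_axis[OF J(2)] \<theta> m(2) r
      by (intro sheet_between[OF a \<rho> J(1,2)]) auto
  qed
qed

lemma level_small:
  assumes z: "(\<rho>, \<theta>) \<in> sheet a s" and "0 < e" and \<theta>: "\<epsilon> * (\<theta> - s) < - twist / e - pi"
  shows "\<bar>level a s (\<rho>, \<theta>)\<bar> < e"
proof -
  define x where "x = level a s (\<rho>, \<theta>)"
  have l: "x \<in> J" "theta a x \<rho> = \<theta> - s" "0 < \<rho>" "\<rho> \<le> 1"
    using level[OF a z] by (auto simp: x_def)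
  have J: "\<epsilon> * e \<in> J" using \<epsilon> \<open>0 < e\<close> by (auto simp: J\<epsilon>)
  note b = theta_bounds[OF a J l(3,4)]
  have "\<bar>x\<bar> < e"
    using \<epsilon>
  proof
    assume 1: "\<epsilon> = 1"
    then have "theta a x \<rho> < theta a e \<rho>" using b u_axis[OF J] \<theta> l(2) by auto
    then have "x < e" using theta_strict_mono[OF a l(3,4), of e x] J l(1) 1
      by (metis less_asym' linorder_less_linear mult_1)
    then show ?thesis using l(1) 1 by (auto simp: J\<epsilon>)
  next
    assume 1: "\<epsilon> = -1"
    then have "theta a (- e) \<rho> < theta a x \<rho>" using b u_axis[OF J] \<theta> l(2) by auto
    then have "- e < x" using theta_strict_mono[OF a l(3,4), of x "- e"] J l(1) 1
      by (metis less_asym' linorder_less_linear mult_minus1)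
    then show ?thesis using l(1) 1 by (auto simp: J\<epsilon>)
  qed
  then show ?thesis by (simp add: x_def)
qed

lemma spiraling_half:
  assumes \<tau>: "\<tau> = 1 \<and> s = 0 \<or> \<tau> = -1 \<and> s = pi"
  shows "spiraling_multi_graph (half \<tau> a)"
proof -
  have sub: "half \<tau> a \<subseteq> {x. 0 < (x$1)\<^sup>2 + (x$2)\<^sup>2 \<and> (x$1)\<^sup>2 + (x$2)\<^sup>2 \<le> 1}"
  proof
    fix X assume X: "X \<in> half \<tau> a"
    then obtain q where q: "(a, q) \<in> tube" "X = F a q" "Q a q \<le> 1"
      using surf_iff[OF a] by (auto simp: half_def)
    moreover have "q$2 \<noteq> 0" using X yof_F[OF q(1)] q(2) by (auto simp: half_def)
    ultimately show "X \<in> {x. 0 < (x$1)\<^sup>2 + (x$2)\<^sup>2 \<and> (x$1)\<^sup>2 + (x$2)\<^sup>2 \<le> 1}"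
      using Q_pos[OF q(1)] by (simp add: Q_def)
  qed
  have small: "\<bar>level a s z\<bar> < e" if "z \<in> sheet a s" "0 < e" "\<epsilon> * (snd z - s) < - twist / e - pi" for z e
    using level_small[of "fst z" "snd z" s e] that by simp
  from \<epsilon> have "(\<exists>\<theta>\<^sub>0. {(\<rho>, \<theta>). 0 < \<rho> \<and> \<rho> < 1 \<and> \<theta> > \<theta>\<^sub>0} \<subseteq> sheet a s) \<and>
           (level a s \<longlongrightarrow> 0) (inf (filtercomap snd at_top) (principal (sheet a s)))
       \<or> (\<exists>\<theta>\<^sub>0. {(\<rho>, \<theta>). 0 < \<rho> \<and> \<rho> < 1 \<and> \<theta> < - \<theta>\<^sub>0} \<subseteq> sheet a s) \<and>
           (level a s \<longlongrightarrow> 0) (inf (filtercomap snd at_bot) (principal (sheet a s)))"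
  proof
    assume 1: "\<epsilon> = 1"
    have "{(\<rho>, \<theta>). 0 < \<rho> \<and> \<rho> < 1 \<and> \<theta> < - (twist + pi - s)} \<subseteq> sheet a s"
      using sheet_far 1 by auto
    moreover have "(level a s \<longlongrightarrow> 0) (inf (filtercomap snd at_bot) (principal (sheet a s)))"
    proof (rule tendstoI)
      fix e :: real assume "0 < e"
      have "\<forall>\<^sub>F \<theta> in at_bot. \<epsilon> * (\<theta> - s) < - twist / e - pi"
        unfolding eventually_at_bot_dense 1 by (intro exI[of _ "s - twist / e - pi"]) auto
      then have "\<forall>\<^sub>F z in filtercomap snd at_bot. \<epsilon> * (snd (z :: real \<times> real) - s) < - twist / e - pi"
        by (rule eventually_filtercomapI)
      then show "\<forall>\<^sub>F z in inf (filtercomap snd at_bot) (principal (sheet a s)). dist (level a s z) 0 < e"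
        unfolding eventually_inf_principal
        by eventually_elim (use small \<open>0 < e\<close> in auto)
    qed
    ultimately show ?thesis by blast
  next
    assume 1: "\<epsilon> = -1"
    have "{(\<rho>, \<theta>). 0 < \<rho> \<and> \<rho> < 1 \<and> \<theta> > twist + pi + s} \<subseteq> sheet a s"
      using sheet_far 1 by auto
    moreover have "(level a s \<longlongrightarrow> 0) (inf (filtercomap snd at_top) (principal (sheet a s)))"
    proof (rule tendstoI)
      fix e :: real assume "0 < e"
      have "\<forall>\<^sub>F \<theta> in at_top. \<epsilon> * (\<theta> - s) < - twist / e - pi"
        unfolding eventually_at_top_dense 1 by (intro exI[of _ "s + twist / e + pi"]) auto
      then have "\<forall>\<^sub>F z in filtercomap snd at_top. \<epsilon> * (snd (z :: real \<times> real) - s) < - twist / e - pi"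
        by (rule eventually_filtercomapI)
      then show "\<forall>\<^sub>F z in inf (filtercomap snd at_top) (principal (sheet a s)). dist (level a s z) 0 < e"
        unfolding eventually_inf_principal
        by eventually_elim (use small \<open>0 < e\<close> in auto)
    qed
    ultimately show ?thesis by blast
  qed
  then show ?thesis
    unfolding spiraling_multi_graph_def using sub multi_graph_half[OF a \<tau>] by blast
qed

lemma spiraling_halves:
  "\<exists>\<Sigma>1 \<Sigma>2. spiraling_multi_graph \<Sigma>1 \<and> spiraling_multi_graph \<Sigma>2 \<and> surf a - x3_axis = \<Sigma>1 \<union> \<Sigma>2"
proof (intro exI conjI)
  show "spiraling_multi_graph (half 1 a)" by (rule spiraling_half[of 1 0]) simp
  show "spiraling_multi_graph (half (-1) a)" by (rule spiraling_half[of "-1" pi]) simp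
qed (rule surf_minus_axis[OF a])

text \<open>Off the axis, turn by full angles along the spiral, which changes the height only. On the axis,
  descend along it.\<close>

lemma limit_disc_in_closure:
  assumes X: "(X$1)\<^sup>2 + (X$2)\<^sup>2 \<le> 1" "X$3 = 0"
  shows "X \<in> closure (surf a)"
  unfolding closure_approachable
proof (intro allI impI)
  fix e :: real assume e: "0 < e"
  define r where "r = sqrt ((X$1)\<^sup>2 + (X$2)\<^sup>2)"
  have r: "0 \<le> r" "r \<le> 1" "r\<^sup>2 = (X$1)\<^sup>2 + (X$2)\<^sup>2" using X by (simp_all add: r_def)
  have approx: "\<exists>Z\<in>surf a. dist Z X < e" if "X + t *\<^sub>R axis 3 1 \<in> surf a" "\<bar>t\<bar> < e" for t
    using that by (intro bexI[of _ "X + t *\<^sub>R axis 3 1"]) (simp_all add: dist_norm)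
  show "\<exists>Z\<in>surf a. dist Z X < e"
  proof (cases "r = 0")
    case True
    then have "X = 0" using r(3) X(2) by (simp add: vec_eq_iff forall_3 sum_power2_eq_zero_iff)
    then have "X + (\<epsilon> * e / 2) *\<^sub>R axis 3 1 = vector [0, 0, \<epsilon> * e / 2]"
      by (simp add: vec_eq_iff forall_3 vector_3 axis_def)
    moreover have "\<epsilon> * e / 2 \<in> J" using \<epsilon> e by (auto simp: J\<epsilon>)
    ultimately show ?thesis
      using \<epsilon> e axis_in_surf[OF a] by (intro approx[of "\<epsilon> * e / 2"]) auto
  next
    case False
    then have r0: "0 < r" using r by simp
    have "(X$1 / r)\<^sup>2 + (X$2 / r)\<^sup>2 = ((X$1)\<^sup>2 + (X$2)\<^sup>2) / r\<^sup>2"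
      by (simp add: power_divide add_divide_distrib)
    also have "\<dots> = 1" unfolding r(3)[symmetric] using r0 by simp
    finally obtain t where t: "X$1 / r = cos t" "X$2 / r = sin t"
      using sincos_total_2pi by metis
    obtain k :: nat where k: "\<bar>t\<bar> + twist + twist / e + pi < real k" using reals_Archimedean2 by blast
    define \<theta> where "\<theta> = t - \<epsilon> * (2 * pi * real k)"
    have "real k \<le> 2 * pi * real k" using pi_gt3 by (simp add: mult_le_cancel_right1)
    moreover have "\<epsilon> * \<theta> = \<epsilon> * t - 2 * pi * real k" using \<epsilon> by (auto simp: \<theta>_def)
    moreover have "\<epsilon> * t \<le> \<bar>t\<bar>" using \<epsilon> by auto
    moreover have "0 < twist / e" using e by simp
    ultimately have far: "\<epsilon> * (\<theta> - 0) < - twist - pi" "\<epsilon> * (\<theta> - 0) < - twist / e - pi"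
      using k twist_pos minus_divide_left[of twist e] unfolding diff_zero by linarith+
    have "cos \<theta> = cos t" "sin \<theta> = sin t"
      using \<epsilon> sin_2npi[of k] cos_2npi[of k] by (auto simp: \<theta>_def cos_diff sin_diff cos_add sin_add mult_ac)
    then have XX: "r * cos \<theta> = X$1" "r * sin \<theta> = X$2" using t r0 by (simp_all add: field_simps)
    have z: "(r, \<theta>) \<in> sheet a 0" by (rule sheet_far[OF r0 r(2) far(1)])
    have "X + level a 0 (r, \<theta>) *\<^sub>R axis 3 1 = vector [r * cos \<theta>, r * sin \<theta>, level a 0 (r, \<theta>)]"
      using X(2) by (simp add: vec_eq_iff forall_3 vector_3 axis_def XX)
    also have "\<dots> \<in> half 1 a" using half_eq_sheet[OF a, of 1 0] z by blast
    finally show ?thesis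
      using level_small[OF z e far(2)] by (intro approx) (auto simp: half_def)
  qed
qed

lemma closure_surf_minus_surf:
  "closure (surf a) - surf a = {x. (x$1)\<^sup>2 + (x$2)\<^sup>2 \<le> 1 \<and> x$3 = 0}"
proof
  have "closed {X::real^3. (X$1)\<^sup>2 + (X$2)\<^sup>2 \<le> 1 \<and> 0 \<le> \<epsilon> * X$3}"
    by (intro closed_Collect_conj closed_Collect_le continuous_intros)
  moreover have "surf a \<subseteq> {X. (X$1)\<^sup>2 + (X$2)\<^sup>2 \<le> 1 \<and> 0 \<le> \<epsilon> * X$3}"
  proof
    fix X assume X: "X \<in> surf a"
    then have "X$3 \<in> J" by (auto simp: surf_def G_def Dom_def)
    then have "0 < \<epsilon> * X$3" by (simp add: J\<epsilon>)
    moreover have "(X$1)\<^sup>2 + (X$2)\<^sup>2 \<le> 1" using X Q_G(1)[OF a] by (auto simp: surf_def)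
    ultimately show "X \<in> {X. (X$1)\<^sup>2 + (X$2)\<^sup>2 \<le> 1 \<and> 0 \<le> \<epsilon> * X$3}" by simp
  qed
  ultimately have "closure (surf a) \<subseteq> {X. (X$1)\<^sup>2 + (X$2)\<^sup>2 \<le> 1 \<and> 0 \<le> \<epsilon> * X$3}"
    by (intro closure_minimal)
  moreover have "X$3 \<notin> J" if "X \<in> closure (surf a) - surf a" for X
    using closure_surf[OF a] that by blast
  ultimately show "closure (surf a) - surf a \<subseteq> {x. (x$1)\<^sup>2 + (x$2)\<^sup>2 \<le> 1 \<and> x$3 = 0}"
    using \<epsilon> by (fastforce simp: J\<epsilon>)
  have "X$3 \<in> J" if "X \<in> surf a" for X
    using that by (auto simp: surf_def G_def Dom_def)
  then show "{x. (x$1)\<^sup>2 + (x$2)\<^sup>2 \<le> 1 \<and> x$3 = 0} \<subseteq> closure (surf a) - surf a"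
    using limit_disc_in_closure by (fastforce simp: J\<epsilon>)
qed

end

end

section \<open>Existence of the holomorphic data\<close>

lemma half_line_homeomorphic:
  fixes \<epsilon> :: real
  assumes "\<epsilon> = 1 \<or> \<epsilon> = -1"
  shows "{x. 0 < \<epsilon> * x} homeomorphic (UNIV :: real set)"
proof -
  have ee: "\<epsilon> * \<epsilon> = 1" using assms by auto
  have "homeomorphism {x. 0 < \<epsilon> * x} (UNIV :: real set) (\<lambda>x. ln (\<epsilon> * x)) (\<lambda>y. \<epsilon> * exp y)"
    by (rule homeomorphismI)
      (use ee in \<open>auto intro!: continuous_intros simp: mult.assoc[symmetric]\<close>)
  then show ?thesis by (auto simp: homeomorphic_def)
qed

text \<open>The complex plane without two rays of the imaginary axis, where \<open>arctan (z / a)\<close> is holomorphic.\<close>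

definition slit :: "real \<Rightarrow> complex set" where
  "slit a = {z. Re z = 0 \<longrightarrow> \<bar>Im z\<bar> < a}"

lemma slit_open: "open (slit a)"
proof -
  have "closed {z. Re z = 0 \<and> a \<le> \<bar>Im z\<bar>}"
    by (intro closed_Collect_conj closed_Collect_eq closed_Collect_le continuous_intros)
  moreover have "slit a = - {z. Re z = 0 \<and> a \<le> \<bar>Im z\<bar>}" by (auto simp: slit_def)
  ultimately show ?thesis by (simp add: open_closed)
qed

lemma slit_starlike: "0 < a \<Longrightarrow> starlike (slit a)"
  unfolding starlike_def
proof (intro bexI[of _ 0] ballI subsetI)
  fix z w assume a: "0 < a" and z: "z \<in> slit a" and "w \<in> closed_segment 0 z"
  then obtain t where t: "0 \<le> t" "t \<le> 1" "w = t *\<^sub>R z" by (auto simp: closed_segment_def)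
  have "t * \<bar>Im z\<bar> \<le> 1 * \<bar>Im z\<bar>" using t by (intro mult_right_mono) auto
  then show "w \<in> slit a" using z a t by (auto simp: slit_def abs_mult)
qed (simp add: slit_def)

lemma Arctan_derivative_slit:
  assumes "0 < a" "z \<in> slit a"
  shows "((\<lambda>z. of_real (twist / a) * Arctan (z / of_real a)) has_field_derivative
    of_real twist / (z\<^sup>2 + (of_real a)\<^sup>2)) (at z)"
proof -
  have s: "Re (z / of_real a) = 0 \<Longrightarrow> \<bar>Im (z / of_real a)\<bar> < 1"
    using assms by (auto simp: slit_def)
  have a0: "a \<noteq> 0" using assms(1) by simp
  have nz: "z\<^sup>2 + (of_real a)\<^sup>2 \<noteq> 0"
  proof
    assume "z\<^sup>2 + (of_real a)\<^sup>2 = 0"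
    then have "(z - \<i> * of_real a) * (z + \<i> * of_real a) = 0" by (simp add: algebra_simps power2_eq_square)
    then have "z = \<i> * of_real a \<or> z = - (\<i> * of_real a)" by (auto simp: add_eq_0_iff)
    then show False using assms by (auto simp: slit_def)
  qed
  have "((\<lambda>z. of_real (twist / a) * Arctan (z / of_real a)) has_field_derivative
      of_real (twist / a) * (inverse (1 + (z / of_real a)\<^sup>2) * (1 / of_real a))) (at z)"
    using s a0 by (auto intro!: derivative_eq_intros DERIV_chain2[OF has_field_derivative_Arctan])
  moreover have "of_real (twist / a) * (inverse (1 + (z / of_real a)\<^sup>2) * (1 / of_real a))
      = of_real twist / (z\<^sup>2 + (of_real a)\<^sup>2)"
    using a0 nz by (simp add: field_simps power2_eq_square)
  ultimately show ?thesis by simp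
qed

lemma Im_zero_on_interval:
  assumes "convex J" "open J" "x0 \<in> J" "x \<in> J" "Im (g (of_real x0)) = 0"
    and "\<And>x. x \<in> J \<Longrightarrow> (g has_field_derivative k x) (at (of_real x))" "\<And>x. x \<in> J \<Longrightarrow> Im (k x) = 0"
  shows "Im (g (of_real x)) = 0"
proof -
  have "((\<lambda>t. Im (g (of_real t))) has_vector_derivative 0) (at t within J)" if "t \<in> J" for t
  proof -
    have "((\<lambda>t. g (of_real t)) has_vector_derivative (1 * k t)) (at t)"
      by (rule field_vector_diff_chain_at[where f=of_real and g=g, OF _ assms(6)[OF that], unfolded o_def])
        (auto intro!: derivative_eq_intros)
    from has_vector_derivative_at_within[OF bounded_linear.has_vector_derivative[OF bounded_linear_Im this]]
    show ?thesis using assms(7)[OF that] by simp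
  qed
  then obtain c where "\<And>t. t \<in> J \<Longrightarrow> Im (g (of_real t)) = c"
    using has_vector_derivative_zero_constant[OF assms(1)] by metis
  then show ?thesis using assms(3-5) by metis
qed

lemma primitive_slit:
  assumes a: "0 < a" and f: "f holomorphic_on UNIV" "\<And>x. Im x = 0 \<Longrightarrow> Im (f x) = 0"
  shows "\<exists>P. (\<forall>z\<in>slit a. (P has_field_derivative f (of_real (twist / a) * Arctan (z / of_real a))) (at z)) \<and>
    (\<forall>x. Im (P (of_real x)) = 0)"
proof -
  let ?h = "\<lambda>z. of_real (twist / a) * Arctan (z / of_real a)"
  have fd: "(\<lambda>z. f (?h z)) field_differentiable at z" if "z \<in> slit a" for z
  proof -
    have "f field_differentiable at (?h z)" using f(1) holomorphic_on_imp_differentiable_at open_UNIV by blast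
    moreover have "?h field_differentiable at z"
      using Arctan_derivative_slit[OF a that] by (auto simp: field_differentiable_def)
    ultimately show ?thesis using field_differentiable_compose[of ?h z f] by (simp add: o_def)
  qed
  then have "continuous_on (slit a) (\<lambda>z. f (?h z))"
    by (intro continuous_at_imp_continuous_on ballI field_differentiable_imp_continuous_at) auto
  from holomorphic_starlike_primitive[OF this slit_starlike[OF a] slit_open finite.emptyI] fd
  obtain g where g: "\<And>z. z \<in> slit a \<Longrightarrow> (g has_field_derivative f (?h z)) (at z)" by auto
  define P where "P z = g z - g 0" for z
  have P: "(P has_field_derivative f (?h z)) (at z)" if "z \<in> slit a" for z
    unfolding P_def using DERIV_diff[OF g[OF that] DERIV_const] by simp
  have "Im (P (of_real x)) = 0" for x
  proof (rule Im_zero_on_interval[of UNIV 0 x P "\<lambda>x. f (?h (of_real x))"])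
    show "(P has_field_derivative f (?h (of_real t))) (at (of_real t))" for t
      by (rule P) (use a in \<open>simp add: slit_def\<close>)
    have "Im (?h (of_real t)) = 0" for t
      by (simp add: Arctan_of_real flip: of_real_divide of_real_mult)
    then show "Im (f (?h (of_real t))) = 0" for t by (rule f(2))
  qed (auto simp: P_def)
  with P show ?thesis by blast
qed

lemma primitive_half_plane:
  assumes \<epsilon>: "\<epsilon> = 1 \<or> \<epsilon> = -1" and f: "f holomorphic_on UNIV" "\<And>x. Im x = 0 \<Longrightarrow> Im (f x) = 0"
  shows "\<exists>P. (\<forall>z. 0 < \<epsilon> * Re z \<longrightarrow> (P has_field_derivative f (- of_real twist / z)) (at z)) \<and>
    (\<forall>x. 0 < \<epsilon> * x \<longrightarrow> Im (P (of_real x)) = 0)"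
proof -
  let ?H = "{z. 0 < \<epsilon> * Re z}"
  have o: "open ?H" by (intro open_Collect_less continuous_intros)
  have c: "convex ?H"
    using \<epsilon> convex_halfspace_Re_gt[of 0] convex_halfspace_Re_lt[of 0] by auto
  have "f field_differentiable at z" for z
    using f(1) holomorphic_on_imp_differentiable_at open_UNIV by blast
  then have "(\<lambda>z. f (- of_real twist / z)) field_differentiable at z" if "z \<in> ?H" for z
  proof -
    have "(\<lambda>z. - of_real twist / z) field_differentiable at z"
      using that by (intro derivative_intros) auto
    from field_differentiable_compose[OF this] show ?thesis
      using \<open>\<And>z. f field_differentiable at z\<close> by (simp add: o_def)
  qed
  then have "(\<lambda>z. f (- of_real twist / z)) holomorphic_on ?H"
    by (auto simp: holomorphic_on_def intro: field_differentiable_at_within)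
  from holomorphic_convex_primitive'[OF c o this]
  obtain g where g: "\<And>z. z \<in> ?H \<Longrightarrow> (g has_field_derivative f (- of_real twist / z)) (at z within ?H)" by blast
  define P where "P z = g z - g (of_real \<epsilon>)" for z
  have P: "(P has_field_derivative f (- of_real twist / z)) (at z)" if "z \<in> ?H" for z
    unfolding P_def using DERIV_diff[OF g[OF that, unfolded at_within_open[OF that o]] DERIV_const] by simp
  have "Im (P (of_real x)) = 0" if "0 < \<epsilon> * x" for x
  proof (rule Im_zero_on_interval[of "{x. 0 < \<epsilon> * x}" \<epsilon> x P "\<lambda>x. f (- of_real twist / of_real x)"])
    show "convex {x. 0 < \<epsilon> * x}" using \<epsilon> by (auto simp: convex_real_interval lessThan_def[symmetric] greaterThan_def[symmetric])
    show "open {x. 0 < \<epsilon> * x}" by (intro open_Collect_less continuous_intros)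
    show "(P has_field_derivative f (- of_real twist / of_real t)) (at (of_real t))" if "t \<in> {x. 0 < \<epsilon> * x}" for t
      by (rule P) (use that in simp)
    show "Im (f (- of_real twist / of_real t)) = 0" for t by (rule f(2)) simp
  qed (use \<epsilon> that in \<open>auto simp: P_def\<close>)
  with P show ?thesis by blast
qed

text \<open>For \<open>a = 0\<close> the domain consists of two half planes, on which the primitives are normalized
  independently of each other.\<close>

lemma primitive_family:
  assumes f: "f holomorphic_on UNIV" "\<And>x. Im x = 0 \<Longrightarrow> Im (f x) = 0"
  shows "\<exists>P :: real \<Rightarrow> complex \<Rightarrow> complex.
    (\<forall>a>0. (\<forall>z\<in>slit a. (P a has_field_derivative f (of_real (twist / a) * Arctan (z / of_real a))) (at z)) \<and>
      (\<forall>x. Im (P a (of_real x)) = 0)) \<and>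
    (\<forall>z. Re z \<noteq> 0 \<longrightarrow> (P 0 has_field_derivative f (- of_real twist / z)) (at z)) \<and>
    (\<forall>x. x \<noteq> 0 \<longrightarrow> Im (P 0 (of_real x)) = 0)"
proof -
  obtain Pa where Pa: "\<And>a. 0 < a \<Longrightarrow>
      (\<forall>z\<in>slit a. (Pa a has_field_derivative f (of_real (twist / a) * Arctan (z / of_real a))) (at z)) \<and>
      (\<forall>x. Im (Pa a (of_real x)) = 0)"
    using primitive_slit[OF _ f] by metis
  obtain Pp where Pp: "\<And>z. 0 < Re z \<Longrightarrow> (Pp has_field_derivative f (- of_real twist / z)) (at z)"
    "\<And>x. 0 < x \<Longrightarrow> Im (Pp (of_real x)) = 0"
    using primitive_half_plane[of 1, OF _ f] by auto
  obtain Pm where Pm: "\<And>z. Re z < 0 \<Longrightarrow> (Pm has_field_derivative f (- of_real twist / z)) (at z)"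
    "\<And>x. x < 0 \<Longrightarrow> Im (Pm (of_real x)) = 0"
    using primitive_half_plane[of "-1", OF _ f] by auto
  define P where "P a = (if a = 0 then (\<lambda>z. if 0 < Re z then Pp z else Pm z) else Pa a)" for a :: real
  have op: "open {z. 0 < Re z}" "open {z. Re z < 0}"
    by (intro open_Collect_less continuous_intros)+
  have "(P 0 has_field_derivative f (- of_real twist / z)) (at z)" if "Re z \<noteq> 0" for z
  proof (cases "0 < Re z")
    case True
    show ?thesis
      by (rule has_field_derivative_transform_within_open[OF Pp(1)[OF True] op(1)]) (use True in \<open>auto simp: P_def\<close>)
  next
    case False
    then have neg: "Re z < 0" using that by simp
    show ?thesis
      by (rule has_field_derivative_transform_within_open[OF Pm(1)[OF neg] op(2)]) (use neg in \<open>auto simp: P_def\<close>)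
  qed
  moreover have "Im (P 0 (of_real x)) = 0" if "x \<noteq> 0" for x
    using Pp(2) Pm(2) that by (simp add: P_def)
  moreover have "P a = Pa a" if "0 < a" for a using that by (simp add: P_def)
  ultimately show ?thesis using Pa by (intro exI[of _ P]) auto
qed

lemma Arctan_inverse:
  assumes \<epsilon>: "\<epsilon> = 1 \<or> \<epsilon> = -1" and z: "0 < \<epsilon> * Re z"
  shows "Arctan z + Arctan (1 / z) = of_real (\<epsilon> * pi / 2)"
proof -
  let ?H = "{z. 0 < \<epsilon> * Re z}"
  have c: "convex ?H"
    using \<epsilon> convex_halfspace_Re_gt[of 0] convex_halfspace_Re_lt[of 0] by auto
  have D: "((\<lambda>z. Arctan z + Arctan (1 / z)) has_field_derivative 0) (at w within ?H)" if w: "w \<in> ?H" for w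
  proof -
    have w0: "w \<noteq> 0" "Re w \<noteq> 0" using w \<epsilon> by auto
    have "Re (1 / w) \<noteq> 0" using w0 by (simp add: Re_divide)
    moreover have nz: "w\<^sup>2 + 1 \<noteq> 0"
    proof
      assume "w\<^sup>2 + 1 = 0"
      then have "(w - \<i>) * (w + \<i>) = 0" by (simp add: algebra_simps power2_eq_square)
      then have "w = \<i> \<or> w = - \<i>" by (simp add: eq_neg_iff_add_eq_0)
      then show False using w0 by auto
    qed
    ultimately have "((\<lambda>z. Arctan z + Arctan (1 / z)) has_field_derivative
        inverse (1 + w\<^sup>2) + inverse (1 + (1 / w)\<^sup>2) * (- (1 / w\<^sup>2))) (at w)"
      using w0 by (auto intro!: derivative_eq_intros DERIV_chain2[OF has_field_derivative_Arctan] simp: power2_eq_square)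
    moreover have "inverse (1 + w\<^sup>2) + inverse (1 + (1 / w)\<^sup>2) * (- (1 / w\<^sup>2)) = 0"
      using w0 nz by (simp add: field_simps)
    ultimately show ?thesis by (simp add: has_field_derivative_at_within)
  qed
  have e: "of_real \<epsilon> \<in> ?H" using \<epsilon> by auto
  obtain k where k: "\<And>w. w \<in> ?H \<Longrightarrow> Arctan w + Arctan (1 / w) = k"
    using has_field_derivative_zero_constant[OF c D] by auto
  have "Arctan 1 = of_real (pi / 4)" "Arctan (- 1) = - of_real (pi / 4)"
    using Arctan_of_real[of 1] Arctan_of_real[of "-1"] by (simp_all add: arctan_one arctan_minus)
  then have "Arctan (of_real \<epsilon>) + Arctan (1 / of_real \<epsilon>) = of_real (\<epsilon> * pi / 2)"
    using \<epsilon> by (auto simp: mult.commute)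
  with k[OF e] k[of z] z show ?thesis by simp
qed

text \<open>The continuous extension to \<open>0\<close> is what makes \<open>h\<close> continuous in \<open>a\<close> up to \<open>a = 0\<close>.\<close>

definition Arctan_quotient :: "complex \<Rightarrow> complex" where
  "Arctan_quotient w = (if w = 0 then 1 else Arctan w / w)"

lemma continuous_on_Arctan_quotient: "continuous_on (slit 1) Arctan_quotient"
proof (intro continuous_at_imp_continuous_on ballI)
  fix w assume w: "w \<in> slit 1"
  show "isCont Arctan_quotient w"
  proof (cases "w = 0")
    case True
    have "(Arctan has_field_derivative inverse (1 + 0\<^sup>2)) (at 0)"
      by (rule has_field_derivative_Arctan) simp
    then have "((\<lambda>h. (Arctan (0 + h) - Arctan 0) / h) \<longlongrightarrow> 1) (at 0)"
      by (simp add: DERIV_def)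
    then have "((\<lambda>h. Arctan h / h) \<longlongrightarrow> 1) (at 0)" by simp
    moreover have "\<forall>\<^sub>F h in at 0. Arctan h / h = Arctan_quotient h"
      by (auto simp: eventually_at_filter Arctan_quotient_def)
    ultimately have "(Arctan_quotient \<longlongrightarrow> 1) (at 0)" by (rule Lim_transform_eventually)
    then show ?thesis using True by (simp add: isCont_def Arctan_quotient_def)
  next
    case False
    have "isCont Arctan w"
      using has_field_derivative_Arctan[of w] w by (intro DERIV_isCont) (auto simp: slit_def)
    then have "isCont (\<lambda>w. Arctan w / w) w" using False by (intro continuous_intros) auto
    moreover have "\<forall>\<^sub>F v in nhds w. Arctan v / v = Arctan_quotient v"
      using eventually_nhds_in_open[of "- {0}" w] False
      by (auto simp: Arctan_quotient_def elim: eventually_mono)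
    ultimately show ?thesis by (simp add: isCont_cong)
  qed
qed


section \<open>The sequence\<close>

definition h_full :: "real \<Rightarrow> complex \<Rightarrow> complex" where
  "h_full a z = of_real (twist / a) * Arctan (z / of_real a)"

text \<open>On a half plane \<open>arctan (z / a)\<close> is a constant minus \<open>arctan (a / z)\<close>. Without the constant the
  function extends to \<open>a = 0\<close>, with the value \<open>- twist / z\<close>.\<close>

definition h_half :: "real \<Rightarrow> complex \<Rightarrow> complex" where
  "h_half a z = - (of_real twist / z) * Arctan_quotient (of_real a / z)"

text \<open>The values \<open>twist / (4 m)\<close> with \<open>m \<ge> 2\<^sup>2\<^sup>4\<close>: the constant by which \<open>h_full\<close> and \<open>h_half\<close> differ is then a
  multiple of \<open>2 pi\<close>, and the parameters are at most \<open>1\<close>, as the curvature estimate requires.\<close>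

definition scale :: "nat \<Rightarrow> real" where
  "scale n = 2^24 / (real n + 2^24)"

lemma scale_pos: "0 < scale n"
  unfolding scale_def by (intro divide_pos_pos add_nonneg_pos) auto

lemma scale_le_1: "scale n \<le> 1"
  by (simp add: scale_def)

lemma scale_tendsto_0: "scale \<longlonglongrightarrow> 0"
  unfolding scale_def by real_asymp

lemma twist_over_scale: "twist / scale n * pi / 2 = 2 * pi * real (n + 2^24)"
  using scale_pos[of n] by (simp add: scale_def twist_def)

lemma height_in_slit:
  assumes "0 < a" "\<bar>p$2\<bar> < height a (p$1)" shows "cvec p \<in> slit a"
  using assms height_le(1)[of a "p$1"] by (auto simp: slit_def radius_def)

lemma h_half_eq_h_full:
  assumes \<epsilon>: "\<epsilon> = 1 \<or> \<epsilon> = -1" and z: "0 < \<epsilon> * Re z"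
  shows "h_half (scale n) z = h_full (scale n) z - of_real (\<epsilon> * (2 * pi * real (n + 2^24)))"
proof -
  define a where "a = scale n"
  have a: "0 < a" using scale_pos by (simp add: a_def)
  have z0: "z \<noteq> 0" using z by auto
  have "0 < \<epsilon> * Re (z / of_real a)" using z a by (simp add: zero_less_divide_iff)
  from Arctan_inverse[OF \<epsilon> this]
  have A: "Arctan (of_real a / z) = of_real (\<epsilon> * pi / 2) - Arctan (z / of_real a)"
    by (simp add: algebra_simps)
  have "h_half a z = - (of_real (twist / a) * Arctan (of_real a / z))"
    using a z0 by (simp add: h_half_def Arctan_quotient_def)
  also have "\<dots> = h_full a z - of_real (\<epsilon> * (twist / a * pi / 2))"
    unfolding A by (simp add: h_full_def algebra_simps)
  also have "\<epsilon> * (twist / a * pi / 2) = \<epsilon> * (2 * pi * real (n + 2^24))"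
    unfolding a_def twist_over_scale by simp
  finally show ?thesis by (simp add: a_def)
qed

lemma sin_cos_shift:
  fixes z :: complex
  assumes "\<epsilon> = 1 \<or> \<epsilon> = -1"
  shows "sin (z - of_real (\<epsilon> * (2 * pi * real m))) = sin z" "cos (z - of_real (\<epsilon> * (2 * pi * real m))) = cos z"
proof -
  have r: "sin (of_real (2 * pi * real m)) = (0::complex)" "cos (of_real (2 * pi * real m)) = (1::complex)"
    using sin_2npi[of m] cos_2npi[of m] by (simp_all only: sin_of_real cos_of_real mult_ac of_real_0 of_real_1)
  show "sin (z - of_real (\<epsilon> * (2 * pi * real m))) = sin z" "cos (z - of_real (\<epsilon> * (2 * pi * real m))) = cos z"
    using assms r by (auto simp: sin_diff cos_diff sin_add cos_add simp del: of_real_mult)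
qed

locale helicoid_primitives =
  fixes S C :: "real \<Rightarrow> complex \<Rightarrow> complex"
  assumes S': "0 < a \<Longrightarrow> z \<in> slit a \<Longrightarrow> (S a has_field_derivative sin (h_full a z)) (at z)"
    and C': "0 < a \<Longrightarrow> z \<in> slit a \<Longrightarrow> (C a has_field_derivative cos (h_full a z)) (at z)"
    and S0': "Re z \<noteq> 0 \<Longrightarrow> (S 0 has_field_derivative sin (- of_real twist / z)) (at z)"
    and C0': "Re z \<noteq> 0 \<Longrightarrow> (C 0 has_field_derivative cos (- of_real twist / z)) (at z)"
    and real_S: "0 < a \<or> x \<noteq> 0 \<and> a = 0 \<Longrightarrow> Im (S a (of_real x)) = 0"
    and real_C: "0 < a \<or> x \<noteq> 0 \<and> a = 0 \<Longrightarrow> Im (C a (of_real x)) = 0"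
begin

lemma full_family:
  assumes a: "0 < a"
  shows "helicoidal_family {a} UNIV h_full S C"
proof
  let ?tube = "height_domain {a} UNIV"
  have slit: "b = a \<and> cvec p \<in> slit a" if "(b, p) \<in> ?tube" for b p
    using height_in_slit[OF a, of p] that by (auto simp: height_domain_def)
  show h: "(h_full b has_field_derivative of_real twist / ((cvec p)\<^sup>2 + (of_real b)\<^sup>2)) (at (cvec p))"
    if "(b, p) \<in> ?tube" for b p
    using Arctan_derivative_slit[OF a] slit[OF that] by (simp add: h_full_def[abs_def])
  have c: "continuous_on (cvec ` {p. \<bar>p$2\<bar> < height a (p$1)}) (h_full a)"
    by (intro continuous_at_imp_continuous_on ballI) (use h DERIV_isCont in \<open>auto simp: height_domain_def\<close>)
  have "continuous_on ?tube (\<lambda>q. h_full a (cvec (snd q)))"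
    by (rule continuous_on_compose2[OF c]) (auto simp: height_domain_def intro!: continuous_intros)
  then show "continuous_on ?tube (\<lambda>(b, p). h_full b (cvec p))"
    by (rule continuous_on_eq) (auto simp: height_domain_def)
  show "Im (h_full b (of_real x)) = 0" for b x
    by (simp add: h_full_def Arctan_of_real flip: of_real_divide of_real_mult)
  show "(S b has_field_derivative sin (h_full b (cvec p))) (at (cvec p))"
    "(C b has_field_derivative cos (h_full b (cvec p))) (at (cvec p))" if "(b, p) \<in> ?tube" for b p
    using S'[OF a] C'[OF a] slit[OF that] by auto
qed (use a real_S real_C in \<open>auto simp: add_nonneg_pos\<close>)

lemma half_family:
  assumes \<epsilon>: "\<epsilon> = 1 \<or> \<epsilon> = -1"
  shows "helicoidal_family (insert 0 (range scale)) {x. 0 < \<epsilon> * x} h_half S C"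
    (is "helicoidal_family ?A ?J _ _ _")
proof
  let ?tube = "height_domain ?A ?J"
  have H: "open {z. 0 < \<epsilon> * Re z}" by (intro open_Collect_less continuous_intros)
  have A: "a = 0 \<or> (\<exists>n. a = scale n)" if "a \<in> ?A" for a using that by auto
  have nz: "Re (cvec p) \<noteq> 0" "0 < \<epsilon> * Re (cvec p)" "cvec p \<noteq> 0" if "(a, p) \<in> ?tube" for a p
    using that by (auto simp: height_domain_def complex_eq_iff)
  have h0: "h_half 0 z = - of_real twist / z" for z by (simp add: h_half_def Arctan_quotient_def)
  show "open ?J" by (intro open_Collect_less continuous_intros)
  show "convex ?J"
    using \<epsilon> by (auto simp: convex_real_interval lessThan_def[symmetric] greaterThan_def[symmetric])
  have "\<epsilon> \<in> ?J" using \<epsilon> by auto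
  then show "?J \<noteq> {}" by blast
  show "0 < x\<^sup>2 + a\<^sup>2" if "a \<in> ?A" "x \<in> ?J" for a x
    using that(2) by (intro add_pos_nonneg) auto
  show "(h_half a has_field_derivative of_real twist / ((cvec p)\<^sup>2 + (of_real a)\<^sup>2)) (at (cvec p))"
    if ap: "(a, p) \<in> ?tube" for a p
  proof -
    have "a = 0 \<or> (\<exists>n. a = scale n)" using ap A by (auto simp: height_domain_def)
    then show ?thesis
    proof
      assume "a = 0"
      have "((\<lambda>z. - of_real twist / z) has_field_derivative of_real twist / (cvec p)\<^sup>2) (at (cvec p))"
        using nz(3)[OF ap] by (auto intro!: derivative_eq_intros simp: power2_eq_square)
      then show ?thesis by (simp add: \<open>a = 0\<close> h0[abs_def])
    next
      assume "\<exists>n. a = scale n"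
      then obtain n where n: "a = scale n" by blast
      let ?k = "of_real (\<epsilon> * (2 * pi * real (n + 2^24))) :: complex"
      have "cvec p \<in> slit a" using height_in_slit[of a p] scale_pos[of n] n ap by (auto simp: height_domain_def)
      then have "(h_full a has_field_derivative of_real twist / ((cvec p)\<^sup>2 + (of_real a)\<^sup>2)) (at (cvec p))"
        using Arctan_derivative_slit[of a] scale_pos[of n] n by (simp add: h_full_def[abs_def])
      from DERIV_diff[OF this DERIV_const[of ?k]]
      have "((\<lambda>z. h_full a z - ?k) has_field_derivative of_real twist / ((cvec p)\<^sup>2 + (of_real a)\<^sup>2)) (at (cvec p))"
        by simp
      then show ?thesis
        by (rule has_field_derivative_transform_within_open[OF _ H])
          (use nz(2)[OF ap] h_half_eq_h_full[OF \<epsilon>] n in auto)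
    qed
  qed
  show "(S a has_field_derivative sin (h_half a (cvec p))) (at (cvec p))"
    "(C a has_field_derivative cos (h_half a (cvec p))) (at (cvec p))" if ap: "(a, p) \<in> ?tube" for a p
  proof -
    have "a = 0 \<or> (\<exists>n. a = scale n)" using ap A by (auto simp: height_domain_def)
    then have "(S a has_field_derivative sin (h_half a (cvec p))) (at (cvec p)) \<and>
      (C a has_field_derivative cos (h_half a (cvec p))) (at (cvec p))"
    proof
      assume "a = 0"
      then show ?thesis using S0'[OF nz(1)[OF ap]] C0'[OF nz(1)[OF ap]] by (simp add: h0)
    next
      assume "\<exists>n. a = scale n"
      then obtain n where n: "a = scale n" by blast
      have a: "0 < a" using scale_pos n by simp
      have s: "cvec p \<in> slit a" using height_in_slit[OF a] ap by (auto simp: height_domain_def)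
      have "sin (h_half a (cvec p)) = sin (h_full a (cvec p))" "cos (h_half a (cvec p)) = cos (h_full a (cvec p))"
        unfolding n h_half_eq_h_full[OF \<epsilon> nz(2)[OF ap]] by (rule sin_cos_shift[OF \<epsilon>])+
      then show ?thesis using S'[OF a s] C'[OF a s] by simp
    qed
    then show "(S a has_field_derivative sin (h_half a (cvec p))) (at (cvec p))"
      "(C a has_field_derivative cos (h_half a (cvec p))) (at (cvec p))" by auto
  qed
  show "Im (h_half a (of_real x)) = 0" for a x
  proof -
    have "Arctan_quotient (of_real a / of_real x) = of_real (if a / x = 0 then 1 else arctan (a / x) / (a / x))"
      by (simp add: Arctan_quotient_def Arctan_of_real flip: of_real_divide)
    then show ?thesis by (simp add: h_half_def flip: of_real_divide of_real_mult of_real_minus)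
  qed
  show "Im (S a (of_real x)) = 0" "Im (C a (of_real x)) = 0" if "a \<in> ?A" "x \<in> ?J" for a x
    using that A[OF that(1)] scale_pos by (auto intro!: real_S real_C)
  have "continuous_on ?tube (\<lambda>q. Arctan_quotient (of_real (fst q) / cvec (snd q)))"
  proof (rule continuous_on_compose2[OF continuous_on_Arctan_quotient])
    show "continuous_on ?tube (\<lambda>q. of_real (fst q) / cvec (snd q))"
      using nz(3) by (intro continuous_intros) fastforce
    show "(\<lambda>q. of_real (fst q) / cvec (snd q)) ` ?tube \<subseteq> slit 1"
    proof
      fix w assume "w \<in> (\<lambda>q. of_real (fst q) / cvec (snd q)) ` ?tube"
      then obtain a p where w: "(a, p) \<in> ?tube" "w = of_real a / cvec p" by auto
      have "Re w = 0 \<Longrightarrow> w = 0" using nz(1)[OF w(1)] by (auto simp: w(2) Re_divide complex_eq_iff)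
      then show "w \<in> slit 1" by (auto simp: slit_def)
    qed
  qed
  then have "continuous_on ?tube (\<lambda>q. - (of_real twist / cvec (snd q)) * Arctan_quotient (of_real (fst q) / cvec (snd q)))"
    using nz(3) by (intro continuous_intros) fastforce+
  then show "continuous_on ?tube (\<lambda>(a, p). h_half a (cvec p))"
    by (simp add: h_half_def case_prod_unfold)
qed

lemma full_surfaces:
  defines "\<Sigma> \<equiv> \<lambda>n. piece S C UNIV (scale n)"
  shows "properly_embedded_disk (\<Sigma> n)" "minimal_surface (\<Sigma> n)" "0 \<in> \<Sigma> n" "x3_axis \<subseteq> \<Sigma> n"
    and "norm_A_sq (\<Sigma> n) 0 = 2 * twist\<^sup>2 / (scale n)^4"
    and "0 < \<delta> \<Longrightarrow> X \<in> \<Sigma> n - ball 0 \<delta> \<Longrightarrow> norm_A_sq (\<Sigma> n) X \<le> 128 * twist\<^sup>2 * (\<delta>\<^sup>2 + 1) / \<delta>^4"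
    and "\<exists>\<Sigma>1 \<Sigma>2. multi_valued_graph \<Sigma>1 \<and> multi_valued_graph \<Sigma>2 \<and> \<Sigma> n - x3_axis = \<Sigma>1 \<union> \<Sigma>2"
proof -
  interpret helicoidal_family "{scale n}" UNIV h_full S C
    by (rule full_family[OF scale_pos])
  have eq: "\<Sigma> n = surf (scale n)" unfolding \<Sigma>_def by (rule surf_eq_piece[symmetric]) simp
  have a: "scale n \<in> {scale n}" by simp
  have abs: "\<bar>scale n\<bar> \<le> 1" using scale_pos[of n] scale_le_1[of n] by simp
  show "properly_embedded_disk (\<Sigma> n)" unfolding eq by (rule properly_embedded_surf[OF a refl])
  show "minimal_surface (\<Sigma> n)" unfolding eq by (rule curvature_surf(1)[OF a])
  show "0 \<in> \<Sigma> n" "norm_A_sq (\<Sigma> n) 0 = 2 * twist\<^sup>2 / (scale n)^4"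
    unfolding eq using curvature_at_origin[OF a] by auto
  show "x3_axis \<subseteq> \<Sigma> n" unfolding eq using axis_in_surf[OF a] by (auto simp: x3_axis_def)
  show "norm_A_sq (\<Sigma> n) X \<le> 128 * twist\<^sup>2 * (\<delta>\<^sup>2 + 1) / \<delta>^4" if "0 < \<delta>" "X \<in> \<Sigma> n - ball 0 \<delta>"
    using that curvature_bound[OF a abs, of X \<delta>] unfolding eq by (auto simp: dist_norm)
  show "\<exists>\<Sigma>1 \<Sigma>2. multi_valued_graph \<Sigma>1 \<and> multi_valued_graph \<Sigma>2 \<and> \<Sigma> n - x3_axis = \<Sigma>1 \<union> \<Sigma>2"
    unfolding eq by (rule multi_valued_graphs[OF a])
qed

lemma limit_surface:
  assumes \<epsilon>: "\<epsilon> = 1 \<or> \<epsilon> = -1"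
  defines "J \<equiv> {x. 0 < \<epsilon> * x}"
  defines "T \<equiv> piece S C J 0"
  shows "C2_converges_in {X. X$3 \<in> J} (\<lambda>n. piece S C UNIV (scale n)) T"
    and "embedded_disk T" "minimal_surface T" "T \<subseteq> {X. X$3 \<in> J}"
    and "closure T - T = {x. (x$1)\<^sup>2 + (x$2)\<^sup>2 \<le> 1 \<and> x$3 = 0}"
    and "\<exists>\<Sigma>1 \<Sigma>2. spiraling_multi_graph \<Sigma>1 \<and> spiraling_multi_graph \<Sigma>2 \<and> T - x3_axis = \<Sigma>1 \<union> \<Sigma>2"
proof -
  interpret helicoidal_family "insert 0 (range scale)" J h_half S C
    unfolding J_def by (rule half_family[OF \<epsilon>])
  have a: "0 \<in> insert 0 (range scale)" by simp
  have eq: "T = surf 0" unfolding T_def by (rule surf_eq_piece[OF a, symmetric])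
  have axis: "u 0 (vec2 x 0) = - twist / x" for x
    by (simp add: u_def h_half_def Arctan_quotient_def Re_divide cvec_def power2_eq_square)
  have J\<epsilon>: "J = {x. 0 < \<epsilon> * x}" by (simp add: J_def)
  show "C2_converges_in {X. X$3 \<in> J} (\<lambda>n. piece S C UNIV (scale n)) T"
    unfolding eq
  proof (rule converges[OF _ a])
    show "compact (insert 0 (range scale))" by (rule compact_sequence_with_limit[OF scale_tendsto_0])
    show "piece S C UNIV (scale n) \<inter> {X. X$3 \<in> J} = surf (scale n)" for n
      unfolding piece_Int by (rule surf_eq_piece[symmetric]) simp
  qed (use scale_tendsto_0 in auto)
  show "embedded_disk T"
    unfolding eq by (rule embedded_disk_surf[OF a]) (unfold J_def, rule half_line_homeomorphic[OF \<epsilon>])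
  show "minimal_surface T" unfolding eq by (rule curvature_surf(1)[OF a])
  show "T \<subseteq> {X. X$3 \<in> J}" by (auto simp: T_def piece_def vector_3)
  show "closure T - T = {x. (x$1)\<^sup>2 + (x$2)\<^sup>2 \<le> 1 \<and> x$3 = 0}"
    unfolding eq by (rule closure_surf_minus_surf[OF \<epsilon> J\<epsilon> a axis])
  show "\<exists>\<Sigma>1 \<Sigma>2. spiraling_multi_graph \<Sigma>1 \<and> spiraling_multi_graph \<Sigma>2 \<and> T - x3_axis = \<Sigma>1 \<union> \<Sigma>2"
    unfolding eq by (rule spiraling_halves[OF \<epsilon> J\<epsilon> a axis])
qed

end

theorem theorem1p1:
  shows "\<exists>\<Sigma> :: nat \<Rightarrow> (real^3) set.
    (\<forall>i. properly_embedded_disk (\<Sigma> i) \<and> minimal_surface (\<Sigma> i) \<and>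
         0 \<in> \<Sigma> i \<and> \<Sigma> i \<subseteq> solid_cylinder \<and> x3_axis \<subseteq> \<Sigma> i) \<and>
    filterlim (\<lambda>i. norm_A_sq (\<Sigma> i) 0) at_top sequentially \<and>
    (\<forall>\<delta>>0. (SUP i. SUP p \<in> \<Sigma> i - ball 0 \<delta>. ereal (norm_A_sq (\<Sigma> i) p)) < \<infinity>) \<and>
    (\<forall>i. \<exists>\<Sigma>1 \<Sigma>2. multi_valued_graph \<Sigma>1 \<and> multi_valued_graph \<Sigma>2 \<and>
         \<Sigma> i - x3_axis = \<Sigma>1 \<union> \<Sigma>2) \<and>
    (\<exists>\<Sigma>p \<Sigma>m.
       C2_converges_in {x. x$3 > 0} \<Sigma> \<Sigma>p \<and> C2_converges_in {x. x$3 < 0} \<Sigma> \<Sigma>m \<and>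
       embedded_disk \<Sigma>p \<and> minimal_surface \<Sigma>p \<and> \<Sigma>p \<subseteq> {x. x$3 > 0} \<and>
       embedded_disk \<Sigma>m \<and> minimal_surface \<Sigma>m \<and> \<Sigma>m \<subseteq> {x. x$3 < 0} \<and>
       closure \<Sigma>p - \<Sigma>p = {x. (x$1)\<^sup>2 + (x$2)\<^sup>2 \<le> 1 \<and> x$3 = 0} \<and>
       closure \<Sigma>m - \<Sigma>m = {x. (x$1)\<^sup>2 + (x$2)\<^sup>2 \<le> 1 \<and> x$3 = 0} \<and>
       (\<exists>\<Sigma>1 \<Sigma>2. spiraling_multi_graph \<Sigma>1 \<and> spiraling_multi_graph \<Sigma>2 \<and>
          \<Sigma>p - x3_axis = \<Sigma>1 \<union> \<Sigma>2) \<and>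
       (\<exists>\<Sigma>1 \<Sigma>2. spiraling_multi_graph \<Sigma>1 \<and> spiraling_multi_graph \<Sigma>2 \<and>
          \<Sigma>m - x3_axis = \<Sigma>1 \<union> \<Sigma>2))"
proof -
  have sin: "sin holomorphic_on UNIV" "\<And>z. Im z = 0 \<Longrightarrow> Im (sin z) = 0"
    and cos: "cos holomorphic_on UNIV" "\<And>z. Im z = 0 \<Longrightarrow> Im (cos z) = 0"
    by (auto simp: Re_Im_sin_cos intro!: holomorphic_intros)
  obtain S :: "real \<Rightarrow> complex \<Rightarrow> complex" where
    S1: "\<forall>a>0. (\<forall>z\<in>slit a. (S a has_field_derivative sin (of_real (twist / a) * Arctan (z / of_real a))) (at z)) \<and>
      (\<forall>x. Im (S a (of_real x)) = 0)"
    and S2: "\<forall>z. Re z \<noteq> 0 \<longrightarrow> (S 0 has_field_derivative sin (- of_real twist / z)) (at z)"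
    and S3: "\<forall>x. x \<noteq> 0 \<longrightarrow> Im (S 0 (of_real x)) = 0"
    using primitive_family[OF sin] by blast
  obtain C :: "real \<Rightarrow> complex \<Rightarrow> complex" where
    C1: "\<forall>a>0. (\<forall>z\<in>slit a. (C a has_field_derivative cos (of_real (twist / a) * Arctan (z / of_real a))) (at z)) \<and>
      (\<forall>x. Im (C a (of_real x)) = 0)"
    and C2: "\<forall>z. Re z \<noteq> 0 \<longrightarrow> (C 0 has_field_derivative cos (- of_real twist / z)) (at z)"
    and C3: "\<forall>x. x \<noteq> 0 \<longrightarrow> Im (C 0 (of_real x)) = 0"
    using primitive_family[OF cos] by blast
  interpret helicoid_primitives S C
  proof
    show "Im (S a (of_real x)) = 0" "Im (C a (of_real x)) = 0" if "0 < a \<or> x \<noteq> 0 \<and> a = 0" for a x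
      using that S1 S3 C1 C3 by auto
  qed (use S1 S2 C1 C2 in \<open>simp_all add: h_full_def\<close>)
  let ?\<Sigma> = "\<lambda>n. piece S C UNIV (scale n)"
  note F = full_surfaces
  note signs = mem_Collect_eq mult_1 mult_minus1 neg_0_less_iff_less
  note P = limit_surface[OF disjI1[OF refl], unfolded signs]
    and M = limit_surface[OF disjI2[OF refl], unfolded signs]
  have cyl: "?\<Sigma> n \<subseteq> solid_cylinder" for n
    using F(1)[of n] by (simp add: properly_embedded_disk_def)
  have lim: "filterlim (\<lambda>n. norm_A_sq (?\<Sigma> n) 0) at_top sequentially"
    unfolding F(5) unfolding scale_def twist_def by real_asymp
  have sup: "(SUP i. SUP p \<in> ?\<Sigma> i - ball 0 \<delta>. ereal (norm_A_sq (?\<Sigma> i) p)) < \<infinity>" if "0 < \<delta>" for \<delta>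
  proof -
    have "(SUP i. SUP p \<in> ?\<Sigma> i - ball 0 \<delta>. ereal (norm_A_sq (?\<Sigma> i) p))
        \<le> ereal (128 * twist\<^sup>2 * (\<delta>\<^sup>2 + 1) / \<delta>^4)"
      using F(6)[OF that] by (intro SUP_least) simp
    also have "\<dots> < \<infinity>" by simp
    finally show ?thesis .
  qed
  show ?thesis
  proof (rule exI[of _ ?\<Sigma>], intro conjI allI impI F(1-4,7) cyl lim sup, assumption)
    show "\<exists>\<Sigma>p \<Sigma>m.
       C2_converges_in {x. x$3 > 0} ?\<Sigma> \<Sigma>p \<and> C2_converges_in {x. x$3 < 0} ?\<Sigma> \<Sigma>m \<and>
       embedded_disk \<Sigma>p \<and> minimal_surface \<Sigma>p \<and> \<Sigma>p \<subseteq> {x. x$3 > 0} \<and>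
       embedded_disk \<Sigma>m \<and> minimal_surface \<Sigma>m \<and> \<Sigma>m \<subseteq> {x. x$3 < 0} \<and>
       closure \<Sigma>p - \<Sigma>p = {x. (x$1)\<^sup>2 + (x$2)\<^sup>2 \<le> 1 \<and> x$3 = 0} \<and>
       closure \<Sigma>m - \<Sigma>m = {x. (x$1)\<^sup>2 + (x$2)\<^sup>2 \<le> 1 \<and> x$3 = 0} \<and>
       (\<exists>\<Sigma>1 \<Sigma>2. spiraling_multi_graph \<Sigma>1 \<and> spiraling_multi_graph \<Sigma>2 \<and>
          \<Sigma>p - x3_axis = \<Sigma>1 \<union> \<Sigma>2) \<and>
       (\<exists>\<Sigma>1 \<Sigma>2. spiraling_multi_graph \<Sigma>1 \<and> spiraling_multi_graph \<Sigma>2 \<and>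
          \<Sigma>m - x3_axis = \<Sigma>1 \<union> \<Sigma>2)"
      by (rule exI[of _ "piece S C {x. 0 < x} 0"], rule exI[of _ "piece S C {x. x < 0} 0"],
          intro conjI P M)
  qed
qed

end
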